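(* Let $k\ge 1$, $m\ge 2$ be integers and $\lambda\in\mathbb C^*=\mathbb C\setminus\{0\}$. Let $\mathcal R=\mathcal R_{(H,\Phi)}$ be the graph recursion operator on $\mathcal G_k$ associated with a gluing data $(H,\Phi)$ with parameters $k,m$, and let $F_\lambda:\mathbb P^{2^k-1}\dashrightarrow\mathbb P^{2^k-1}$ be the associated renormalization map. The variety $\mathcal M\subset\mathbb P^{2^k-1}$ defined in the context is a $k$-dimensional algebraic variety that is invariant under $F_\lambda$, i.e. $F_\lambda(\mathcal M\setminus \mathrm I(F_\lambda))\subset\mathcal M$. Moreover, with $N$ and $\mathcal M_0\subset\mathcal M$ as in the context, the following hold. (i) If $\mathcal R$ is non-degenerate, then the iterate $F_\lambda^N$ retracts $\mathcal M$ to the subvariety $\mathcal M_0$, of some dimension $k_0\le k$, which consists entirely of fixed points: $F_\lambda^N(\mathcal M\setminus \mathrm I(F^N_\lambda))\subset\mathcal M_0$, and $F_\lambda^N(\xi)=\xi$ for every $\xi\in\mathcal M_0\setminus \mathrm I(F_\lambda^N)$. (ii) If $\mathcal R$ is non-degenerate and expanding, then $\mathcal M_0$ is transversally superattracting, i.e. $F_\lambda^N$ is transversally superattracting on $\mathcal M_0\setminus \mathrm I(F_\lambda^N)$. (iii) If $\mathcal R$ is non-degenerate and expanding and $\lambda\in\mathbb R_+=(0,\infty)$, then for every starting graph $G_0\in\mathcal G_k$ the orbit $(F_\lambda^n(\xi_0))_{n\ge0}$ of the point $\xi_0=\phi_\lambda(G_0)$ converges to $\mathcal M$ (i.e. every limit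 point of the orbit lies in $\mathcal M$).
   Context: Graphs are finite and undirected; multiple edges allowed, no loops. $\mathcal G_k$ is the set of graphs with $k$ distinct marked vertices labeled $1,\dots,k$. Gluing data and recursion. A gluing data with parameters $k\ge1,m\ge2$ is a pair $(H,\Phi)$: $H$ is a hypergraph with $V(H)=\{1,\dots,m\}$ and a finite multiset $E(H)$ of edges (nonempty subsets of $V(H)$), each edge $e$ carrying a label $\ell(e)\in\{1,\dots,k\}$ such that for each $j$ the edges labeled $j$ form a partition of $V(H)$; $\Phi:\{1,\dots,k\}\to E(H)$ is injective. For $G\in\mathcal G_k$, the graph $\mathcal R(G)=\mathcal R_{(H,\Phi)}(G)\in\mathcal G_k$ is obtained by taking $m$ disjoint copies $G(1),\dots,G(m)$ of $G$, identifying, for each $e\in E(H)$, the vertices labeled $\ell(e)$ in the copies $G(i)$, $i\in e$, and then giving the new label $j$ to the vertex corresponding to the edge $\Phi(j)$, $j=1,\dots,k$ (old labels are forgotten). Label dynamics. $\Lambda:\{1,\dots,k\}\to\{1,\dots,k\}$, $\Lambda(j)=\ell(\Phi(j))$. A label $j$ is periodic if $\Lambda^p(j)=j$ for some $p\ge1$, and critical if $\#\Phi(j)\ge2$. $\mathcal R$ is non-degenerate if no periodic label is critical. The $n$-th iterate $\mathcal R^n$ is the recursion of a gluing data $(H_n,\Phi_n)$ with parameters $k,m^n$: $\mathcal R^n(G)$ is glued from $m^n$ copies of $G$ indexed by $V(H_n)=\{1,\dots,m\}^n$, and $\Phi_n(j)=\Phi(j)\times\Phi(\Lambda(j))\times\cdots\times\Phi(\Lambda^{n-1}(j))\subset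 V(H_n)$ is the set of copies containing the vertex labeled $j$ of $\mathcal R^n(G)$. $\mathcal R$ is expanding if for some $n\ge1$ the sets $\Phi_n(1),\dots,\Phi_n(k)$ are pairwise disjoint. Renormalization map. Denote the coordinates on $\mathbb C^{2^k}$ by $(\mathbf x)$, $\mathbf x\in\{0,1\}^k$. For $\mathbf x\in\{0,1\}^k$ and $\eta:E(H)\setminus\Phi(\{1,\dots,k\})\to\{0,1\}$ let $\mathbf x\wedge\eta:E(H)\to\{0,1\}$ be the map with value $x_j$ on $\Phi(j)$ and $\eta(e)$ on the remaining edges $e$. For $i\in\{1,\dots,m\}$ let $[\mathbf x\wedge\eta]_i\in\{0,1\}^k$ be the tuple whose $j$-th entry is the value of $\mathbf x\wedge\eta$ on the unique edge labeled $j$ that contains $i$. Let $\|\mathbf x\wedge\eta\|_H=\sum_{e:(\mathbf x\wedge\eta)(e)=1}(\#e-1)$. For $\lambda\in\mathbb C^*$ the homogeneous polynomial map $\widehat F_\lambda:\mathbb C^{2^k}\to\mathbb C^{2^k}$ of degree $m$ sends the point with coordinates $(\mathbf x)$ to the point with coordinates $(\mathbf x)'=\sum_\eta\lambda^{-\|\mathbf x\wedge\eta\|_H}\prod_{i=1}^m([\mathbf x\wedge\eta]_i)$. The induced rational self-map $F_\lambda$ of $\mathbb P^{2^k-1}$ is the renormalization map. $\mathrm I(F_\lambda^n)$ denotes the indeterminacy set of $F^n_\lambda$: the points at which the iterate $F_\lambda^n$ is not well-defined (i.e. $\widehat F_\lambda^n$ vanishes on lifts). For $G\in\mathcal G_k$,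 $\phi_\lambda(G)\in\mathbb P^{2^k-1}$ is the point with homogeneous coordinates $(\mathbf x)=Z_G^{\mathbf x}(\lambda)$, where $Z_G^{\mathbf x}(\lambda)=\sum_I\lambda^{\#I}$, the sum over independent sets $I\subset V(G)$ such that, for each $j$, the vertex labeled $j$ is in $I$ iff $x_j=1$. One has $F_\lambda(\phi_\lambda(G))=\phi_\lambda(\mathcal R(G))$ whenever these are defined; for $\lambda>0$ they are always defined. The varieties. $\mathcal M\subset\mathbb P^{2^k-1}$ is defined by the equations $(\mathbf x)(\mathbf y)=(\mathbf z)(\mathbf w)$ for all $\mathbf x,\mathbf y,\mathbf z,\mathbf w\in\{0,1\}^k$ with $\mathbf x+\mathbf y=\mathbf z+\mathbf w$ (componentwise integer sum). Fix $N\ge1$ with $\Lambda^{2N}=\Lambda^N$; $\mathcal M_0=\mathcal M_0(\lambda)$ is the Zariski closure of $F_\lambda^N(\mathcal M\setminus \mathrm I(F_\lambda^N))$. Transversal superattraction. If $\mathcal Y$ is a submanifold of a complex manifold $\mathcal X$ and $F$ is a holomorphic map from a neighborhood of $\mathcal Y$ to $\mathcal X$ fixing $\mathcal Y$ pointwise, then $F$ is transversally superattracting on $\mathcal Y$ if at every $p\in\mathcal Y$ the characteristic polynomial of $DF(p)$ is $(z-1)^{\dim\mathcal Y}z^{\dim\mathcal X-\dim\mathcal Y}$. *)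

theory Defs
  imports "HOL-Analysis.Analysis" "HOL-Library.Multiset" "HOL-Library.Disjoint_Sets"
    "Jordan_Normal_Form.Char_Poly"
begin

hide_const (open) Matrix.vec_index
hide_type (open) Matrix.vec
no_notation Matrix.vec_index (infixl \<open>$\<close> 100)

section \<open>Gluing data\<close>

text \<open>
  \<open>'k\<close> is the set of labels, \<open>'m\<close> the vertex set of the hypergraph. The multiset of hyperedges is
  an indexed family: \<open>ends e\<close> is the vertex set of the edge \<open>e \<in> edges D\<close>, so that parallel edges
  remain distinguishable and \<open>Phi\<close> can be injective.
\<close>

record ('e, 'k, 'm) gluing =
  edges :: "'e set"
  ends :: "'e \<Rightarrow> 'm set"
  elabel :: "'e \<Rightarrow> 'k"
  Phi :: "'k \<Rightarrow> 'e"

definition gluing_data :: "('e, 'k::finite, 'm::finite) gluing \<Rightarrow> bool" where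
  "gluing_data D \<longleftrightarrow>
     finite (edges D) \<and>
     (\<forall>j. inj_on (ends D) {e \<in> edges D. elabel D e = j} \<and>
          partition_on UNIV (ends D ` {e \<in> edges D. elabel D e = j})) \<and>
     inj (Phi D) \<and> range (Phi D) \<subseteq> edges D"

definition label_map :: "('e, 'k, 'm) gluing \<Rightarrow> 'k \<Rightarrow> 'k" where
  "label_map D j = elabel D (Phi D j)"

definition periodic_label :: "('e, 'k, 'm) gluing \<Rightarrow> 'k \<Rightarrow> bool" where
  "periodic_label D j \<longleftrightarrow> (\<exists>p\<ge>1. (label_map D ^^ p) j = j)"

definition critical_label :: "('e, 'k, 'm) gluing \<Rightarrow> 'k \<Rightarrow> bool" where
  "critical_label D j \<longleftrightarrow> card (ends D (Phi D j)) \<ge> 2"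

definition nondegenerate :: "('e, 'k, 'm) gluing \<Rightarrow> bool" where
  "nondegenerate D \<longleftrightarrow> (\<forall>j. periodic_label D j \<longrightarrow> \<not> critical_label D j)"

text \<open>The product \<open>\<Phi>(j) \<times> \<Phi>(\<Lambda>(j)) \<times> \<dots> \<times> \<Phi>(\<Lambda>\<^sup>n\<^sup>-\<^sup>1(j))\<close>, with \<open>n\<close>-tuples as lists.\<close>

definition Phi_iter :: "('e, 'k, 'm) gluing \<Rightarrow> nat \<Rightarrow> 'k \<Rightarrow> 'm list set" where
  "Phi_iter D n j =
     {w. length w = n \<and> (\<forall>i<n. w ! i \<in> ends D (Phi D ((label_map D ^^ i) j)))}"

definition expanding :: "('e, 'k, 'm) gluing \<Rightarrow> bool" where
  "expanding D \<longleftrightarrow> (\<exists>n\<ge>1. disjoint_family (Phi_iter D n))"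


section \<open>Complex projective space\<close>

text \<open>
  \<open>'i proj\<close> is the projective space with homogeneous coordinates indexed by \<open>'i\<close>, of complex
  dimension \<open>CARD('i) - 1\<close>. \<open>abs_proj v\<close> is the point with homogeneous coordinates \<open>v\<close>; it is
  unspecified for \<open>v = 0\<close>. \<open>rep_proj p\<close> is some lift of \<open>p\<close>.
\<close>

definition proj_rel :: "complex ^ 'i \<Rightarrow> complex ^ 'i \<Rightarrow> bool" where
  "proj_rel u v \<longleftrightarrow> u \<noteq> 0 \<and> v \<noteq> 0 \<and> (\<exists>c. c \<noteq> 0 \<and> v = c *s u)"

quotient_type (overloaded) 'i proj = "complex ^ ('i::finite)" / partial: proj_rel
proof (rule part_equivpI)
  show "\<exists>v :: complex ^ 'i. proj_rel v v"
    by (rule exI[of _ "1"]) (auto simp: proj_rel_def intro!: exI[of _ 1])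
  show "symp (proj_rel :: complex ^ 'i \<Rightarrow> _)"
  proof (rule sympI)
    fix u v :: "complex ^ 'i"
    assume "proj_rel u v"
    then obtain c where c: "u \<noteq> 0" "v \<noteq> 0" "c \<noteq> 0" "v = c *s u"
      by (auto simp: proj_rel_def)
    then have "u = inverse c *s v"
      by (simp add: vector_smult_assoc)
    with c show "proj_rel v u"
      unfolding proj_rel_def using nonzero_imp_inverse_nonzero by blast
  qed
  show "transp (proj_rel :: complex ^ 'i \<Rightarrow> _)"
  proof (rule transpI)
    fix u v w :: "complex ^ 'i"
    assume "proj_rel u v" "proj_rel v w"
    then obtain c d where "u \<noteq> 0" "v \<noteq> 0" "w \<noteq> 0" "c \<noteq> 0" "v = c *s u" "d \<noteq> 0" "w = d *s v"
      by (auto simp: proj_rel_def)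
    then have "w = (d * c) *s u" "d * c \<noteq> 0" "u \<noteq> 0" "w \<noteq> 0"
      by (simp_all add: vector_smult_assoc)
    then show "proj_rel u w"
      unfolding proj_rel_def by blast
  qed
qed

text \<open>The quotient topology.\<close>

instantiation proj :: (finite) topological_space
begin

definition open_proj :: "'a proj set \<Rightarrow> bool" where
  "open_proj S \<longleftrightarrow> open {v. v \<noteq> 0 \<and> abs_proj v \<in> S}"

instance
proof
  have "open (- {0 :: complex ^ 'a})"
    by (intro open_Compl closed_singleton)
  also have "- {0 :: complex ^ 'a} = {v. v \<noteq> 0 \<and> abs_proj v \<in> UNIV}"
    by auto
  finally show "open (UNIV :: 'a proj set)"
    unfolding open_proj_def .
next
  fix S T :: "'a proj set"
  assume "open S" "open T"
  then have "open ({v. v \<noteq> 0 \<and> abs_proj v \<in> S} \<inter> {v. v \<noteq> 0 \<and> abs_proj v \<in> T})"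
    unfolding open_proj_def by (rule open_Int)
  moreover have "{v. v \<noteq> 0 \<and> abs_proj v \<in> S} \<inter> {v. v \<noteq> 0 \<and> abs_proj v \<in> T} =
      {v. v \<noteq> 0 \<and> abs_proj v \<in> S \<inter> T}"
    by auto
  ultimately show "open (S \<inter> T)"
    unfolding open_proj_def by simp
next
  fix K :: "'a proj set set"
  assume "\<forall>S\<in>K. open S"
  then have "open (\<Union>S\<in>K. {v. v \<noteq> 0 \<and> abs_proj v \<in> S})"
    unfolding open_proj_def by (intro open_UN) auto
  moreover have "(\<Union>S\<in>K. {v. v \<noteq> 0 \<and> abs_proj v \<in> S}) = {v. v \<noteq> 0 \<and> abs_proj v \<in> \<Union>K}"
    by auto
  ultimately show "open (\<Union>K)"
    unfolding open_proj_def by simp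
qed

end

text \<open>
  The rational self-map induced by a homogeneous polynomial map \<open>f\<close>; it is meaningful off
  \<open>proj_indet f\<close> only.
\<close>

definition proj_map :: "(complex ^ 'i \<Rightarrow> complex ^ 'i) \<Rightarrow> 'i::finite proj \<Rightarrow> 'i proj" where
  "proj_map f p = abs_proj (f (rep_proj p))"

definition proj_indet :: "(complex ^ 'i \<Rightarrow> complex ^ 'i) \<Rightarrow> 'i::finite proj set" where
  "proj_indet f = {abs_proj v |v. v \<noteq> 0 \<and> f v = 0}"


section \<open>Zariski topology\<close>

text \<open>Polynomials over \<open>\<complex>\<close> are identified with polynomial functions.\<close>

inductive poly_fun :: "(complex ^ 'i \<Rightarrow> complex) \<Rightarrow> bool" where
  poly_fun_const: "poly_fun (\<lambda>v. c)"
| poly_fun_coord: "poly_fun (\<lambda>v. v $ i)"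
| poly_fun_add: "poly_fun f \<Longrightarrow> poly_fun g \<Longrightarrow> poly_fun (\<lambda>v. f v + g v)"
| poly_fun_mult: "poly_fun f \<Longrightarrow> poly_fun g \<Longrightarrow> poly_fun (\<lambda>v. f v * g v)"

definition homogeneous_poly :: "(complex ^ 'i \<Rightarrow> complex) \<Rightarrow> bool" where
  "homogeneous_poly f \<longleftrightarrow> poly_fun f \<and> (\<exists>d. \<forall>c v. f (c *s v) = c ^ d * f v)"

definition zariski_closed :: "'i::finite proj set \<Rightarrow> bool" where
  "zariski_closed V \<longleftrightarrow>
     (\<exists>P. (\<forall>f\<in>P. homogeneous_poly f) \<and> V = {abs_proj v |v. v \<noteq> 0 \<and> (\<forall>f\<in>P. f v = 0)})"

definition zariski_closure :: "'i::finite proj set \<Rightarrow> 'i proj set" where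
  "zariski_closure S = zariski_closed hull S"

text \<open>Varieties are irreducible by convention.\<close>

definition proj_variety :: "'i::finite proj set \<Rightarrow> bool" where
  "proj_variety V \<longleftrightarrow> zariski_closed V \<and> V \<noteq> {} \<and>
     (\<forall>A B. zariski_closed A \<longrightarrow> zariski_closed B \<longrightarrow> V \<subseteq> A \<union> B \<longrightarrow> V \<subseteq> A \<or> V \<subseteq> B)"


section \<open>Complex submanifolds of projective space and transversal superattraction\<close>

text \<open>
  A function on an open subset of projective space is holomorphic iff its pullback under the
  holomorphic submersion \<open>abs_proj\<close> from the nonzero vectors is complex differentiable.
\<close>

definition proj_holomorphic_on :: "('i::finite proj \<Rightarrow> complex) \<Rightarrow> 'i proj set \<Rightarrow> bool" where
  "proj_holomorphic_on g W \<longleftrightarrow>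
     (\<forall>v. v \<noteq> 0 \<and> abs_proj v \<in> W \<longrightarrow>
        (\<exists>L. ((\<lambda>u. g (abs_proj u)) has_derivative L) (at v) \<and> (\<forall>c h. L (c *s h) = c * L h)))"

text \<open>
  Submanifolds of dimension \<open>d\<close>, given locally as the common zeros of \<open>r = (CARD('i) - 1) - d\<close>
  holomorphic functions with linearly independent differentials. Independence can be tested on the
  pullbacks, again because \<open>abs_proj\<close> is a submersion.
\<close>

definition proj_submanifold :: "nat \<Rightarrow> 'i::finite proj set \<Rightarrow> bool" where
  "proj_submanifold d Y \<longleftrightarrow>
     (\<exists>r. d + r + 1 = CARD('i) \<and>
        (\<forall>p\<in>Y. \<exists>W (g :: nat \<Rightarrow> 'i proj \<Rightarrow> complex).
           open W \<and> p \<in> W \<and> (\<forall>i<r. proj_holomorphic_on (g i) W) \<and>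
           Y \<inter> W = {q \<in> W. \<forall>i<r. g i q = 0} \<and>
           (\<forall>v c. v \<noteq> 0 \<and> abs_proj v \<in> W \<and>
              (\<forall>h. (\<Sum>i<r. c i * frechet_derivative (\<lambda>u. g i (abs_proj u)) (at v) h) = 0)
                \<longrightarrow> (\<forall>i<r. c i = 0))))"

text \<open>The dimension of a variety is the (maximal) dimension of its manifold of smooth points.\<close>

definition proj_dim :: "'i::finite proj set \<Rightarrow> nat \<Rightarrow> bool" where
  "proj_dim V d \<longleftrightarrow>
     (\<exists>W. open W \<and> V \<inter> W \<noteq> {} \<and> proj_submanifold d (V \<inter> W)) \<and>
     (\<forall>d' W. open W \<and> V \<inter> W \<noteq> {} \<and> proj_submanifold d' (V \<inter> W) \<longrightarrow> d' \<le> d)"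

definition chart_dom :: "'i \<Rightarrow> 'i::finite proj set" where
  "chart_dom a = {p. rep_proj p $ a \<noteq> 0}"

text \<open>
  The \<open>i\<close>-th affine coordinate on \<open>chart_dom a\<close>. The coordinate with \<open>i = a\<close> is constantly 1, and
  those with \<open>i \<noteq> a\<close> form the standard chart.
\<close>

definition aff_coord :: "'i \<Rightarrow> 'i \<Rightarrow> 'i::finite proj \<Rightarrow> complex" where
  "aff_coord a i p = rep_proj p $ i / rep_proj p $ a"

definition proj_holomorphic_map_on ::
    "('i::finite proj \<Rightarrow> 'i proj) \<Rightarrow> 'i proj set \<Rightarrow> bool" where
  "proj_holomorphic_map_on F W \<longleftrightarrow> continuous_on W F \<and>
     (\<forall>a i. proj_holomorphic_on (\<lambda>p. aff_coord a i (F p)) {p \<in> W. F p \<in> chart_dom a})"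

text \<open>Partial derivatives at a fixed point \<open>p\<close> of \<open>F\<close>, in the chart \<open>a\<close> around \<open>p\<close>.\<close>

definition jacobian_entry ::
    "('i::finite proj \<Rightarrow> 'i proj) \<Rightarrow> 'i \<Rightarrow> 'i proj \<Rightarrow> 'i \<Rightarrow> 'i \<Rightarrow> complex" where
  "jacobian_entry F a p i j =
     deriv (\<lambda>t. aff_coord a i (F (abs_proj ((\<chi> l. aff_coord a l p) + t *s axis j 1)))) 0"

text \<open>
  The Jacobian matrix with rows and columns indexed by \<open>UNIV - {a}\<close>, enumerated by \<open>e\<close>.
\<close>

definition jacobian_mat ::
    "('i::finite proj \<Rightarrow> 'i proj) \<Rightarrow> 'i \<Rightarrow> (nat \<Rightarrow> 'i) \<Rightarrow> 'i proj \<Rightarrow> complex mat" where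
  "jacobian_mat F a e p =
     Matrix.mat (CARD('i) - 1) (CARD('i) - 1) (\<lambda>(r, s). jacobian_entry F a p (e r) (e s))"

definition transversally_superattracting ::
    "('i::finite proj \<Rightarrow> 'i proj) \<Rightarrow> 'i proj set \<Rightarrow> bool" where
  "transversally_superattracting F Y \<longleftrightarrow>
     (\<exists>d. proj_submanifold d Y \<and>
        (\<exists>W. open W \<and> Y \<subseteq> W \<and> proj_holomorphic_map_on F W) \<and>
        (\<forall>p\<in>Y. F p = p) \<and>
        (\<forall>p\<in>Y. \<forall>a e. p \<in> chart_dom a \<and> bij_betw e {..<CARD('i) - 1} (UNIV - {a}) \<longrightarrow>
           char_poly (jacobian_mat F a e p) = [:-1, 1:] ^ d * [:0, 1:] ^ (CARD('i) - 1 - d)))"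


section \<open>The renormalization map\<close>

text \<open>
  Coordinates are indexed by \<open>'k \<Rightarrow> bool\<close>, which plays the role of \<open>{0,1}\<^sup>k\<close>.
\<close>

definition wedge :: "('e, 'k, 'm) gluing \<Rightarrow> ('k \<Rightarrow> bool) \<Rightarrow> ('e \<Rightarrow> bool) \<Rightarrow> 'e \<Rightarrow> bool" where
  "wedge D x \<eta> e = (if e \<in> range (Phi D) then x (the_inv (Phi D) e) else \<eta> e)"

definition edge_at :: "('e, 'k, 'm) gluing \<Rightarrow> 'k \<Rightarrow> 'm \<Rightarrow> 'e" where
  "edge_at D j i = (THE e. e \<in> edges D \<and> elabel D e = j \<and> i \<in> ends D e)"

definition copy_tuple :: "('e, 'k, 'm) gluing \<Rightarrow> ('e \<Rightarrow> bool) \<Rightarrow> 'm \<Rightarrow> 'k \<Rightarrow> bool" where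
  "copy_tuple D y i = (\<lambda>j. y (edge_at D j i))"

definition wedge_norm :: "('e, 'k, 'm) gluing \<Rightarrow> ('e \<Rightarrow> bool) \<Rightarrow> nat" where
  "wedge_norm D y = (\<Sum>e \<in> {e \<in> edges D. y e}. card (ends D e) - 1)"

definition renorm_hat ::
    "('e, 'k::finite, 'm::finite) gluing \<Rightarrow> complex \<Rightarrow>
     complex ^ ('k \<Rightarrow> bool) \<Rightarrow> complex ^ ('k \<Rightarrow> bool)" where
  "renorm_hat D lam v =
     (\<chi> x. \<Sum>\<eta> \<in> (edges D - range (Phi D)) \<rightarrow>\<^sub>E UNIV.
        inverse lam ^ wedge_norm D (wedge D x \<eta>) *
        (\<Prod>i\<in>UNIV. v $ copy_tuple D (wedge D x \<eta>) i))"

abbreviation renorm_map ::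
    "('e, 'k::finite, 'm::finite) gluing \<Rightarrow> complex \<Rightarrow> nat \<Rightarrow>
     ('k \<Rightarrow> bool) proj \<Rightarrow> ('k \<Rightarrow> bool) proj" where
  "renorm_map D lam n \<equiv> proj_map (renorm_hat D lam ^^ n)"

abbreviation renorm_indet ::
    "('e, 'k::finite, 'm::finite) gluing \<Rightarrow> complex \<Rightarrow> nat \<Rightarrow> ('k \<Rightarrow> bool) proj set" where
  "renorm_indet D lam n \<equiv> proj_indet (renorm_hat D lam ^^ n)"

definition M_var :: "('k::finite \<Rightarrow> bool) proj set" where
  "M_var = {p. \<forall>x y z w.
     (\<forall>j. of_bool (x j) + of_bool (y j) = (of_bool (z j) + of_bool (w j) :: int)) \<longrightarrow>
     rep_proj p $ x * rep_proj p $ y = rep_proj p $ z * rep_proj p $ w}"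

definition M0_var ::
    "('e, 'k::finite, 'm::finite) gluing \<Rightarrow> complex \<Rightarrow> nat \<Rightarrow> ('k \<Rightarrow> bool) proj set" where
  "M0_var D lam N = zariski_closure (renorm_map D lam N ` (M_var - renorm_indet D lam N))"


section \<open>Marked graphs and their independence polynomials\<close>

record ('v, 'k) mgraph =
  gverts :: "'v set"
  gedges :: "'v set multiset"
  gmark :: "'k \<Rightarrow> 'v"

definition marked_graph :: "('v, 'k) mgraph \<Rightarrow> bool" where
  "marked_graph G \<longleftrightarrow> finite (gverts G) \<and> (\<forall>e\<in>#gedges G. e \<subseteq> gverts G \<and> card e = 2) \<and>
     inj (gmark G) \<and> range (gmark G) \<subseteq> gverts G"

definition independent_set :: "('v, 'k) mgraph \<Rightarrow> 'v set \<Rightarrow> bool" where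
  "independent_set G I \<longleftrightarrow> I \<subseteq> gverts G \<and> (\<forall>e\<in>#gedges G. \<not> e \<subseteq> I)"

definition indep_poly :: "('v, 'k) mgraph \<Rightarrow> ('k \<Rightarrow> bool) \<Rightarrow> complex \<Rightarrow> complex" where
  "indep_poly G x lam =
     (\<Sum>I \<in> {I. independent_set G I \<and> (\<forall>j. gmark G j \<in> I \<longleftrightarrow> x j)}. lam ^ card I)"

definition graph_point :: "complex \<Rightarrow> ('v, 'k::finite) mgraph \<Rightarrow> ('k \<Rightarrow> bool) proj" where
  "graph_point lam G = abs_proj (\<chi> x. indep_poly G x lam)"

end

theory Submission
  imports Defs "Jordan_Normal_Form.Schur_Decomposition"
begin

text \<open>
  Throughout, \<open>u\<^sub>j \<in> \<complex>\<^sup>2\<close> stands for \<open>u j\<close>, and the coordinates of the product vector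
  \<open>tensor u\<close> are \<open>(x) = \<Prod>\<^sub>j u\<^sub>j(x\<^sub>j)\<close>. The variety \<open>M_var\<close> is the image of these vectors, the
  Segre embedding of a product of projective lines, one for each label. Everything rests on
  one computation: on product vectors the sum over \<open>\<eta>\<close> factorises over the edges of the
  hypergraph, even if every copy carries its own product vector (\<open>renorm_multi_tensor\<close>). In
  particular, the lift of the renormalization map sends \<open>tensor u\<close> to a multiple of
  \<open>tensor u'\<close>, where \<open>u'\<^sub>j\<close> is a monomial image of \<open>u\<^bsub>\<Lambda>(j)\<^esub>\<close>. This gives the invariance of
  \<open>M_var\<close>.

  If no periodic label is critical, then the monomial map attached to a periodic label is the
  identity. So the \<open>N\<close>-th iterate acts on \<open>M_var\<close> by \<open>u\<^sub>j \<mapsto> Q\<^sub>j(u\<^bsub>\<pi>(j)\<^esub>)\<close>, where \<open>\<pi> = \<Lambda>\<^sup>N\<close> is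
  idempotent and \<open>Q\<^sub>j\<close> is the identity for \<open>\<pi>(j) = j\<close>. The locus \<open>u\<^sub>j = Q\<^sub>j(u\<^bsub>\<pi>(j)\<^esub>)\<close> is
  closed, irreducible and smooth, since it is a graph over the factors at periodic labels, and
  it consists of fixed points where the map is defined; hence it is \<open>M0_var\<close>
  (\<open>M0_eq_graph_variety\<close>). For \<open>\<pi>\<close> the identity this locus is \<open>M_var\<close> itself, so that both
  varieties are treated at once in the locale \<open>segre_graph\<close>. Their dimension is found from
  affine charts in which they are graphs; that a graph is not also the zero set of fewer
  independent equations is a consequence of Brouwer's fixed point theorem
  (\<open>graph_chart_dim_le\<close>).

  For the superattraction, the derivative of the lift at a product vector is a sum over the
  copies, in which one copy at a time carries the direction. A direction that is a product
  vector and differs from \<open>u\<close> only at the labels in \<open>S\<close> goes to a sum over the copies \<open>i\<close> of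
  product vectors that differ from \<open>u'\<close> only at those \<open>j\<close> for which \<open>\<Phi>(j)\<close> contains \<open>i\<close> and
  \<open>\<Lambda>(j) \<in> S\<close>. After \<open>n\<close> steps from the set of all labels these sets are \<open>{j. w \<in> \<Phi>\<^sub>n(j)}\<close> for
  the copies \<open>w\<close> of the \<open>n\<close>-th iterate; if the recursion is expanding, they eventually have at
  most one element, which means that a high iterate maps every direction to the tangent space
  of \<open>M_var\<close>. There the derivative is known from the action on the factors: modulo the
  directions of the nonperiodic labels, which it kills, it is the identity on those of the
  periodic labels. This determines the characteristic polynomial
  (\<open>char_poly_mat_of_retraction\<close>).

  For positive \<open>\<lambda>\<close> the coordinates along the orbit of a graph are nonnegative, and filling a
  marked vertex costs at most a factor \<open>\<lambda>\<close>. A limit point is in \<open>M_var\<close> if, for each label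
  \<open>j\<close>, the ratio of the coordinates with \<open>x\<^sub>j = 1\<close> and \<open>x\<^sub>j = 0\<close> becomes independent of the
  other entries of \<open>x\<close>. If \<open>j\<close> is periodic, then by non-degeneracy the vertex labelled \<open>j\<close>
  lies in one copy only, and the ratio for the glued graph is an average of the ratios for
  this copy over the states of its other marked vertices. The weight of the states in which
  those of them that have become unmarked are vacant is bounded below by a constant \<open>\<epsilon>\<close>. After
  \<open>n\<close> steps with disjoint \<open>\<Phi>\<^sub>n(1), \<dots>, \<Phi>\<^sub>n(k)\<close>, nothing is left of the state \<open>x\<close> in this part
  of the average, so the oscillation of the ratio shrinks by the factor \<open>1 - \<epsilon>\<^sup>n\<close>
  (\<open>ratio_spread_contract\<close>). The remaining labels become periodic after finitely many steps.
\<close>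

(* Below, vec and $ refer to finite Cartesian products, and mat to matrices in the sense of Char_Poly. *)
hide_const (open) Matrix.vec_index
hide_type (open) Matrix.vec
no_notation Matrix.vec_index (infixl \<open>$\<close> 100)

lemmas cart_eq_iff = Finite_Cartesian_Product.vec_eq_iff


section \<open>Linear maps that eventually retract\<close>

lemma upper_triangular_mult:
  fixes A B :: "'a::comm_ring_1 mat"
  assumes A: "A \<in> carrier_mat n n" "upper_triangular A" and B: "B \<in> carrier_mat n n" "upper_triangular B"
  shows "upper_triangular (A * B)" and "i < n \<Longrightarrow> (A * B) $$ (i, i) = A $$ (i, i) * B $$ (i, i)"
proof -
  have entry: "(A * B) $$ (i, j) = (\<Sum>l<n. A $$ (i, l) * B $$ (l, j))" if "i < n" "j < n" for i j
    using that A(1) B(1) by (simp add: scalar_prod_def lessThan_atLeast0)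
  have zero: "A $$ (i, l) * B $$ (l, j) = 0" if "i < n" "l < n" "l < i \<or> j < l" for i j l
    using that upper_triangularD[OF A(2)] upper_triangularD[OF B(2)] A(1) B(1) by auto
  show "upper_triangular (A * B)"
  proof (rule upper_triangularI)
    fix i j assume ij: "j < i" "i < dim_row (A * B)"
    then have "(\<Sum>l<n. A $$ (i, l) * B $$ (l, j)) = 0"
      using A(1) by (intro sum.neutral ballI zero) auto
    with ij entry[of i j] A(1) show "(A * B) $$ (i, j) = 0" by simp
  qed
  show "(A * B) $$ (i, i) = A $$ (i, i) * B $$ (i, i)" if "i < n"
  proof -
    have "(\<Sum>l<n. A $$ (i, l) * B $$ (l, i)) = (\<Sum>l\<in>{i}. A $$ (i, l) * B $$ (l, i))"
      using that by (intro sum.mono_neutral_right) (auto intro!: zero)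
    with entry[OF that that] show ?thesis by simp
  qed
qed

lemma upper_triangular_pow:
  fixes A :: "'a::comm_ring_1 mat"
  assumes "A \<in> carrier_mat n n" "upper_triangular A"
  shows "upper_triangular (A ^\<^sub>m k) \<and> (\<forall>i<n. (A ^\<^sub>m k) $$ (i, i) = (A $$ (i, i)) ^ k)"
proof (induction k)
  case 0
  then show ?case using assms(1) by (auto)
next
  case (Suc k)
  have "A ^\<^sub>m k \<in> carrier_mat n n" using assms(1) by (rule pow_carrier_mat)
  with Suc upper_triangular_mult[of "A ^\<^sub>m k" n A] assms show ?case by (auto simp: mult.commute)
qed

lemma sum_diag_mult_commute:
  fixes A B :: "'a::comm_ring_1 mat"
  assumes "A \<in> carrier_mat n n" "B \<in> carrier_mat n n"
  shows "(\<Sum>i<n. (A * B) $$ (i, i)) = (\<Sum>i<n. (B * A) $$ (i, i))"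
proof -
  have 1: "(\<Sum>i<n. (A * B) $$ (i, i)) = (\<Sum>i<n. \<Sum>l<n. A $$ (i, l) * B $$ (l, i))"
    using assms by (intro sum.cong) (auto simp: scalar_prod_def lessThan_atLeast0)
  have 2: "(\<Sum>i<n. (B * A) $$ (i, i)) = (\<Sum>i<n. \<Sum>l<n. B $$ (i, l) * A $$ (l, i))"
    using assms by (intro sum.cong) (auto simp: scalar_prod_def lessThan_atLeast0)
  show ?thesis unfolding 1 2 by (subst sum.swap) (simp add: mult.commute)
qed

lemma prod_list_diag: "(\<Prod>a\<leftarrow>diag_mat U. f a) = (\<Prod>i<dim_row U. f (U $$ (i,i)))"
  by (simp add: diag_mat_def prod.list_conv_set_nth atLeast0LessThan comp_def)

text \<open>
  Triangularise \<open>J\<close>. Each diagonal entry is equal to 0 or 1, because its \<open>q\<close>-th and its next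
  power agree. The diagonal of the \<open>q\<close>-th power is then the same, so the trace counts the
  ones.
\<close>

lemma char_poly_eventually_idempotent:
  fixes J :: "complex mat"
  assumes J: "J \<in> carrier_mat n n" and idem: "J ^\<^sub>m Suc q = J ^\<^sub>m q"
    and trace: "(\<Sum>i<n. (J ^\<^sub>m q) $$ (i, i)) = of_nat d"
  shows "char_poly J = [:-1, 1:] ^ d * [:0, 1:] ^ (n - d)"
proof -
  obtain as where as: "char_poly J = (\<Prod>a\<leftarrow>as. [:- a, 1:])"
    using char_poly_factorized[OF J] by blast
  obtain U where U: "U \<in> carrier_mat n n" "upper_triangular U" "similar_mat J U"
    using schur_decomposition_exists[OF J as] by blast
  then obtain P Q where wit: "similar_mat_wit J U P Q"
    unfolding similar_mat_def by blast
  note PQ = similar_mat_witD2[OF J wit]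
  define l where "l i = U $$ (i, i)" for i
  have Uk: "U ^\<^sub>m k = Q * J ^\<^sub>m k * P" for k
    by (rule similar_mat_wit_pow_id[OF similar_mat_wit_sym[OF wit]])
  have Upow: "U ^\<^sub>m k \<in> carrier_mat n n" for k using U(1) by (rule pow_carrier_mat)
  have Jpow: "J ^\<^sub>m k \<in> carrier_mat n n" for k using J by (rule pow_carrier_mat)
  have diag: "(U ^\<^sub>m k) $$ (i, i) = l i ^ k" if "i < n" for i k
    using upper_triangular_pow[OF U(1,2)] that unfolding l_def by blast
  have l01: "l i = 0 \<or> l i = 1" and lq: "l i ^ q = l i" if "i < n" for i
  proof -
    have "l i ^ Suc q = l i ^ q"
      using diag[OF that, of q] diag[OF that, of "Suc q"] unfolding Uk idem by simp
    then have "l i ^ q * (l i - 1) = 0" by (simp add: algebra_simps)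
    then show "l i = 0 \<or> l i = 1" by auto
    with \<open>l i ^ Suc q = l i ^ q\<close> show "l i ^ q = l i" by auto
  qed
  define S where "S = {i. i < n \<and> l i = 1}"
  have fS: "finite S" "S \<subseteq> {..<n}" unfolding S_def by auto
  have "(\<Sum>i<n. (J ^\<^sub>m q) $$ (i, i)) = (\<Sum>i<n. (P * (U ^\<^sub>m q * Q)) $$ (i, i))"
    using similar_mat_wit_pow_id[OF wit, of q] PQ Upow by (simp add: assoc_mult_mat[of _ n n _ n _ n])
  also have "\<dots> = (\<Sum>i<n. (U ^\<^sub>m q * Q * P) $$ (i, i))"
    by (rule sum_diag_mult_commute) (use PQ Upow in auto)
  also have "U ^\<^sub>m q * Q * P = U ^\<^sub>m q"
    using PQ Upow[of q] by (simp add: assoc_mult_mat[of _ n n _ n _ n])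
  also have "(\<Sum>i<n. (U ^\<^sub>m q) $$ (i, i)) = (\<Sum>i<n. if i \<in> S then 1 else 0)"
    using l01 by (intro sum.cong) (auto simp: diag lq S_def)
  also have "\<dots> = of_nat (card S)"
    using fS by (simp add: sum.If_cases Int_absorb1)
  finally have d: "card S = d"
    using trace by (metis of_nat_eq_iff)
  have "char_poly J = char_poly U"
    by (rule char_poly_similar[OF U(3)])
  also have "\<dots> = (\<Prod>i<n. [:- l i, 1:])"
    unfolding char_poly_upper_triangular[OF U(1,2)] prod_list_diag l_def using U(1) by simp
  also have "\<dots> = (\<Prod>i<n. if i \<in> S then [:-1, 1:] else [:0, 1:])"
    using l01 by (intro prod.cong) (auto simp: S_def)
  also have "\<dots> = [:-1, 1:] ^ card S * [:0, 1:] ^ (n - card S)"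
  proof -
    have "{..<n} \<inter> - S = {..<n} - S" by auto
    then show ?thesis
      using fS by (simp add: prod.If_cases Int_absorb1 card_Diff_subset)
  qed
  finally show ?thesis unfolding d .
qed

text \<open>
  Here \<open>B\<close> is meant as the derivative at a fixed point, acting on the hyperplane \<open>h $ a = 0\<close>.
  The vectors \<open>eps j\<close>, with dual coordinates \<open>c j\<close>, span a space that contains the image of
  some power of \<open>B\<close> and is invariant under \<open>B\<close>. On this space, \<open>B\<close> kills the directions
  outside of \<open>P\<close> and is the identity on the others modulo the killed ones, hence it is
  idempotent. Expanding the trace of the next power in the dual coordinates leaves one summand
  1 for each element of \<open>P\<close>.
\<close>

lemma char_poly_mat_of_retraction:
  fixes B :: "complex ^ 'i \<Rightarrow> complex ^ 'i::finite" and eps :: "'j::finite \<Rightarrow> complex ^ 'i" and c :: "'j \<Rightarrow> 'i"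
  assumes lin: "Vector_Spaces.linear (*s) (*s) B"
    and Ba: "\<And>h. B h $ a = 0"
    and epsa: "\<And>j. eps j $ a = 0"
    and dual: "\<And>j j'. eps j $ c j' = (if j = j' then 1 else 0)"
    and range: "\<And>h. (B ^^ t) h = (\<Sum>j\<in>UNIV. ((B ^^ t) h $ c j) *s eps j)"
    and Beps: "\<And>j. B (eps j) = (\<Sum>j'\<in>UNIV. (B (eps j) $ c j') *s eps j')"
    and kill: "\<And>j j'. j \<notin> P \<Longrightarrow> B (eps j) $ c j' = 0"
    and ret: "\<And>j j'. j \<in> P \<Longrightarrow> j' \<in> P \<Longrightarrow> B (eps j) $ c j' = (if j = j' then 1 else 0)"
    and e: "bij_betw e {..<CARD('i) - 1} (UNIV - {a})"
  shows "char_poly (Matrix.mat (CARD('i) - 1) (CARD('i) - 1) (\<lambda>(r, s). B (axis (e s) 1) $ e r)) =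
    [:-1, 1:] ^ card P * [:0, 1:] ^ (CARD('i) - 1 - card P)"
proof -
  define n where "n = CARD('i) - 1"
  define J where "J = Matrix.mat n n (\<lambda>(r, s). B (axis (e s) 1) $ e r)"
  interpret B: Vector_Spaces.linear "(*s)" "(*s)" B by (rule lin)
  have linpow: "Vector_Spaces.linear (*s) (*s) (B ^^ q)" for q
  proof (induction q)
    case 0 show ?case unfolding funpow_0 id_def[symmetric] by (simp add: vec.linear_id)
  next
    case (Suc q) with lin show ?case unfolding funpow.simps by (rule Vector_Spaces.linear_compose[rotated])
  qed
  have expand: "h = (\<Sum>i\<in>UNIV - {a}. (h $ i) *s axis i 1)" if "h $ a = 0" for h :: "complex ^ 'i"
  proof (rule iffD2[OF cart_eq_iff], intro allI)
    fix l
    have "(\<Sum>i\<in>UNIV - {a}. (h $ i) *s axis i 1) $ l = (\<Sum>i\<in>UNIV - {a}. if i = l then h $ i else 0)"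
      by (simp add: axis_def if_distrib cong: if_cong)
    also have "\<dots> = h $ l" using that by (auto simp: sum.delta)
    finally show "h $ l = (\<Sum>i\<in>UNIV - {a}. (h $ i) *s axis i 1) $ l" by simp
  qed
  have Bsum: "(B ^^ q) (\<Sum>i\<in>I. x i *s y i) = (\<Sum>i\<in>I. x i *s (B ^^ q) (y i))" for q I and x :: "'z \<Rightarrow> complex" and y
  proof -
    interpret Bq: Vector_Spaces.linear "(*s)" "(*s)" "B ^^ q" by (rule linpow)
    show ?thesis by (simp add: Bq.sum Bq.scale)
  qed
  have Jpow: "(J ^\<^sub>m q) $$ (r, s) = (B ^^ q) (axis (e s) 1) $ e r" if "r < n" "s < n" for q r s
    using that
  proof (induction q arbitrary: r s)
    case 0
    then show ?case using e by (auto simp: J_def axis_def n_def bij_betw_def inj_on_def)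
  next
    case (Suc q)
    have C: "J \<in> carrier_mat n n" "J ^\<^sub>m q \<in> carrier_mat n n"
      by (auto simp: J_def intro!: pow_carrier_mat)
    have "(J ^\<^sub>m Suc q) $$ (r, s) = (\<Sum>l<n. (J ^\<^sub>m q) $$ (r, l) * J $$ (l, s))"
      using C Suc.prems by (simp add: scalar_prod_def lessThan_atLeast0)
    also have "\<dots> = (\<Sum>l<n. B (axis (e s) 1) $ e l * ((B ^^ q) (axis (e l) 1) $ e r))"
      using Suc by (intro sum.cong) (auto simp: J_def)
    also have "\<dots> = (\<Sum>i\<in>UNIV - {a}. B (axis (e s) 1) $ i * ((B ^^ q) (axis i 1) $ e r))"
      using e unfolding n_def by (rule sum.reindex_bij_betw)
    also have "\<dots> = (B ^^ q) (\<Sum>i\<in>UNIV - {a}. (B (axis (e s) 1) $ i) *s axis i 1) $ e r"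
      unfolding Bsum by simp
    also have "(\<Sum>i\<in>UNIV - {a}. (B (axis (e s) 1) $ i) *s axis i 1) = B (axis (e s) 1)"
      by (rule expand[symmetric, OF Ba])
    finally show ?case by (simp add: funpow_swap1)
  qed
  have eps_B0: "B (eps j) = 0" if "j \<notin> P" for j
    using Beps[of j] kill[OF that] by simp
  have B2: "B (B (eps j)) = B (eps j)" for j
  proof (cases "j \<in> P")
    case True
    have "B (B (eps j)) = (\<Sum>j'\<in>UNIV. (B (eps j) $ c j') *s B (eps j'))"
      by (subst Beps) (simp add: B.sum B.scale)
    also have "\<dots> = (\<Sum>j'\<in>UNIV. if j' = j then B (eps j) else 0)"
    proof (intro sum.cong refl)
      fix j' show "(B (eps j) $ c j') *s B (eps j') = (if j' = j then B (eps j) else 0)"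
        using True ret[OF True, of j'] eps_B0[of j'] by (cases "j' \<in> P") auto
    qed
    finally show ?thesis by simp
  qed (simp add: eps_B0 B.zero)
  define q where "q = Suc t"
  have Bq: "B ((B ^^ q) h) = (B ^^ q) h" for h
  proof -
    have "(B ^^ q) h = (\<Sum>j\<in>UNIV. ((B ^^ t) h $ c j) *s B (eps j))"
      unfolding q_def funpow.simps comp_def by (subst range) (simp add: B.sum B.scale)
    then show ?thesis by (simp add: B.sum B.scale B2)
  qed
  have Bq_eps: "(B ^^ q) (eps j) = B (eps j)" for j
    unfolding q_def by (induction t) (auto simp: B2)
  have range_q: "(B ^^ q) h = (\<Sum>j\<in>UNIV. ((B ^^ q) h $ c j) *s eps j)" for h
    using range[of "B h"] unfolding q_def by (simp add: funpow_swap1)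
  have C: "J \<in> carrier_mat n n" by (simp add: J_def)
  have idem: "J ^\<^sub>m Suc q = J ^\<^sub>m q"
  proof (rule eq_matI)
    show "dim_row (J ^\<^sub>m Suc q) = dim_row (J ^\<^sub>m q)" "dim_col (J ^\<^sub>m Suc q) = dim_col (J ^\<^sub>m q)"
      using C pow_carrier_mat[OF C, of q] pow_carrier_mat[OF C, of "Suc q"] by auto
    fix i j assume "i < dim_row (J ^\<^sub>m q)" "j < dim_col (J ^\<^sub>m q)"
    then have ij: "i < n" "j < n" using pow_carrier_mat[OF C, of q] by auto
    show "(J ^\<^sub>m Suc q) $$ (i, j) = (J ^\<^sub>m q) $$ (i, j)"
      unfolding Jpow[OF ij] funpow.simps comp_def Bq ..
  qed
  have "(\<Sum>i<n. (J ^\<^sub>m q) $$ (i, i)) = (\<Sum>i<n. (B ^^ q) (axis (e i) 1) $ e i)"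
    by (intro sum.cong) (auto simp: Jpow)
  also have "\<dots> = (\<Sum>i\<in>UNIV - {a}. (B ^^ q) (axis i 1) $ i)"
    using e unfolding n_def by (rule sum.reindex_bij_betw)
  also have "\<dots> = (\<Sum>i\<in>UNIV - {a}. \<Sum>j\<in>UNIV. ((B ^^ q) (axis i 1) $ c j) * eps j $ i)"
    by (intro sum.cong refl, subst range_q) simp
  also have "\<dots> = (\<Sum>j\<in>UNIV. \<Sum>i\<in>UNIV - {a}. eps j $ i * ((B ^^ q) (axis i 1) $ c j))"
    by (subst sum.swap) (simp add: mult.commute)
  also have "\<dots> = (\<Sum>j\<in>UNIV. (B ^^ q) (\<Sum>i\<in>UNIV - {a}. (eps j $ i) *s axis i 1) $ c j)"
    unfolding Bsum by simp
  also have "\<dots> = (\<Sum>j\<in>UNIV. B (eps j) $ c j)"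
    by (simp add: expand[symmetric, OF epsa] Bq_eps)
  also have "\<dots> = (\<Sum>j\<in>UNIV. if j \<in> P then 1 else 0)"
    by (intro sum.cong refl) (auto simp: kill ret)
  also have "\<dots> = of_nat (card P)" by (simp add: sum.If_cases)
  finally have trace: "(\<Sum>i<n. (J ^\<^sub>m q) $$ (i, i)) = of_nat (card P)" .
  show ?thesis
    using char_poly_eventually_idempotent[OF C idem trace] unfolding J_def n_def .
qed


section \<open>Points of projective space and their lifts\<close>

lemma proj_rel_refl: "proj_rel v v \<longleftrightarrow> v \<noteq> (0 :: complex ^ 'i)"
  unfolding proj_rel_def by (auto intro!: exI[of _ 1])

lemma rep_proj_nonzero [simp]: "rep_proj p \<noteq> 0"
  using Quotient3_rep_reflp[OF Quotient3_proj, of p] by (simp add: proj_rel_refl)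

lemma abs_rep_proj [simp]: "abs_proj (rep_proj p) = p"
  by (rule Quotient3_abs_rep[OF Quotient3_proj])

lemma abs_proj_eq_iff:
  assumes "u \<noteq> 0" "v \<noteq> 0"
  shows "abs_proj u = abs_proj v \<longleftrightarrow> (\<exists>c. c \<noteq> 0 \<and> v = c *s u)"
  using Quotient3_rel[OF Quotient3_proj, of u v] assms by (auto simp: proj_rel_refl proj_rel_def)

lemma abs_proj_scale: "v \<noteq> 0 \<Longrightarrow> c \<noteq> 0 \<Longrightarrow> abs_proj (c *s v) = abs_proj v"
  using abs_proj_eq_iff[of v "c *s v"] by (auto simp: vec.scale_eq_0_iff)

lemma rep_abs_proj:
  assumes "v \<noteq> 0" obtains c where "c \<noteq> 0" "rep_proj (abs_proj v) = c *s v"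
  using abs_proj_eq_iff[of v "rep_proj (abs_proj v)"] assms by auto

lemma open_proj_Collect:
  assumes inv: "\<And>c v. c \<noteq> 0 \<Longrightarrow> v \<noteq> 0 \<Longrightarrow> Q (c *s v) \<longleftrightarrow> Q v" and "open {v. v \<noteq> 0 \<and> Q v}"
  shows "open {p :: 'i::finite proj. Q (rep_proj p)}"
proof -
  have "{v. v \<noteq> 0 \<and> abs_proj v \<in> {p. Q (rep_proj p)}} = {v. v \<noteq> 0 \<and> Q v}"
  proof (intro Collect_cong conj_cong refl)
    fix v :: "complex ^ 'i" assume "v \<noteq> 0"
    then show "abs_proj v \<in> {p. Q (rep_proj p)} \<longleftrightarrow> Q v"
      using inv by (metis mem_Collect_eq rep_abs_proj)
  qed
  with assms(2) show ?thesis unfolding open_proj_def by simp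
qed

lemma open_abs_proj_vimage: "open W \<Longrightarrow> open {v. v \<noteq> 0 \<and> abs_proj v \<in> W}"
  unfolding open_proj_def .

lemma aff_coord_abs: "v \<noteq> 0 \<Longrightarrow> aff_coord a i (abs_proj v) = v $ i / v $ a"
  unfolding aff_coord_def by (elim rep_abs_proj) simp

lemma abs_in_chart_dom: "v \<noteq> 0 \<Longrightarrow> abs_proj v \<in> chart_dom a \<longleftrightarrow> v $ a \<noteq> 0"
  unfolding chart_dom_def by (elim rep_abs_proj) simp

lemma open_chart_dom: "open (chart_dom a)"
  unfolding chart_dom_def
proof (rule open_proj_Collect)
  have "{v :: complex ^ 'a. v \<noteq> 0 \<and> v $ a \<noteq> 0} = {v. v $ a \<noteq> 0}" by auto
  also have "open \<dots>"
    by (intro open_Collect_neq continuous_intros)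
  finally show "open {v :: complex ^ 'a. v \<noteq> 0 \<and> v $ a \<noteq> 0}" .
qed simp

lemma normalised_lift:
  assumes "p \<in> chart_dom a"
  shows "(\<chi> l. aff_coord a l p) = inverse (rep_proj p $ a) *s rep_proj p"
    and "(\<chi> l. aff_coord a l p) $ a = 1" and "(\<chi> l. aff_coord a l p) \<noteq> 0"
    and "abs_proj (\<chi> l. aff_coord a l p) = p"
proof -
  let ?y = "\<chi> l. aff_coord a l p"
  have a: "rep_proj p $ a \<noteq> 0" using assms by (simp add: chart_dom_def)
  show 1: "?y = inverse (rep_proj p $ a) *s rep_proj p"
    by (rule iffD2[OF cart_eq_iff]) (simp add: aff_coord_def divide_inverse mult.commute)
  show "?y $ a = 1" using a by (simp add: aff_coord_def)
  then show "?y \<noteq> 0" by (metis zero_index zero_neq_one)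
  show "abs_proj ?y = p" unfolding 1 using a by (simp add: abs_proj_scale)
qed


section \<open>Polynomial and complex differentiable functions\<close>

lemma poly_fun_sum: "(\<And>x. x \<in> A \<Longrightarrow> poly_fun (f x)) \<Longrightarrow> poly_fun (\<lambda>v. \<Sum>x\<in>A. f x v)"
  by (induction A rule: infinite_finite_induct) (auto intro: poly_fun.intros)

lemma poly_fun_prod: "(\<And>x. x \<in> A \<Longrightarrow> poly_fun (f x)) \<Longrightarrow> poly_fun (\<lambda>v. \<Prod>x\<in>A. f x v)"
  by (induction A rule: infinite_finite_induct) (auto intro: poly_fun.intros)

lemma poly_fun_power: "poly_fun f \<Longrightarrow> poly_fun (\<lambda>v. f v ^ n)"
  by (induction n) (auto intro: poly_fun.intros)

lemma poly_fun_diff: "poly_fun f \<Longrightarrow> poly_fun g \<Longrightarrow> poly_fun (\<lambda>v. f v - g v)"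
  using poly_fun_add[of f "\<lambda>v. - g v"] poly_fun_mult[OF poly_fun_const[of "-1"], of g] by simp

lemma poly_fun_compose: "poly_fun f \<Longrightarrow> (\<And>i. poly_fun (\<lambda>v. G v $ i)) \<Longrightarrow> poly_fun (\<lambda>v. f (G v))"
  by (induction rule: poly_fun.induct) (auto intro: poly_fun.intros)

lemmas poly_fun_intros = poly_fun.intros poly_fun_sum poly_fun_prod poly_fun_power poly_fun_diff

text \<open>
  Complex differentiability as in the definition of holomorphic functions on projective space:
  the real derivative commutes with complex scalars.
\<close>

definition cdiff_at :: "(complex ^ 'i::finite \<Rightarrow> complex) \<Rightarrow> complex ^ 'i \<Rightarrow> bool" where
  "cdiff_at f v \<longleftrightarrow> (\<exists>L. (f has_derivative L) (at v) \<and> (\<forall>c h. L (c *s h) = c * L h))"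

lemma cdiff_const: "cdiff_at (\<lambda>v. c) v"
  unfolding cdiff_at_def by (intro exI[of _ "\<lambda>_. 0"]) auto

lemma bounded_linear_coord: "bounded_linear (\<lambda>v :: complex ^ 'i::finite. v $ i)"
  by (rule bounded_linear_vec_nth)

lemma cdiff_coord: "cdiff_at (\<lambda>v. v $ i) v"
  unfolding cdiff_at_def
  by (intro exI[of _ "\<lambda>h. h $ i"]) (auto intro!: bounded_linear_imp_has_derivative bounded_linear_coord)

lemma cdiff_add: "cdiff_at f v \<Longrightarrow> cdiff_at g v \<Longrightarrow> cdiff_at (\<lambda>v. f v + g v) v"
  unfolding cdiff_at_def
  by (elim exE, rename_tac L L', rule_tac x="\<lambda>h. L h + L' h" in exI)
     (auto intro!: derivative_eq_intros simp: algebra_simps)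

lemma cdiff_mult:
  assumes "cdiff_at f v" "cdiff_at g v" shows "cdiff_at (\<lambda>v. f v * g v) v"
proof -
  obtain L L' where L: "(f has_derivative L) (at v)" "\<And>c h. L (c *s h) = c * L h"
    "(g has_derivative L') (at v)" "\<And>c h. L' (c *s h) = c * L' h"
    using assms unfolding cdiff_at_def by blast
  then show ?thesis
    unfolding cdiff_at_def using has_derivative_mult[OF L(1,3)]
    by (intro exI[of _ "\<lambda>h. f v * L' h + L h * g v"]) (simp add: algebra_simps)
qed

lemma cdiff_inverse:
  assumes "cdiff_at f v" "f v \<noteq> 0" shows "cdiff_at (\<lambda>v. inverse (f v)) v"
proof -
  obtain L where L: "(f has_derivative L) (at v)" "\<And>c h. L (c *s h) = c * L h"
    using assms unfolding cdiff_at_def by blast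
  then show ?thesis
    unfolding cdiff_at_def using Deriv.has_derivative_inverse[OF assms(2) L(1)]
    by (intro exI[of _ "\<lambda>h. - (inverse (f v) * L h * inverse (f v))"]) (simp add: algebra_simps)
qed

lemma cdiff_divide: "cdiff_at f v \<Longrightarrow> cdiff_at g v \<Longrightarrow> g v \<noteq> 0 \<Longrightarrow> cdiff_at (\<lambda>v. f v / g v) v"
  unfolding divide_inverse by (intro cdiff_mult cdiff_inverse)

lemma cdiff_diff: "cdiff_at f v \<Longrightarrow> cdiff_at g v \<Longrightarrow> cdiff_at (\<lambda>v. f v - g v) v"
  using cdiff_add[of f v "\<lambda>v. - g v"] cdiff_mult[OF cdiff_const[of "-1"], of g] by simp

lemma cdiff_poly_fun_compose:
  assumes "poly_fun f" "\<And>i. cdiff_at (\<lambda>v. G v $ i) v"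
  shows "cdiff_at (\<lambda>v. f (G v)) v"
  using assms by (induction rule: poly_fun.induct) (auto intro: cdiff_const cdiff_add cdiff_mult)

lemma cdiff_poly_fun: "poly_fun f \<Longrightarrow> cdiff_at f v"
  using cdiff_poly_fun_compose[of f "\<lambda>v. v"] cdiff_coord by auto

lemma cdiff_cong:
  assumes "cdiff_at f v" "open S" "v \<in> S" "\<And>u. u \<in> S \<Longrightarrow> f u = g u"
  shows "cdiff_at g v"
  using assms unfolding cdiff_at_def by (metis has_derivative_transform_within_open)

lemma cdiff_isCont: "cdiff_at f v \<Longrightarrow> isCont f v"
  unfolding cdiff_at_def using has_derivative_continuous by blast

lemma continuous_poly_fun: "poly_fun f \<Longrightarrow> continuous_on S f"
  using cdiff_isCont[OF cdiff_poly_fun] by (meson continuous_at_imp_continuous_on)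

lemma continuous_poly_map:
  "(\<And>i. poly_fun (\<lambda>v. G v $ i)) \<Longrightarrow> continuous_on S (G :: complex ^ 'i::finite \<Rightarrow> complex ^ 'j::finite)"
  using continuous_on_vec_lambda[OF continuous_poly_fun, of "\<lambda>i v. G v $ i" S]
  by (simp only: vec_lambda_eta)

lemma cdiff_line:
  fixes f :: "complex ^ 'i::finite \<Rightarrow> complex"
  assumes "(f has_derivative L) (at v)"
  shows "((\<lambda>t. f (v + t *s h)) has_derivative (\<lambda>t. L (t *s h))) (at 0)"
proof -
  have bl: "bounded_linear (\<lambda>t. t *s h)"
    unfolding linear_conv_bounded_linear[symmetric]
    by (rule Real_Vector_Spaces.linearI) (auto simp: cart_eq_iff algebra_simps)
  have "((\<lambda>t. v + t *s h) has_derivative (\<lambda>t. t *s h)) (at 0)"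
    by (auto intro!: derivative_eq_intros bounded_linear_imp_has_derivative bl)
  from has_derivative_compose[OF this, of f L] assms show ?thesis by simp
qed

text \<open>
  On a line, products of nonzero polynomial functions can be seen to be nonzero, since
  univariate polynomials over \<open>\<complex>\<close> form an integral domain and vanish identically only if they
  are 0.
\<close>

lemma poly_fun_on_line:
  assumes "poly_fun f" shows "\<exists>p. \<forall>t. f (x + t *s y) = poly p t"
  using assms
proof (induction rule: poly_fun.induct)
  case (poly_fun_const c)
  show ?case by (rule exI[of _ "[:c:]"]) simp
next
  case (poly_fun_coord i)
  show ?case by (rule exI[of _ "[:x $ i, y $ i:]"]) simp
next
  case (poly_fun_add f g)
  then show ?case by (metis poly_add)
next
  case (poly_fun_mult f g)
  then show ?case by (metis poly_mult)
qed


section \<open>Maps of projective space induced by homogeneous polynomials\<close>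

lemma proj_map_abs:
  assumes hom: "\<And>c v. G (c *s v) = c ^ d *s G v" and v: "v \<noteq> 0" "G v \<noteq> 0"
  shows "proj_map G (abs_proj v) = abs_proj (G v)"
proof -
  obtain c where "c \<noteq> 0" "rep_proj (abs_proj v) = c *s v" using rep_abs_proj[OF v(1)] .
  then show ?thesis unfolding proj_map_def using v(2) by (simp add: hom abs_proj_scale)
qed

lemma proj_indet_iff:
  assumes hom: "\<And>c v. G (c *s v) = c ^ d *s G v" and v: "v \<noteq> 0"
  shows "abs_proj v \<in> proj_indet G \<longleftrightarrow> G v = 0"
proof
  assume "abs_proj v \<in> proj_indet G"
  then obtain w where w: "w \<noteq> 0" "G w = 0" "abs_proj w = abs_proj v" unfolding proj_indet_def by auto
  then obtain c where "v = c *s w" using abs_proj_eq_iff[OF w(1) v] by auto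
  with w(2) show "G v = 0" by (simp add: hom)
qed (use v in \<open>auto simp: proj_indet_def\<close>)

lemma zariski_closed_proj_indet:
  assumes "\<And>c v. G (c *s v) = c ^ d *s G v" "\<And>i. poly_fun (\<lambda>v. G v $ i)"
  shows "zariski_closed (proj_indet G)"
  unfolding zariski_closed_def
proof (intro exI[of _ "range (\<lambda>i v. G v $ i)"] conjI)
  show "\<forall>f\<in>range (\<lambda>i v. G v $ i). homogeneous_poly f"
    using assms by (auto simp: homogeneous_poly_def)
  show "proj_indet G = {abs_proj v |v. v \<noteq> 0 \<and> (\<forall>f\<in>range (\<lambda>i v. G v $ i). f v = 0)}"
    unfolding proj_indet_def by (auto simp: cart_eq_iff)
qed

lemma open_Compl_proj_indet:
  assumes hom: "\<And>c v. G (c *s v) = c ^ d *s G v" and poly: "\<And>i. poly_fun (\<lambda>v. G v $ i)"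
  shows "open (- proj_indet (G :: complex ^ 'i::finite \<Rightarrow> complex ^ 'i))"
proof -
  have "{v. v \<noteq> 0 \<and> abs_proj v \<in> - proj_indet G} = {v. v \<noteq> 0 \<and> G v \<noteq> 0}"
    using proj_indet_iff[of G d, OF hom] by auto
  also have "\<dots> = {v. v \<noteq> 0} \<inter> {v. G v \<noteq> 0}" by blast
  also have "open \<dots>"
    by (intro open_Int open_Collect_neq continuous_poly_map[OF poly] continuous_intros)
  finally show ?thesis unfolding open_proj_def .
qed

text \<open>
  Continuity for the quotient topology and holomorphy are both conditions on pullbacks to
  nonzero vectors, where the map becomes \<open>G\<close> followed by the projection.
\<close>

lemma proj_map_holomorphic:
  fixes G :: "complex ^ 'i::finite \<Rightarrow> complex ^ 'i"
  assumes hom: "\<And>c v. G (c *s v) = c ^ d *s G v" and poly: "\<And>i. poly_fun (\<lambda>v. G v $ i)"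
  shows "proj_holomorphic_map_on (proj_map G) (- proj_indet G)"
proof -
  note pm = proj_map_abs[of G d, OF hom] and ind = proj_indet_iff[of G d, OF hom]
  have contG: "continuous_on UNIV G" by (rule continuous_poly_map[OF poly])
  have openW: "open (- proj_indet G)" by (rule open_Compl_proj_indet[OF hom poly])
  have "continuous_on (- proj_indet G) (proj_map G)"
    unfolding continuous_on_open_vimage[OF openW]
  proof (intro allI impI)
    fix S :: "'i proj set" assume S: "open S"
    have "{v. v \<noteq> 0 \<and> abs_proj v \<in> proj_map G -` S \<inter> - proj_indet G} =
        {v. v \<noteq> 0} \<inter> G -` {v. v \<noteq> 0 \<and> abs_proj v \<in> S}" (is "?A = ?B")
    proof (rule Set.set_eqI)
      fix v show "v \<in> ?A \<longleftrightarrow> v \<in> ?B"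
        using pm[of v] ind[of v] by (cases "v = 0"; cases "G v = 0") simp_all
    qed
    also have "open \<dots>"
    proof (rule open_Int)
      show "open {v :: complex ^ 'i. v \<noteq> 0}" by (intro open_Collect_neq continuous_intros)
      show "open (G -` {v. v \<noteq> 0 \<and> abs_proj v \<in> S})"
        by (rule open_vimage[OF open_abs_proj_vimage[OF S] contG])
    qed
    finally show "open (proj_map G -` S \<inter> - proj_indet G)" unfolding open_proj_def .
  qed
  moreover have "proj_holomorphic_on (\<lambda>p. aff_coord a i (proj_map G p)) {p \<in> - proj_indet G. proj_map G p \<in> chart_dom a}"
    for a i
    unfolding proj_holomorphic_on_def cdiff_at_def[symmetric]
  proof (intro allI impI)
    fix v :: "complex ^ 'i"
    assume v: "v \<noteq> 0 \<and> abs_proj v \<in> {p \<in> - proj_indet G. proj_map G p \<in> chart_dom a}"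
    then have Gv: "G v \<noteq> 0" using ind by auto
    have "proj_map G (abs_proj v) = abs_proj (G v)" using v Gv by (intro pm) auto
    then have a: "G v $ a \<noteq> 0" using v abs_in_chart_dom[OF Gv] by auto
    show "cdiff_at (\<lambda>u. aff_coord a i (proj_map G (abs_proj u))) v"
    proof (rule cdiff_cong)
      show "cdiff_at (\<lambda>u. G u $ i / G u $ a) v"
        using a by (intro cdiff_divide cdiff_poly_fun poly)
      show "open {u. u \<noteq> 0 \<and> G u $ a \<noteq> 0}"
        by (intro open_Collect_conj open_Collect_neq continuous_intros continuous_poly_fun poly)
      show "v \<in> {u. u \<noteq> 0 \<and> G u $ a \<noteq> 0}" using v a by simp
      fix u assume u: "u \<in> {u. u \<noteq> 0 \<and> G u $ a \<noteq> 0}"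
      then have "G u \<noteq> 0" by auto
      with u show "G u $ i / G u $ a = aff_coord a i (proj_map G (abs_proj u))"
        by (simp add: pm aff_coord_abs)
    qed
  qed
  ultimately show ?thesis unfolding proj_holomorphic_map_on_def by blast
qed

text \<open>
  The quotient rule for \<open>G i / G a\<close> along a coordinate line through the lift \<open>y\<close>. In other
  words, the Jacobian matrix describes \<open>A / c\<close> followed by the projection along the line of
  \<open>y\<close> to the hyperplane of vectors that vanish at \<open>a\<close>.
\<close>

lemma jacobian_entry_eq:
  fixes G :: "complex ^ 'i::finite \<Rightarrow> complex ^ 'i"
  assumes hom: "\<And>c v. G (c *s v) = c ^ d *s G v" and poly: "\<And>i. poly_fun (\<lambda>v. G v $ i)"
    and y: "y = (\<chi> l. aff_coord a l p)" "p \<in> chart_dom a"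
    and Gy: "G y = c *s y" "c \<noteq> 0"
    and A: "(G has_derivative A) (at y)" "\<And>t h. A (t *s h) = t *s A h"
  shows "jacobian_entry (proj_map G) a p i j = (A (axis j 1) $ i - y $ i * A (axis j 1) $ a) / c"
proof -
  define h :: "complex ^ 'i" where "h = axis j 1"
  have ya: "y $ a = 1" and y0: "y \<noteq> 0" using normalised_lift[OF y(2)] unfolding y(1) by blast+
  have coord: "((\<lambda>v. G v $ l) has_derivative (\<lambda>h. A h $ l)) (at y)" for l
    by (rule bounded_linear.has_derivative[OF bounded_linear_coord A(1)])
  have der: "((\<lambda>t. G (y + t *s h) $ l) has_field_derivative A h $ l) (at 0)" for l
    using cdiff_line[OF coord[of l], of h] by (intro has_derivative_imp_has_field_derivative) (simp_all add: A(2) mult.commute)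
  have G0: "G (y + 0 *s h) $ l = c * y $ l" for l using Gy by simp
  have "((\<lambda>t. G (y + t *s h) $ i / G (y + t *s h) $ a) has_field_derivative
      (A h $ i * (c * y $ a) - (c * y $ i) * A h $ a) / ((c * y $ a) * (c * y $ a))) (at 0)"
    using DERIV_divide[OF der[of i] der[of a]] Gy(2) ya unfolding G0 by simp
  also have "(A h $ i * (c * y $ a) - (c * y $ i) * A h $ a) / ((c * y $ a) * (c * y $ a)) = (A h $ i - y $ i * A h $ a) / c"
    using Gy(2) ya by (simp add: field_simps)
  finally have quot: "((\<lambda>t. G (y + t *s h) $ i / G (y + t *s h) $ a) has_field_derivative (A h $ i - y $ i * A h $ a) / c) (at 0)" .
  define S where "S = {t :: complex. y + t *s h \<noteq> 0 \<and> G (y + t *s h) $ a \<noteq> 0}"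
  have cont: "continuous_on UNIV (\<lambda>t. y + t *s h)"
  proof -
    have "continuous_on UNIV (\<lambda>t. (y + t *s h) $ l)" for l by (auto intro!: continuous_intros)
    then have "continuous_on UNIV (\<lambda>t. \<chi> l. (y + t *s h) $ l)" by (rule continuous_on_vec_lambda)
    then show ?thesis by (simp only: vec_lambda_eta)
  qed
  have "continuous_on UNIV (\<lambda>t. G (y + t *s h) $ a)"
    by (rule continuous_on_compose2[OF continuous_poly_fun[OF poly] cont]) auto
  then have openS: "open S" unfolding S_def
    by (intro open_Collect_conj open_Collect_neq[OF cont continuous_on_const] open_Collect_neq continuous_on_const)
  have S0: "0 \<in> S" using y0 Gy ya by (simp add: S_def)
  have "((\<lambda>t. aff_coord a i (proj_map G (abs_proj (y + t *s h)))) has_field_derivative (A h $ i - y $ i * A h $ a) / c) (at 0)"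
  proof (rule has_field_derivative_transform_within_open[OF quot openS S0])
    fix t assume "t \<in> S"
    then have t: "y + t *s h \<noteq> 0" "G (y + t *s h) $ a \<noteq> 0" unfolding S_def by auto
    then have "G (y + t *s h) \<noteq> 0" by (metis zero_index)
    then show "G (y + t *s h) $ i / G (y + t *s h) $ a = aff_coord a i (proj_map G (abs_proj (y + t *s h)))"
      using t(1) by (simp add: proj_map_abs[of G d, OF hom] aff_coord_abs)
  qed
  then show ?thesis unfolding jacobian_entry_def y(1)[symmetric] h_def by (rule DERIV_imp_deriv)
qed


section \<open>Dimension of sets that are locally graphs\<close>

lemma bounded_linear_axis: "bounded_linear (axis l :: complex \<Rightarrow> complex ^ 'i::finite)"
  unfolding linear_conv_bounded_linear[symmetric]
  by (rule Real_Vector_Spaces.linearI) (auto simp: cart_eq_iff axis_def)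

lemma has_derivative_vecI:
  fixes f :: "'a::real_normed_vector \<Rightarrow> complex ^ 'i::finite"
  assumes "\<And>l. ((\<lambda>x. f x $ l) has_derivative (\<lambda>h. f' h $ l)) F"
  shows "(f has_derivative f') F"
proof -
  have eq: "(\<lambda>x. \<Sum>l\<in>UNIV. axis l (g x $ l)) = g" for g :: "'a \<Rightarrow> complex ^ 'i"
    by (auto simp: cart_eq_iff axis_def sum.delta fun_eq_iff cong: if_cong)
  have "((\<lambda>x. \<Sum>l\<in>UNIV. axis l (f x $ l)) has_derivative (\<lambda>h. \<Sum>l\<in>UNIV. axis l (f' h $ l))) F"
    by (intro has_derivative_sum bounded_linear.has_derivative[OF bounded_linear_axis] assms)
  then show ?thesis unfolding eq .
qed

lemma dim_coordinate_subspace: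
  "dim {z :: complex ^ 'i::finite. \<forall>l. l \<notin> A \<longrightarrow> z $ l = 0} = 2 * card A"
proof -
  define BA where "BA = (\<lambda>(i, u). axis i u :: complex ^ 'i) ` (A \<times> {1, \<i>})"
  have "BA \<subseteq> Basis" by (auto simp: BA_def Basis_vec_def Basis_complex_def)
  then have "dim {x. \<forall>i\<in>Basis. i \<notin> BA \<longrightarrow> x \<bullet> i = 0} = card BA" by (rule dim_substandard)
  moreover have "card BA = 2 * card A"
  proof -
    have "inj_on (\<lambda>(i, u). axis i u :: complex ^ 'i) (A \<times> {1, \<i>})"
      by (auto simp: inj_on_def axis_eq_axis)
    then show ?thesis by (simp add: BA_def card_image card_cartesian_product)
  qed
  moreover have "{x. \<forall>i\<in>Basis. i \<notin> BA \<longrightarrow> x \<bullet> i = 0} = {z :: complex ^ 'i. \<forall>l. l \<notin> A \<longrightarrow> z $ l = 0}"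
  proof (intro Collect_cong iffI allI impI ballI)
    fix z :: "complex ^ 'i" and l
    assume z: "\<forall>i\<in>Basis. i \<notin> BA \<longrightarrow> z \<bullet> i = 0" and l: "l \<notin> A"
    have "axis l u \<notin> BA" if "u \<noteq> 0" for u using l that by (auto simp: BA_def axis_eq_axis)
    with z have "z \<bullet> axis l 1 = 0" "z \<bullet> axis l \<i> = 0"
      by (auto simp: Basis_vec_def Basis_complex_def)
    then show "z $ l = 0" by (simp add: inner_axis inner_complex_def complex_eq_iff)
  next
    fix z i :: "complex ^ 'i"
    assume z: "\<forall>l. l \<notin> A \<longrightarrow> z $ l = 0" and i: "i \<in> Basis" "i \<notin> BA"
    then obtain l u where "i = axis l u" "u \<in> {1, \<i>}" by (auto simp: Basis_vec_def Basis_complex_def)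
    moreover from this i(2) have "l \<notin> A" by (auto simp: BA_def)
    ultimately show "z \<bullet> i = 0" using z by (simp add: inner_axis)
  qed
  ultimately show ?thesis by simp
qed

text \<open>
  In the affine chart at \<open>a\<close>, the set \<open>Y\<close> is the graph of a polynomial map in the coordinates
  with index in \<open>B\<close>. The functions \<open>h y\<close> take the whole vector as argument and are required to
  depend on these coordinates only, as there is no type of vectors indexed by the set \<open>B\<close>.
\<close>

definition graph_chart ::
    "'i::finite proj set \<Rightarrow> 'i proj set \<Rightarrow> 'i \<Rightarrow> 'i set \<Rightarrow> ('i \<Rightarrow> complex ^ 'i \<Rightarrow> complex) \<Rightarrow> bool" where
  "graph_chart Y W a B h \<longleftrightarrow> open W \<and> W \<subseteq> chart_dom a \<and> a \<notin> B \<and> (\<forall>y. poly_fun (h y)) \<and>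
     (\<forall>y u u'. (\<forall>b\<in>B. u $ b = u' $ b) \<longrightarrow> h y u = h y u') \<and>
     Y \<inter> W = {q \<in> W. \<forall>y. y \<notin> insert a B \<longrightarrow> aff_coord a y q = h y (\<chi> l. aff_coord a l q)}"

text \<open>
  The defining functions \<open>v y / v a - h y\<close> have independent differentials because the
  coordinate \<open>v y\<close> occurs in only one of them.
\<close>

lemma graph_chart_submanifold:
  fixes Y :: "'i::finite proj set"
  assumes ne: "Y \<noteq> {}"
    and chart: "\<And>p. p \<in> Y \<Longrightarrow> \<exists>W a B h. p \<in> W \<and> card B = d \<and> graph_chart Y W a B h"
  shows "proj_submanifold d Y"
  unfolding proj_submanifold_def
proof (intro exI[of _ "CARD('i) - 1 - d"] conjI ballI)
  have card_C: "d + card (UNIV - insert a B) + 1 = CARD('i)" if "card B = d" "a \<notin> B" for a :: 'i and B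
  proof -
    have "card (insert a B) = d + 1" using that by (simp add: card_insert_if finite_subset[OF subset_UNIV])
    moreover have "card (insert a B) + card (UNIV - insert a B) = CARD('i)"
      by (subst card_Un_disjoint[symmetric]) (auto intro!: arg_cong[of _ _ card])
    ultimately show ?thesis by simp
  qed
  from ne chart obtain W a B h where "card B = d" "graph_chart Y W a B h" by blast
  then show "d + (CARD('i) - 1 - d) + 1 = CARD('i)"
    using card_C[of B a] by (simp add: graph_chart_def)
  fix p assume "p \<in> Y"
  from chart[OF this] obtain W a B h where p: "p \<in> W" and B: "card B = d" and gc: "graph_chart Y W a B h"
    by blast
  define r where "r = CARD('i) - 1 - d"
  define C where "C = UNIV - insert a B"
  have aB: "a \<notin> B" and W: "open W" "W \<subseteq> chart_dom a" and ph: "poly_fun (h y)"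
    and dep: "(\<forall>b\<in>B. u $ b = u' $ b) \<Longrightarrow> h y u = h y u'"
    and YW: "Y \<inter> W = {q \<in> W. \<forall>y. y \<notin> insert a B \<longrightarrow> aff_coord a y q = h y (\<chi> l. aff_coord a l q)}" for y u u'
    using gc unfolding graph_chart_def by blast+
  have "card C = r" using card_C[OF B aB] by (simp add: r_def C_def)
  then obtain e where e: "bij_betw e {..<r} C"
    using ex_bij_betw_nat_finite[of C] by (auto simp: atLeast0LessThan)
  define g where "g i q = aff_coord a (e i) q - h (e i) (\<chi> l. aff_coord a l q)" for i q
  have g_abs: "g i (abs_proj v) = v $ e i / v $ a - h (e i) (\<chi> l. v $ l / v $ a)" if "v $ a \<noteq> 0" for i v
  proof -
    have "v \<noteq> 0" using that by auto
    then show ?thesis by (simp add: g_def aff_coord_abs)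
  qed
  have open_a: "open {v :: complex ^ 'i. v $ a \<noteq> 0}" by (intro open_Collect_neq continuous_intros)
  have g_cdiff: "cdiff_at (\<lambda>u. g i (abs_proj u)) v" if "v $ a \<noteq> 0" for i v
  proof (rule cdiff_cong[OF _ open_a])
    show "cdiff_at (\<lambda>v. v $ e i / v $ a - h (e i) (\<chi> l. v $ l / v $ a)) v"
      using that by (auto intro!: cdiff_diff cdiff_divide cdiff_coord cdiff_poly_fun_compose[OF ph])
  qed (use that g_abs in auto)
  have Wa: "v $ a \<noteq> 0" if "v \<noteq> 0" "abs_proj v \<in> W" for v
    using that W(2) abs_in_chart_dom by blast
  show "\<exists>W g. open W \<and> p \<in> W \<and> (\<forall>i<CARD('i) - 1 - d. proj_holomorphic_on (g i) W) \<and>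
           Y \<inter> W = {q \<in> W. \<forall>i<CARD('i) - 1 - d. g i q = 0} \<and>
           (\<forall>v c. v \<noteq> 0 \<and> abs_proj v \<in> W \<and>
              (\<forall>h. (\<Sum>i<CARD('i) - 1 - d. c i * frechet_derivative (\<lambda>u. g i (abs_proj u)) (at v) h) = 0)
                \<longrightarrow> (\<forall>i<CARD('i) - 1 - d. c i = 0))"
    unfolding r_def[symmetric]
  proof (intro exI[of _ W] exI[of _ g] conjI allI impI)
    show "proj_holomorphic_on (g i) W" for i
      unfolding proj_holomorphic_on_def using g_cdiff Wa unfolding cdiff_at_def by blast
    have "(\<forall>y. y \<notin> insert a B \<longrightarrow> aff_coord a y q = h y (\<chi> l. aff_coord a l q)) \<longleftrightarrow> (\<forall>i<r. g i q = 0)" for q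
    proof -
      have "(\<forall>i<r. g i q = 0) \<longleftrightarrow> (\<forall>y\<in>e ` {..<r}. aff_coord a y q = h y (\<chi> l. aff_coord a l q))"
        by (auto simp: g_def)
      also have "e ` {..<r} = C" using e by (simp add: bij_betw_def)
      finally show ?thesis by (auto simp: C_def)
    qed
    then show "Y \<inter> W = {q \<in> W. \<forall>i<r. g i q = 0}" unfolding YW by blast
    fix v c i0
    assume v: "v \<noteq> 0 \<and> abs_proj v \<in> W \<and>
      (\<forall>h. (\<Sum>i<r. c i * frechet_derivative (\<lambda>u. g i (abs_proj u)) (at v) h) = 0)" and i0: "i0 < r"
    then have va: "v $ a \<noteq> 0" using Wa by blast
    have frechet: "frechet_derivative (\<lambda>u. g i (abs_proj u)) (at v) (axis (e i0) 1) = (if i = i0 then 1 / v $ a else 0)"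
      if i: "i < r" for i
    proof -
      obtain L where L: "((\<lambda>u. g i (abs_proj u)) has_derivative L) (at v)" "\<And>c h. L (c *s h) = c * L h"
        using g_cdiff[OF va] unfolding cdiff_at_def by blast
      have ei: "e i0 \<notin> insert a B" "e i = e i0 \<longleftrightarrow> i = i0"
        using e i i0 by (auto simp: bij_betw_def C_def inj_on_def)
      have line: "g i (abs_proj (v + t *s axis (e i0) 1)) =
          g i (abs_proj v) + t * (if i = i0 then 1 / v $ a else 0)" for t
      proof -
        have "a \<noteq> e i0" using ei(1) by auto
        then have "(v + t *s axis (e i0) 1) $ a = v $ a" by (simp add: axis_def)
        moreover have "h (e i) (\<chi> l. (v + t *s axis (e i0) 1) $ l / v $ a) = h (e i) (\<chi> l. v $ l / v $ a)"
          by (rule dep) (use ei in \<open>auto simp: axis_def\<close>)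
        ultimately show ?thesis
          using va ei by (auto simp: g_abs axis_def add_divide_distrib)
      qed
      have "((\<lambda>t. g i (abs_proj (v + t *s axis (e i0) 1))) has_derivative (\<lambda>t. L (t *s axis (e i0) 1))) (at 0)"
        by (rule cdiff_line[OF L(1)])
      moreover have "((\<lambda>t. g i (abs_proj (v + t *s axis (e i0) 1))) has_derivative
          (\<lambda>t. t * (if i = i0 then 1 / v $ a else 0))) (at 0)"
        unfolding line using va by (auto intro!: derivative_eq_intros)
      ultimately have "(\<lambda>t. L (t *s axis (e i0) 1)) = (\<lambda>t. t * (if i = i0 then 1 / v $ a else 0))"
        by (rule has_derivative_unique)
      from fun_cong[OF this, of 1] show ?thesis
        using va frechet_derivative_at[OF L(1)] by simp
    qed
    have "0 = (\<Sum>i<r. c i * frechet_derivative (\<lambda>u. g i (abs_proj u)) (at v) (axis (e i0) 1))"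
      using v by simp
    also have "\<dots> = (\<Sum>i<r. if i = i0 then c i / v $ a else 0)"
      by (intro sum.cong refl) (simp add: frechet)
    also have "\<dots> = c i0 / v $ a" using i0 by simp
    finally show "c i0 = 0" using va by simp
  qed (use p W in auto)
qed

text \<open>
  Suppose that near \<open>p\<close> the set is also given by \<open>r\<close> equations with independent differentials,
  where \<open>r\<close> is less than the codimension of the graph. In the slice where the coordinates in
  \<open>B\<close> are frozen, \<open>Y\<close> consists of \<open>p\<close> alone. The differentials vanish on the tangent vectors
  of \<open>Y\<close> and on the radial direction, so they are still independent on the slice, which has
  more than \<open>r\<close> dimensions. By Brouwer's fixed point theorem, the \<open>r\<close> equations then have
  solutions in the slice that are close to \<open>p\<close> but different from \<open>p\<close>. Unlike the implicit
  function theorem, this argument asks for differentiability at one point and continuity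
  nearby, which is what pointwise complex differentiability provides directly.
\<close>

lemma graph_chart_dim_le:
  fixes Y :: "'i::finite proj set"
  assumes gc: "graph_chart Y W a B h" and p: "p \<in> Y" "p \<in> W"
    and W': "open W'" "p \<in> W'" and sub: "proj_submanifold d' (Y \<inter> W')"
  shows "d' \<le> card B"
proof (rule ccontr)
  assume "\<not> d' \<le> card B"
  then have d': "card B < d'" by simp
  have aB: "a \<notin> B" and W: "open W" "W \<subseteq> chart_dom a" and ph: "poly_fun (h y)"
    and dep: "(\<forall>b\<in>B. u $ b = u' $ b) \<Longrightarrow> h y u = h y u'"
    and YW: "Y \<inter> W = {q \<in> W. \<forall>y. y \<notin> insert a B \<longrightarrow> aff_coord a y q = h y (\<chi> l. aff_coord a l q)}" for y u u'
    using gc unfolding graph_chart_def by blast+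
  obtain r where r: "d' + r + 1 = CARD('i)" and local: "\<forall>q\<in>Y \<inter> W'. \<exists>W (g :: nat \<Rightarrow> 'i proj \<Rightarrow> complex).
      open W \<and> q \<in> W \<and> (\<forall>i<r. proj_holomorphic_on (g i) W) \<and>
      Y \<inter> W' \<inter> W = {q \<in> W. \<forall>i<r. g i q = 0} \<and>
      (\<forall>v c. v \<noteq> 0 \<and> abs_proj v \<in> W \<and>
        (\<forall>h. (\<Sum>i<r. c i * frechet_derivative (\<lambda>u. g i (abs_proj u)) (at v) h) = 0)
          \<longrightarrow> (\<forall>i<r. c i = 0))"
    using sub unfolding proj_submanifold_def by blast
  from bspec[OF local IntI[OF p(1) W'(2)]] obtain W'' and g :: "nat \<Rightarrow> 'i proj \<Rightarrow> complex"
    where W'': "open W''" "p \<in> W''"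
    and hol: "\<forall>i<r. proj_holomorphic_on (g i) W''"
    and YW'': "Y \<inter> W' \<inter> W'' = {q \<in> W''. \<forall>i<r. g i q = 0}"
    and indep: "\<forall>v c. v \<noteq> 0 \<and> abs_proj v \<in> W'' \<and>
        (\<forall>h. (\<Sum>i<r. c i * frechet_derivative (\<lambda>u. g i (abs_proj u)) (at v) h) = 0)
          \<longrightarrow> (\<forall>i<r. c i = 0)"
    by (elim exE conjE) (rule that, assumption+)
  define y0 where "y0 = (\<chi> l. aff_coord a l p)"
  have y0: "y0 $ a = 1" "y0 \<noteq> 0" "abs_proj y0 = p"
    unfolding y0_def by (rule normalised_lift[OF subsetD[OF W(2) p(2)]])+
  define U where "U = {v. v \<noteq> 0 \<and> abs_proj v \<in> W \<inter> W' \<inter> W''}"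
  have openU: "open U" unfolding U_def using W W' W'' by (intro open_abs_proj_vimage open_Int)
  have y0U: "y0 \<in> U" unfolding U_def using y0 p W' W'' by auto
  define G where "G i v = g i (abs_proj v)" for i v
  have "\<exists>L. (G i has_derivative L) (at v) \<and> (\<forall>c h. L (c *s h) = c * L h)" if "i < r" "v \<in> U" for i v
    using hol that unfolding G_def proj_holomorphic_on_def U_def by auto
  then obtain LL where LL: "\<And>i v. i < r \<Longrightarrow> v \<in> U \<Longrightarrow> (G i has_derivative LL i v) (at v)"
    "\<And>i v c h. i < r \<Longrightarrow> v \<in> U \<Longrightarrow> LL i v (c *s h) = c * LL i v h" by metis
  define L where "L i = LL i y0" for i
  have L: "(G i has_derivative L i) (at y0)" "L i (c *s h) = c * L i h" if "i < r" for i c h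
    using LL that y0U unfolding L_def by auto
  have L_lin: "L i (x + y) = L i x + L i y" "L i (x - y) = L i x - L i y" "L i (t *\<^sub>R x) = t *\<^sub>R L i x" "L i 0 = 0"
    if "i < r" for i x y t
    using has_derivative_linear[OF L(1)[OF that]]
    by (simp_all add: Real_Vector_Spaces.linear_add linear_diff linear_cmul Real_Vector_Spaces.linear_0)
  have on_Y: "abs_proj v \<in> Y \<longleftrightarrow> (\<forall>i<r. G i v = 0)" if "v \<in> U" for v
    using YW'' that unfolding U_def G_def by auto
  have on_graph: "abs_proj v \<in> Y \<longleftrightarrow> (\<forall>y. y \<notin> insert a B \<longrightarrow> v $ y = h y v)" if "v \<in> U" "v $ a = 1" for v
  proof -
    have nz: "v \<noteq> 0" using that(2) by auto
    have 1: "(\<chi> l. aff_coord a l (abs_proj v)) = v"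
      using nz that(2) by (simp add: aff_coord_abs cart_eq_iff)
    have 2: "aff_coord a y (abs_proj v) = v $ y" for y using nz that(2) by (simp add: aff_coord_abs)
    have vW: "abs_proj v \<in> W" using that(1) unfolding U_def by auto
    have "abs_proj v \<in> Y \<longleftrightarrow> abs_proj v \<in> Y \<inter> W" using vW by blast
    also have "\<dots> \<longleftrightarrow> (\<forall>y. y \<notin> insert a B \<longrightarrow> aff_coord a y (abs_proj v) = h y (\<chi> l. aff_coord a l (abs_proj v)))"
      unfolding YW using vW by blast
    finally show ?thesis unfolding 2 vec_lambda_eta .
  qed
  define S0 where "S0 = {s :: complex ^ 'i. \<forall>l. l \<notin> UNIV - insert a B \<longrightarrow> s $ l = 0}"
  have S0a: "s $ a = 0" and S0B: "b \<in> B \<Longrightarrow> s $ b = 0" if "s \<in> S0" for s b using that unfolding S0_def by auto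
  have y0h: "y0 $ y = h y y0" if "y \<notin> insert a B" for y
    using on_graph[OF y0U y0(1)] y0(3) p(1) that by auto
  \<comment> \<open>Over a fixed point of the base, a graph has a single point.\<close>
  have isolated: "s = 0" if sS: "s \<in> S0" and sU: "y0 + s \<in> U" and sG: "\<forall>i<r. G i (y0 + s) = 0" for s
  proof -
    have a1: "(y0 + s) $ a = 1" using S0a[OF that(1)] y0 by simp
    have "s $ y = 0" if y: "y \<notin> insert a B" for y
    proof -
      have "(y0 + s) $ y = h y (y0 + s)" using on_Y[OF sU] sG on_graph[OF sU a1] y by blast
      also have "\<dots> = h y y0" by (rule dep) (simp add: S0B[OF \<open>s \<in> S0\<close>])
      finally show ?thesis using y0h[OF y] by simp
    qed
    with S0a[OF sS] S0B[OF sS] have "s $ l = 0" for l by (cases "l \<in> insert a B") auto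
    then show "s = 0" by (simp add: cart_eq_iff)
  qed
  have radial: "L i y0 = 0" if "i < r" for i
  proof -
    have "((\<lambda>t. G i (y0 + t *s y0)) has_derivative (\<lambda>t. L i (t *s y0))) (at 0)"
      by (rule cdiff_line[OF L(1)[OF that]])
    moreover have "((\<lambda>t. G i (y0 + t *s y0)) has_derivative (\<lambda>t. 0)) (at 0)"
    proof (rule has_derivative_transform_within_open[of "\<lambda>t. G i y0" _ _ _ "{t. t \<noteq> -1}"])
      fix t :: complex assume "t \<in> {t. t \<noteq> -1}"
      then have "1 + t \<noteq> 0" by (metis add_eq_0_iff mem_Collect_eq)
      moreover have "y0 + t *s y0 = (1 + t) *s y0"
        by (simp add: cart_eq_iff algebra_simps)
      ultimately show "G i y0 = G i (y0 + t *s y0)"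
        using abs_proj_scale[OF y0(2), of "1 + t"] by (simp only: G_def not_False_eq_True)
    qed (auto intro!: open_Collect_neq continuous_intros)
    ultimately have "(\<lambda>t. L i (t *s y0)) = (\<lambda>t. 0)" by (rule has_derivative_unique)
    from fun_cong[OF this, of 1] show ?thesis by simp
  qed
  \<comment> \<open>After subtracting a radial vector and the velocity of a curve \<open>\<gamma>\<close> in \<open>Y\<close>, both in the kernel
      of all \<open>L i\<close>, any vector \<open>z\<close> ends up in the slice.\<close>
  have slice_onto: "\<exists>s\<in>S0. \<forall>i<r. L i s = L i z" for z
  proof -
    define z' where "z' = z - (z $ a) *s y0"
    have "\<exists>D. (h l has_derivative D) (at y0) \<and> (\<forall>c x. D (c *s x) = c * D x)" for l
      using cdiff_poly_fun[OF ph] unfolding cdiff_at_def by blast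
    then obtain D where D: "\<And>l. (h l has_derivative D l) (at y0)" "\<And>l c x. D l (c *s x) = c * D l x" by metis
    define \<gamma> where "\<gamma> t = (\<chi> l. if l = a then 1 else if l \<in> B then y0 $ l + t * z' $ l else h l (y0 + t *s z'))" for t
    define \<tau> where "\<tau> = (\<chi> l. if l = a then 0 else if l \<in> B then z' $ l else D l z')"
    have \<gamma>0: "\<gamma> 0 = y0" using y0 y0h by (auto simp: \<gamma>_def cart_eq_iff)
    have der: "(\<gamma> has_derivative (\<lambda>t. t *s \<tau>)) (at 0)"
    proof (rule has_derivative_vecI)
      fix l
      have "((\<lambda>t. h l (y0 + t *s z')) has_derivative (\<lambda>t. t * D l z')) (at 0)"
        using cdiff_line[OF D(1), of l z'] by (simp add: D(2))
      moreover have "((\<lambda>t. y0 $ l + t * z' $ l) has_derivative (\<lambda>t. t * z' $ l)) (at 0)"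
        by (auto intro!: derivative_eq_intros)
      ultimately show "((\<lambda>t. \<gamma> t $ l) has_derivative (\<lambda>t. (t *s \<tau>) $ l)) (at 0)"
        by (auto simp: \<gamma>_def \<tau>_def)
    qed
    have "isCont \<gamma> 0" using der has_derivative_continuous by blast
    then obtain V where V: "open V" "0 \<in> V" "\<And>t. t \<in> V \<Longrightarrow> \<gamma> t \<in> U"
      using continuous_at_open[THEN iffD1, rule_format, of 0 \<gamma> U] openU y0U \<gamma>0 by auto
    have in_Y: "abs_proj (\<gamma> t) \<in> Y" if "t \<in> V" for t
    proof -
      have "h y (\<gamma> t) = h y (y0 + t *s z')" for y
        by (rule dep) (use aB in \<open>auto simp: \<gamma>_def\<close>)
      then show ?thesis using on_graph[OF V(3)[OF that]] by (auto simp: \<gamma>_def)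
    qed
    have "L i \<tau> = 0" if i: "i < r" for i
    proof -
      have "((\<lambda>t. G i (\<gamma> t)) has_derivative (\<lambda>t. L i (t *s \<tau>))) (at 0)"
        by (rule has_derivative_compose[OF der]) (simp add: \<gamma>0 L(1)[OF i])
      moreover have "((\<lambda>t. G i (\<gamma> t)) has_derivative (\<lambda>t. 0)) (at 0)"
        by (rule has_derivative_transform_within_open[of "\<lambda>t. 0" _ _ _ V])
           (use V in_Y on_Y i in auto)
      ultimately have "(\<lambda>t. L i (t *s \<tau>)) = (\<lambda>t. 0)" by (rule has_derivative_unique)
      from fun_cong[OF this, of 1] show ?thesis by simp
    qed
    then have "L i (z' - \<tau>) = L i z" if "i < r" for i
      using that radial by (simp add: z'_def L_lin L(2))
    moreover have "z' - \<tau> \<in> S0"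
      using y0(1) by (auto simp: S0_def \<tau>_def z'_def)
    ultimately show ?thesis by blast
  qed
  \<comment> \<open>The \<open>r\<close> functions are collected into one map to the ambient space, with values in the span
      \<open>R\<close> of \<open>r\<close> coordinate axes, because their number \<open>r\<close> cannot be the dimension of a
      type.\<close>
  obtain ee :: "nat \<Rightarrow> 'i" where ee: "inj_on ee {..<r}"
    using card_le_inj[of "{..<r}" "UNIV :: 'i set"] r by auto
  define F where "F v = (\<Sum>i<r. axis (ee i) (G i v))" for v
  define DF where "DF v = (\<Sum>i<r. axis (ee i) (L i v))" for v
  have ee_comp: "(\<Sum>i<r. axis (ee i) (x i)) $ ee i0 = x i0" if "i0 < r" for x :: "nat \<Rightarrow> complex" and i0
  proof -
    have "(\<Sum>i<r. axis (ee i) (x i)) $ ee i0 = (\<Sum>i<r. if i = i0 then x i else 0)"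
      unfolding sum_component by (intro sum.cong refl) (use ee that in \<open>auto simp: axis_def inj_on_def\<close>)
    then show ?thesis using that by simp
  qed
  have ee_out: "(\<Sum>i<r. axis (ee i) (x i)) $ l = 0" if "l \<notin> ee ` {..<r}" for x :: "nat \<Rightarrow> complex" and l
    using that by (auto simp: axis_def intro!: sum.neutral)
  define R where "R = {z :: complex ^ 'i. \<forall>l. l \<notin> ee ` {..<r} \<longrightarrow> z $ l = 0}"
  have F_R: "F v \<in> R" and DF_R: "DF v \<in> R" for v 
    unfolding R_def F_def DF_def mem_Collect_eq by (intro allI impI ee_out; assumption)+
  have F_der: "(F has_derivative DF) (at y0)"
    unfolding F_def DF_def by (intro has_derivative_sum bounded_linear.has_derivative[OF bounded_linear_axis] L) auto
  have F_cont: "isCont F v" if "v \<in> U" for v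
    unfolding F_def by (intro continuous_sum bounded_linear.continuous[OF bounded_linear_axis] has_derivative_continuous[OF LL(1)]) (use that in auto)
  have F_y0: "F y0 = 0" unfolding F_def using on_Y[OF y0U] y0(3) p(1)
    by (auto simp: axis_def cart_eq_iff intro!: sum.neutral)
  have DF_lin: "linear DF" using F_der has_derivative_linear by blast
  have sub_R: "Real_Vector_Spaces.subspace R" and sub_S0: "Real_Vector_Spaces.subspace S0"
    unfolding R_def S0_def Real_Vector_Spaces.subspace_def by auto
  have dim_R: "dim R = 2 * r" unfolding R_def dim_coordinate_subspace card_image[OF ee] by simp
  have dim_S0: "dim S0 > 2 * r"
  proof -
    have "card (insert a B) = card B + 1" using aB by (simp add: card_insert_if finite_subset[OF subset_UNIV])
    moreover have "card (insert a B) + card (UNIV - insert a B) = CARD('i)"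
      by (subst card_Un_disjoint[symmetric]) (auto intro!: arg_cong[of _ _ card])
    ultimately show ?thesis unfolding S0_def dim_coordinate_subspace using r d' by simp
  qed
  \<comment> \<open>Otherwise some \<open>w\<close> in \<open>R\<close> is orthogonal to the image, and its conjugate entries are the
      coefficients of a linear relation between the differentials.\<close>
  have onto: "DF ` S0 = R"
  proof (rule ccontr)
    assume "DF ` S0 \<noteq> R"
    moreover have "DF ` S0 \<subseteq> R" using DF_R by auto
    ultimately have "DF ` S0 \<subset> R" by blast
    moreover have subi: "Real_Vector_Spaces.subspace (DF ` S0)" using DF_lin sub_S0 by (rule linear_subspace_image)
    ultimately have "span (DF ` S0) \<subset> span R" using sub_R by (simp add: span_eq_iff[THEN iffD2])
    then obtain w where w: "w \<noteq> 0" "w \<in> span R" "\<And>y. y \<in> span (DF ` S0) \<Longrightarrow> Linear_Algebra.orthogonal w y"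
      using orthogonal_to_subspace_exists_gen by metis
    have wR: "w \<in> R" using w(2) sub_R by (simp add: span_eq_iff[THEN iffD2])
    define c where "c i = cnj (w $ ee i)" for i
    have inner_DF: "w \<bullet> DF s = Re (\<Sum>i<r. c i * L i s)" for s
      unfolding DF_def inner_sum_right Re_sum
      by (intro sum.cong refl) (simp add: inner_axis c_def inner_complex_def)
    have orth: "w \<bullet> DF s = 0" if "s \<in> S0" for s
      using w(3)[OF span_base] that unfolding Linear_Algebra.orthogonal_def by auto
    have zero: "(\<Sum>i<r. c i * L i s) = 0" if s: "s \<in> S0" for s
    proof -
      have "\<i> *s s \<in> S0" using s unfolding S0_def by auto
      then have "0 = Re (\<Sum>i<r. c i * L i (\<i> *s s))" using orth inner_DF by metis
      also have "(\<Sum>i<r. c i * L i (\<i> *s s)) = \<i> * (\<Sum>i<r. c i * L i s)"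
        unfolding sum_distrib_left by (intro sum.cong refl) (simp add: L(2))
      finally have "Im (\<Sum>i<r. c i * L i s) = 0" by simp
      moreover have "Re (\<Sum>i<r. c i * L i s) = 0" using orth[OF s] inner_DF by metis
      ultimately show ?thesis by (simp add: complex_eq_iff)
    qed
    have "(\<Sum>i<r. c i * L i z) = 0" for z
    proof -
      from slice_onto[of z] obtain s where "s \<in> S0" "\<forall>i<r. L i s = L i z" by blast
      with zero[of s] show ?thesis by simp
    qed
    moreover have fr: "frechet_derivative (\<lambda>u. g i (abs_proj u)) (at y0) = L i" if "i < r" for i
      using frechet_derivative_at[OF L(1)[OF that]] unfolding G_def by simp
    have "(\<Sum>i<r. c i * frechet_derivative (\<lambda>u. g i (abs_proj u)) (at y0) z) = (\<Sum>i<r. c i * L i z)" for z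
      by (intro sum.cong refl) (simp add: fr)
    ultimately have "\<forall>z. (\<Sum>i<r. c i * frechet_derivative (\<lambda>u. g i (abs_proj u)) (at y0) z) = 0"
      by simp
    moreover have "abs_proj y0 \<in> W''" using y0(3) W''(2) by simp
    ultimately have "\<forall>i<r. c i = 0"
      using y0(2) by (intro indep[THEN spec, THEN spec, THEN mp, of y0 c] conjI)
    then have "w $ l = 0" for l
      using wR unfolding R_def c_def by (cases "l \<in> ee ` {..<r}") auto
    with w(1) show False by (simp add: cart_eq_iff)
  qed
  \<comment> \<open>\<open>T\<close> is a real linear right inverse of the differential on the slice. For reasons of
      dimension it misses some direction \<open>w\<close> of the slice.\<close>
  obtain T where T: "range T \<subseteq> S0" "linear T" "\<And>y. y \<in> R \<Longrightarrow> DF (T y) = y"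
    using linear_exists_right_inverse_on[OF DF_lin sub_S0] onto by auto
  have "\<exists>w\<in>S0. w \<notin> T ` R"
  proof (rule ccontr)
    assume "\<not> ?thesis"
    then have "dim S0 \<le> dim (T ` R)" by (intro dim_subset) auto
    also have "\<dots> \<le> dim R" using T(2) by (rule dim_image_le)
    finally show False using dim_S0 dim_R by simp
  qed
  then obtain w where w: "w \<in> S0" "w \<notin> T ` R" by blast
  obtain K where K: "K > 0" "\<And>y. norm (T y) \<le> K * norm y" using linear_bounded_pos[OF T(2)] by blast
  define \<kappa> where "\<kappa> = 1 / (2 * K)"
  have "\<kappa> > 0" using K by (simp add: \<kappa>_def)
  then obtain d1 where d1: "d1 > 0" "\<And>y. norm (y - y0) < d1 \<Longrightarrow> norm (F y - F y0 - DF (y - y0)) \<le> \<kappa> * norm (y - y0)"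
    using F_der unfolding has_derivative_at_alt by blast
  obtain d2 where d2: "d2 > 0" "ball y0 d2 \<subseteq> U" using openU y0U open_contains_ball by blast
  define d0 where "d0 = min d1 d2"
  define \<delta> where "\<delta> = d0 / (4 * K)"
  have \<delta>: "\<delta> > 0" using d1 d2 K by (simp add: \<delta>_def d0_def)
  define M where "M = norm (DF w) + (\<kappa> + 1) * norm w + 1"
  have M: "M > 0" unfolding M_def using \<open>\<kappa> > 0\<close> by (intro add_nonneg_pos add_nonneg_nonneg) auto
  define \<epsilon> where "\<epsilon> = min (\<delta> / 2) (d0 / 4) / M"
  have \<epsilon>: "\<epsilon> > 0" using \<delta> d1 d2 M by (simp add: \<epsilon>_def d0_def)
  have \<epsilon>M: "\<epsilon> * M \<le> \<delta> / 2" "\<epsilon> * M \<le> d0 / 4" using M by (simp_all add: \<epsilon>_def)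
  have "norm (DF w) + \<kappa> * norm w \<le> M" "norm w \<le> M" using \<open>\<kappa> > 0\<close> unfolding M_def by (auto simp: algebra_simps)
  then have eps1: "\<epsilon> * (norm (DF w) + \<kappa> * norm w) \<le> \<delta> / 2" and eps2: "\<epsilon> * norm w \<le> d0 / 4"
    using \<epsilon>M \<epsilon> by (meson less_imp_le mult_left_mono order_trans)+
  \<comment> \<open>For small \<open>\<delta>\<close> and much smaller \<open>\<epsilon>\<close>, the map \<open>y \<mapsto> y - F (y0 + T y + \<epsilon> w)\<close> sends the ball \<open>X\<close>
      in \<open>R\<close> to itself, since \<open>F\<close> is close to its differential. A fixed point is a zero of
      \<open>F\<close> in the slice, and it is different from \<open>y0\<close> since \<open>w\<close> is not in the image of \<open>T\<close>.\<close>
  define X where "X = cball 0 \<delta> \<inter> R"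
  define s where "s y = T y + \<epsilon> *\<^sub>R w" for y
  have s_S0: "s y \<in> S0" for y
    unfolding s_def using T(1) w(1) sub_S0 by (intro subspace_add subspace_scale) auto
  have s_small: "norm (s y) \<le> K * \<delta> + \<epsilon> * norm w" "norm (s y) < d0" if "y \<in> X" for y
  proof -
    have "norm y \<le> \<delta>" using that by (simp add: X_def)
    then have "norm (T y) \<le> K * \<delta>"
      using K(2)[of y] mult_left_mono[of "norm y" \<delta> K] K(1) by linarith
    then show 1: "norm (s y) \<le> K * \<delta> + \<epsilon> * norm w"
      using \<epsilon> norm_triangle_ineq[of "T y" "\<epsilon> *\<^sub>R w"] by (simp add: s_def)
    have "K * \<delta> = d0 / 4" using K by (simp add: \<delta>_def)
    moreover have "d0 > 0" using d1 d2 by (simp add: d0_def)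
    ultimately show "norm (s y) < d0" using 1 eps2 by simp
  qed
  have s_U: "y0 + s y \<in> U" if "y \<in> X" for y
    using s_small(2)[OF that] d2(2) by (auto simp: d0_def dist_norm subset_iff)
  have "\<exists>y\<in>X. y - F (y0 + s y) = y"
  proof (rule brouwer[where f="\<lambda>y. y - F (y0 + s y)" and S=X, THEN bexE])
    show "compact X" unfolding X_def using closed_subspace[OF sub_R] by (simp add: compact_Int_closed)
    show "convex X" unfolding X_def using subspace_imp_convex[OF sub_R] by (simp add: convex_Int)
    have "0 \<in> X" unfolding X_def using \<delta> sub_R by (simp add: subspace_0)
    then show "X \<noteq> {}" by blast
    have "continuous_on X T" using T(2) by (simp add: linear_continuous_on linear_linear)
    then have "continuous_on X (\<lambda>y. y0 + s y)" unfolding s_def by (intro continuous_intros)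
    moreover have "continuous_on ((\<lambda>y. y0 + s y) ` X) F"
      by (rule continuous_at_imp_continuous_on) (use F_cont s_U in auto)
    ultimately show "continuous_on X (\<lambda>y. y - F (y0 + s y))"
      using continuous_on_compose2[of _ F X "\<lambda>y. y0 + s y"] by (intro continuous_intros) auto
    show "(\<lambda>y. y - F (y0 + s y)) \<in> X \<rightarrow> X"
    proof
      fix y assume y: "y \<in> X"
      then have yR: "y \<in> R" by (simp add: X_def)
      have "DF (s y) = y + \<epsilon> *\<^sub>R DF w"
        unfolding s_def using DF_lin T(3)[OF yR] by (simp add: Real_Vector_Spaces.linear_add linear_cmul)
      then have "y - F (y0 + s y) = - (F (y0 + s y) - F y0 - DF (s y)) - \<epsilon> *\<^sub>R DF w"
        using F_y0 by simp
      then have "norm (y - F (y0 + s y)) \<le> norm (F (y0 + s y) - F y0 - DF (s y)) + norm (\<epsilon> *\<^sub>R DF w)"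
        by (metis norm_minus_cancel norm_triangle_ineq4)
      also have "norm (F (y0 + s y) - F y0 - DF (s y)) \<le> \<kappa> * norm (s y)"
        using d1(2)[of "y0 + s y"] s_small(2)[OF y] by (simp add: d0_def)
      also have "\<dots> \<le> \<kappa> * (K * \<delta> + \<epsilon> * norm w)"
        using s_small(1)[OF y] \<open>\<kappa> > 0\<close> by simp
      also have "\<dots> = \<delta> / 2 + \<epsilon> * (\<kappa> * norm w)" using K by (simp add: \<kappa>_def algebra_simps)
      finally have "norm (y - F (y0 + s y)) \<le> \<delta> / 2 + \<epsilon> * (norm (DF w) + \<kappa> * norm w)"
        using \<epsilon> by (simp add: algebra_simps)
      with eps1 have "norm (y - F (y0 + s y)) \<le> \<delta>" by simp
      moreover have "y - F (y0 + s y) \<in> R" using sub_R yR F_R by (intro subspace_diff)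
      ultimately show "y - F (y0 + s y) \<in> X" unfolding X_def by simp
    qed
  qed auto
  then obtain y where y: "y \<in> X" "F (y0 + s y) = 0" by auto
  have "G i (y0 + s y) = 0" if "i < r" for i
    using ee_comp[OF that, of "\<lambda>i. G i (y0 + s y)"] y(2) unfolding F_def by simp
  then have "s y = 0" using isolated[OF s_S0 s_U[OF y(1)]] by blast
  then have "\<epsilon> *\<^sub>R w = - T y" unfolding s_def by (simp add: add_eq_0_iff)
  then have "w = (1 / \<epsilon>) *\<^sub>R (- T y)" using \<epsilon> by (metis divideR_right inverse_eq_divide less_numeral_extra(3))
  also have "\<dots> = T ((- 1 / \<epsilon>) *\<^sub>R y)" unfolding linear_cmul[OF T(2)] by simp
  also have "\<dots> \<in> T ` R" using y(1) sub_R unfolding X_def by (intro imageI subspace_scale) auto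
  finally show False using w(2) by blast
qed

lemma graph_chart_proj_dim:
  fixes Y :: "'i::finite proj set"
  assumes ne: "Y \<noteq> {}"
    and chart: "\<And>p. p \<in> Y \<Longrightarrow> \<exists>W a B h. p \<in> W \<and> card B = d \<and> graph_chart Y W a B h"
  shows "proj_dim Y d"
  unfolding proj_dim_def
proof (intro conjI allI impI)
  show "\<exists>W. open W \<and> Y \<inter> W \<noteq> {} \<and> proj_submanifold d (Y \<inter> W)"
    using ne graph_chart_submanifold[OF ne chart] by (intro exI[of _ UNIV]) auto
  fix d' W assume "open W \<and> Y \<inter> W \<noteq> {} \<and> proj_submanifold d' (Y \<inter> W)"
  then obtain p where "p \<in> Y" "p \<in> W" "open W" "proj_submanifold d' (Y \<inter> W)" by blast
  with chart[of p] graph_chart_dim_le show "d' \<le> d" by metis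
qed

lemma graph_chart_restrict:
  assumes "graph_chart Y W a B h" "open V" shows "graph_chart (Y \<inter> V) (W \<inter> V) a B h"
proof -
  have "Y \<inter> V \<inter> (W \<inter> V) = (Y \<inter> W) \<inter> V" by blast
  then show ?thesis using assms unfolding graph_chart_def by (auto intro!: open_Int)
qed


section \<open>Irreducible closed sets\<close>

lemma homogeneous_poly_zero_scale:
  assumes "homogeneous_poly f" "c \<noteq> 0" shows "f (c *s v) = 0 \<longleftrightarrow> f v = 0"
  using assms unfolding homogeneous_poly_def by auto

lemma zariski_zero_set_iff:
  assumes "\<forall>f\<in>P. homogeneous_poly f" "v \<noteq> 0"
  shows "abs_proj v \<in> {abs_proj v |v. v \<noteq> 0 \<and> (\<forall>f\<in>P. f v = 0)} \<longleftrightarrow> (\<forall>f\<in>P. f v = 0)"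
proof
  assume "abs_proj v \<in> {abs_proj v |v. v \<noteq> 0 \<and> (\<forall>f\<in>P. f v = 0)}"
  then obtain u where u: "u \<noteq> 0" "\<forall>f\<in>P. f u = 0" "abs_proj u = abs_proj v" by auto
  then obtain c where "c \<noteq> 0" "v = c *s u" using abs_proj_eq_iff[OF u(1) assms(2)] by auto
  with u assms(1) homogeneous_poly_zero_scale show "\<forall>f\<in>P. f v = 0" by blast
qed (use assms in blast)

text \<open>
  If polynomials \<open>f\<close> and \<open>g\<close> do not vanish identically on \<open>V\<close>, join two parameters that
  witness this by a line. Along the line, \<open>f\<close>, \<open>g\<close> and a coordinate of \<open>Psi\<close> become nonzero
  polynomials in one variable, so they are simultaneously nonzero at some point of it. The
  coordinate of \<open>Psi\<close> ensures that this parameter describes a point of \<open>V\<close>.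
\<close>

lemma proj_variety_param:
  fixes Psi :: "complex ^ 'j::finite \<Rightarrow> complex ^ 'i::finite"
  assumes poly: "\<And>i. poly_fun (\<lambda>w. Psi w $ i)"
    and closed: "zariski_closed V" and V: "V = {abs_proj (Psi w) |w. Psi w \<noteq> 0}" and ne: "V \<noteq> {}"
  shows "proj_variety V"
  unfolding proj_variety_def
proof (intro conjI allI impI closed ne)
  fix A B assume A: "zariski_closed A" and B: "zariski_closed B" and sub: "V \<subseteq> A \<union> B"
  obtain P where P: "\<forall>f\<in>P. homogeneous_poly f" "A = {abs_proj v |v. v \<noteq> 0 \<and> (\<forall>f\<in>P. f v = 0)}"
    using A unfolding zariski_closed_def by blast
  obtain Q where Q: "\<forall>f\<in>Q. homogeneous_poly f" "B = {abs_proj v |v. v \<noteq> 0 \<and> (\<forall>f\<in>Q. f v = 0)}"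
    using B unfolding zariski_closed_def by blast
  show "V \<subseteq> A \<or> V \<subseteq> B"
  proof (rule ccontr)
    assume "\<not> (V \<subseteq> A \<or> V \<subseteq> B)"
    then obtain w0 w1 where w: "Psi w0 \<noteq> 0" "abs_proj (Psi w0) \<notin> A" "Psi w1 \<noteq> 0" "abs_proj (Psi w1) \<notin> B"
      unfolding V by blast
    obtain f where f: "f \<in> P" "f (Psi w0) \<noteq> 0"
      using w(2) zariski_zero_set_iff[OF P(1) w(1)] unfolding P(2) by auto
    obtain g where g: "g \<in> Q" "g (Psi w1) \<noteq> 0"
      using w(4) zariski_zero_set_iff[OF Q(1) w(3)] unfolding Q(2) by auto
    obtain i where i: "Psi w0 $ i \<noteq> 0" using w(1) by (auto simp: cart_eq_iff)
    have pf: "poly_fun f" "poly_fun g" using f g P(1) Q(1) by (auto simp: homogeneous_poly_def)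
    obtain pf where 1: "\<And>t. f (Psi (w0 + t *s (w1 - w0))) = poly pf t"
      using poly_fun_on_line[OF poly_fun_compose[OF pf(1) poly]] by blast
    obtain pg where 2: "\<And>t. g (Psi (w0 + t *s (w1 - w0))) = poly pg t"
      using poly_fun_on_line[OF poly_fun_compose[OF pf(2) poly]] by blast
    obtain pi where 3: "\<And>t. Psi (w0 + t *s (w1 - w0)) $ i = poly pi t"
      using poly_fun_on_line[OF poly] by blast
    have "pf \<noteq> 0" "pg \<noteq> 0" "pi \<noteq> 0" using 1[of 0] 2[of 1] 3[of 0] f g i by auto
    then have "pf * pg * pi \<noteq> 0" by simp
    then obtain t where "poly (pf * pg * pi) t \<noteq> 0" using poly_all_0_iff_0 by blast
    then have t: "poly pf t \<noteq> 0" "poly pg t \<noteq> 0" "poly pi t \<noteq> 0" by auto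
    define v where "v = Psi (w0 + t *s (w1 - w0))"
    have v: "v \<noteq> 0" "f v \<noteq> 0" "g v \<noteq> 0" using t 1[of t] 2[of t] 3[of t] unfolding v_def by auto
    have "abs_proj v \<in> V" using v(1) unfolding V v_def by blast
    moreover have "abs_proj v \<notin> A" using zariski_zero_set_iff[OF P(1) v(1)] v f unfolding P(2) by auto
    moreover have "abs_proj v \<notin> B" using zariski_zero_set_iff[OF Q(1) v(1)] v g unfolding Q(2) by auto
    ultimately show False using sub by blast
  qed
qed


section \<open>The Segre variety and monomial graphs inside it\<close>

definition tensor :: "('k::finite \<Rightarrow> bool \<Rightarrow> complex) \<Rightarrow> complex ^ ('k \<Rightarrow> bool)" where
  "tensor u = (\<chi> x. \<Prod>j\<in>UNIV. u j (x j))"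

lemma tensor_nth [simp]: "tensor u $ x = (\<Prod>j\<in>UNIV. u j (x j))"
  by (simp add: tensor_def)

lemma tensor_nonzero_iff: "tensor u \<noteq> 0 \<longleftrightarrow> (\<forall>j. \<exists>b. u j b \<noteq> 0)"
proof
  assume "\<forall>j. \<exists>b. u j b \<noteq> 0"
  then obtain x where "\<And>j. u j (x j) \<noteq> 0" by metis
  then have "tensor u $ x \<noteq> 0" by simp
  then show "tensor u \<noteq> 0" by (metis zero_index)
qed (auto simp: cart_eq_iff)

lemma tensor_scale:
  assumes "\<And>j b. u j b = c j * w j b" shows "tensor u = (\<Prod>j\<in>UNIV. c j) *s tensor w"
  by (simp add: cart_eq_iff assms prod.distrib)

lemma tensor_upd: "tensor u $ (x(j := b)) = u j b * (\<Prod>i\<in>UNIV - {j}. u i (x i))"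
  by (simp add: prod.remove[of _ j])

lemma aff_coord_tensor:
  assumes "tensor u $ a \<noteq> 0"
  shows "aff_coord a y (abs_proj (tensor u)) = (\<Prod>j\<in>{j. y j \<noteq> a j}. u j (\<not> a j) / u j (a j))"
proof -
  have nz: "tensor u \<noteq> 0" using assms by (metis zero_index)
  have ua: "u j (a j) \<noteq> 0" for j using assms by simp
  have "aff_coord a y (abs_proj (tensor u)) = (\<Prod>j\<in>UNIV. u j (y j) / u j (a j))"
    by (simp add: aff_coord_abs[OF nz] prod_dividef)
  also have "\<dots> = (\<Prod>j\<in>{j. y j \<noteq> a j}. u j (y j) / u j (a j))"
    by (rule prod.mono_neutral_right) (auto simp: ua)
  also have "\<dots> = (\<Prod>j\<in>{j. y j \<noteq> a j}. u j (\<not> a j) / u j (a j))"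
    by (intro prod.cong refl) (metis (full_types) mem_Collect_eq)
  finally show ?thesis .
qed

lemma eq_if_aff_coord_eq:
  assumes "p \<in> chart_dom a" "q \<in> chart_dom a" "\<And>y. aff_coord a y p = aff_coord a y q"
  shows "p = q"
proof -
  have "(\<chi> y. aff_coord a y p) = (\<chi> y. aff_coord a y q)" by (simp only: assms(3))
  then show ?thesis by (metis normalised_lift(4) assms(1,2))
qed

lemma M_var_iff_vec:
  assumes "v \<noteq> 0"
  shows "abs_proj v \<in> M_var \<longleftrightarrow> (\<forall>x y z w.
     (\<forall>j. of_bool (x j) + of_bool (y j) = (of_bool (z j) + of_bool (w j) :: int)) \<longrightarrow>
     v $ x * v $ y = v $ z * v $ w)"
proof -
  obtain c where c: "c \<noteq> 0" "rep_proj (abs_proj v) = c *s v" using rep_abs_proj[OF assms] .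
  have "rep_proj (abs_proj v) $ x * rep_proj (abs_proj v) $ y = rep_proj (abs_proj v) $ z * rep_proj (abs_proj v) $ w
    \<longleftrightarrow> v $ x * v $ y = v $ z * v $ w" for x y z w
  proof -
    have "(c * v $ x) * (c * v $ y) = c\<^sup>2 * (v $ x * v $ y)" for x y by (simp add: power2_eq_square)
    then show ?thesis unfolding c using c(1) by simp
  qed
  then show ?thesis unfolding M_var_def mem_Collect_eq by presburger
qed

lemma M_var_tensor: "tensor u \<noteq> 0 \<Longrightarrow> abs_proj (tensor u) \<in> M_var"
proof (subst M_var_iff_vec, assumption, intro allI impI)
  fix x y z w :: "'a \<Rightarrow> bool"
  assume eq: "\<forall>j. of_bool (x j) + of_bool (y j) = (of_bool (z j) + of_bool (w j) :: int)"
  have "u j (x j) * u j (y j) = u j (z j) * u j (w j)" for j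
    using eq[rule_format, of j] by (cases "x j"; cases "y j"; cases "z j"; cases "w j") auto
  then show "tensor u $ x * tensor u $ y = tensor u $ z * tensor u $ w"
    unfolding tensor_nth prod.distrib[symmetric] by (simp only:)
qed

text \<open>
  Exchanging the entries at a single label is the simplest of the equations of \<open>M_var\<close>.
  Starting from \<open>a\<close> with \<open>v $ a \<noteq> 0\<close>, the entries are changed into those of \<open>x\<close> one after the
  other, and each change multiplies the coordinate by the same factor as it does at \<open>a\<close>.
\<close>

lemma tensor_if_swap:
  assumes v: "v \<noteq> 0" and swap: "\<And>j x y. v $ (x(j := True)) * v $ (y(j := False)) = v $ (x(j := False)) * v $ (y(j := True))"
  obtains u where "tensor u \<noteq> 0" "abs_proj v = abs_proj (tensor u)"
proof -
  have swap': "v $ (x(j := b)) * v $ (y(j := b')) = v $ (x(j := b')) * v $ (y(j := b))" for x y j b b'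
    using swap[of x j y] by (cases b; cases b') auto
  obtain a where a: "v $ a \<noteq> 0" using v by (auto simp: cart_eq_iff)
  define u where "u j b = v $ (a(j := b)) / v $ a" for j b
  have on_subset: "v $ (\<lambda>j. if j \<in> S then x j else a j) = v $ a * (\<Prod>j\<in>S. u j (x j))" if "finite S" for S x
    using that
  proof (induction S)
    case (insert i S)
    define z where "z = (\<lambda>j. if j \<in> S then x j else a j)"
    have e1: "(\<lambda>j. if j \<in> insert i S then x j else a j) = z(i := x i)"
      by (rule ext) (simp add: z_def)
    have e2: "z(i := a i) = z"
      by (rule ext) (use insert(2) in \<open>simp add: z_def\<close>)
    have "v $ (\<lambda>j. if j \<in> insert i S then x j else a j) * v $ a = v $ z * v $ (a(i := x i))"
      using swap'[of z i "x i" a "a i"] unfolding e1 e2 fun_upd_triv .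
    then show ?case using a insert by (simp add: u_def z_def field_simps)
  qed simp
  have eq: "v $ x = v $ a * (\<Prod>j\<in>UNIV. u j (x j))" for x
    by (rule on_subset[of UNIV x, simplified])
  have v_eq: "v = v $ a *s tensor u"
  proof (rule iffD2[OF cart_eq_iff], intro allI)
    show "v $ x = (v $ a *s tensor u) $ x" for x by (subst eq) simp
  qed
  then have nz: "tensor u \<noteq> 0" using v by (metis vec.scale_zero_right)
  have "abs_proj v = abs_proj (tensor u)" using a abs_proj_scale[OF nz] v_eq by metis
  with nz show ?thesis by (rule that)
qed

lemma M_var_if_swap:
  assumes "v \<noteq> 0" "\<And>j x y. v $ (x(j := True)) * v $ (y(j := False)) = v $ (x(j := False)) * v $ (y(j := True))"
  shows "abs_proj v \<in> M_var"
proof -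
  obtain u where "tensor u \<noteq> 0" "abs_proj v = abs_proj (tensor u)" using assms by (rule tensor_if_swap)
  then show ?thesis using M_var_tensor by simp
qed

lemma M_var_imp_tensor:
  assumes "p \<in> M_var" obtains u where "tensor u \<noteq> 0" "p = abs_proj (tensor u)"
proof -
  define v where "v = rep_proj p"
  have "v $ (x(j := True)) * v $ (y(j := False)) = v $ (x(j := False)) * v $ (y(j := True))" for j x y
  proof -
    have "\<forall>i. of_bool ((x(j := True)) i) + of_bool ((y(j := False)) i) =
        (of_bool ((x(j := False)) i) + of_bool ((y(j := True)) i) :: int)" by simp
    then show ?thesis using assms unfolding M_var_def v_def by blast
  qed
  then obtain u where "tensor u \<noteq> 0" "abs_proj v = abs_proj (tensor u)"
    by (rule tensor_if_swap[of v, rotated]) (simp_all add: v_def)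
  then show ?thesis using that by (simp add: v_def)
qed

text \<open>
  Points of \<open>M_var\<close> are tuples of points \<open>u\<^sub>j\<close> of the projective line. Here \<open>u\<^sub>j\<close> is
  prescribed as a monomial image of \<open>u\<^bsub>\<pi>(j)\<^esub>\<close>. Since \<open>\<pi>\<close> is idempotent and the prescription is
  void for \<open>\<pi>(j) = j\<close>, the points at these labels are free parameters.
\<close>

locale segre_graph =
  fixes pi :: "'k::finite \<Rightarrow> 'k" and s :: "'k \<Rightarrow> nat" and coeff_of :: "'k \<Rightarrow> bool \<Rightarrow> complex"
  assumes idem: "pi (pi j) = pi j"
    and exponent_pos: "s j \<ge> 1" and coeff_nonzero: "coeff_of j b \<noteq> 0"
    and fixed_exponent: "pi j = j \<Longrightarrow> s j = 1" and fixed_coeff: "pi j = j \<Longrightarrow> coeff_of j b = 1"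
begin

definition lift :: "('k \<Rightarrow> bool \<Rightarrow> complex) \<Rightarrow> 'k \<Rightarrow> bool \<Rightarrow> complex" where
  "lift t j b = coeff_of j b * t (pi j) b ^ s j"

definition graph_variety :: "('k \<Rightarrow> bool) proj set" where
  "graph_variety = {abs_proj (tensor (lift t)) |t. tensor (lift t) \<noteq> 0}"

lemma lift_pi: "lift t (pi j) b = t (pi j) b"
  unfolding lift_def by (simp add: idem fixed_exponent fixed_coeff)

lemma lift_idem: "lift (lift t) = lift t"
  by (intro ext) (simp add: lift_def[of "lift t"] lift_pi, simp add: lift_def)

lemma lift_eq_0_iff: "lift t j b = 0 \<longleftrightarrow> t (pi j) b = 0"
  using exponent_pos[of j] by (auto simp: lift_def coeff_nonzero)

lemma graph_variety_subset_M: "graph_variety \<subseteq> M_var"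
  unfolding graph_variety_def using M_var_tensor by blast

lemma origin_in_graph_variety:
  obtains t where "tensor (lift t) \<noteq> 0" "\<And>j. lift t j True = 0" "abs_proj (tensor (lift t)) \<in> graph_variety"
proof -
  define t where "t = (\<lambda>j::'k. \<lambda>b. if b then 0 else 1 :: complex)"
  have "tensor (lift t) \<noteq> 0" unfolding tensor_nonzero_iff by (auto simp: lift_eq_0_iff t_def)
  moreover have "lift t j True = 0" for j by (simp add: lift_eq_0_iff t_def)
  ultimately show ?thesis using that unfolding graph_variety_def by blast
qed

text \<open>
  That \<open>u j\<close> and \<open>lift u j\<close> are proportional is the vanishing of a determinant in \<open>u j\<close> and
  \<open>u (pi j)\<close>. To write it as an equation in the coordinates of \<open>tensor u\<close>, it is multiplied by
  the remaining factors at arbitrary entries \<open>x\<close> and \<open>y\<close>; at each point of \<open>M_var\<close> they are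
  nonzero for a suitable choice.
\<close>

lemma zariski_closed_graph_variety: "zariski_closed graph_variety"
proof -
  define f where "f x y z w = (\<lambda>v :: complex ^ ('k \<Rightarrow> bool). v $ x * v $ y - v $ z * v $ w)" for x y z w
  define g where "g j x y = (\<lambda>v :: complex ^ ('k \<Rightarrow> bool).
    coeff_of j False * v $ (x(j := True)) * (v $ (y(pi j := False))) ^ s j
      - coeff_of j True * v $ (x(j := False)) * (v $ (y(pi j := True))) ^ s j)" for j x y
  define P where "P = {f x y z w |x y z w.
      \<forall>j. of_bool (x j) + of_bool (y j) = (of_bool (z j) + of_bool (w j) :: int)} \<union> {g j x y |j x y. True}"
  have "homogeneous_poly (f x y z w)" for x y z w
    unfolding homogeneous_poly_def f_def
    by (intro conjI poly_fun_intros exI[of _ 2]) (simp add: algebra_simps power2_eq_square)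
  moreover have "homogeneous_poly (g j x y)" for j x y
    unfolding homogeneous_poly_def g_def
    by (intro conjI poly_fun_intros exI[of _ "Suc (s j)"]) (simp add: algebra_simps)
  ultimately have P: "\<forall>h\<in>P. homogeneous_poly h" unfolding P_def by blast
  have g_tensor: "g j x y (tensor u) = (\<Prod>i\<in>UNIV - {j}. u i (x i)) * (\<Prod>i\<in>UNIV - {pi j}. u i (y i)) ^ s j *
      (u j True * lift u j False - u j False * lift u j True)" for j x y u
    unfolding g_def tensor_upd by (simp add: lift_def algebra_simps)
  have "graph_variety = {abs_proj v |v. v \<noteq> 0 \<and> (\<forall>f\<in>P. f v = 0)}"
  proof (intro equalityI subsetI)
    fix p assume "p \<in> graph_variety"
    then obtain t where t: "p = abs_proj (tensor (lift t))" "tensor (lift t) \<noteq> 0" unfolding graph_variety_def by blast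
    have "f x y z w (tensor (lift t)) = 0"
      if "\<forall>j. of_bool (x j) + of_bool (y j) = (of_bool (z j) + of_bool (w j) :: int)" for x y z w
      using M_var_tensor[OF t(2)] that unfolding M_var_iff_vec[OF t(2)] f_def by simp
    moreover have "g j x y (tensor (lift t)) = 0" for j x y
      unfolding g_tensor lift_idem by simp
    ultimately show "p \<in> {abs_proj v |v. v \<noteq> 0 \<and> (\<forall>f\<in>P. f v = 0)}"
      using t unfolding P_def by blast
  next
    fix p assume "p \<in> {abs_proj v |v. v \<noteq> 0 \<and> (\<forall>f\<in>P. f v = 0)}"
    then obtain v where v: "p = abs_proj v" "v \<noteq> 0" "\<forall>f\<in>P. f v = 0" by blast
    have "f x y z w v = 0" if "\<forall>j. of_bool (x j) + of_bool (y j) = (of_bool (z j) + of_bool (w j) :: int)"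
      for x y z w using v(3) that unfolding P_def by blast
    then have "p \<in> M_var" unfolding v(1) M_var_iff_vec[OF v(2)] by (simp add: f_def)
    then obtain u where u: "tensor u \<noteq> 0" "p = abs_proj (tensor u)" by (rule M_var_imp_tensor)
    have "abs_proj (tensor u) \<in> {abs_proj v |v. v \<noteq> 0 \<and> (\<forall>f\<in>P. f v = 0)}"
      unfolding u(2)[symmetric] mem_Collect_eq using v by (intro exI[of _ v] conjI)
    then have "\<forall>f\<in>P. f (tensor u) = 0"
      by (rule zariski_zero_set_iff[OF P u(1), THEN iffD1])
    then have gu: "g j x y (tensor u) = 0" for j x y unfolding P_def by blast
    obtain x where x: "\<And>j. u j (x j) \<noteq> 0" using u(1) unfolding tensor_nonzero_iff by metis
    have cross: "u j True * lift u j False = u j False * lift u j True" for j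
      using gu[of j x x] x unfolding g_tensor by simp
    define c where "c j = u j (x (pi j)) / lift u j (x (pi j))" for j
    have Lx: "lift u j (x (pi j)) \<noteq> 0" for j using x by (simp add: lift_eq_0_iff)
    have uc: "u j b = c j * lift u j b" for j b
      using cross[of j] Lx[of j] unfolding c_def by (cases b; cases "x (pi j)") (auto simp: field_simps)
    have c_nz: "c j \<noteq> 0" for j using uc[of j "x j"] x[of j] by auto
    have "tensor u = (\<Prod>j\<in>UNIV. c j) *s tensor (lift u)" by (rule tensor_scale[OF uc])
    moreover from this u(1) have nz: "tensor (lift u) \<noteq> 0" by auto
    ultimately have "p = abs_proj (tensor (lift u))" using u(2) c_nz by (simp add: abs_proj_scale)
    with nz show "p \<in> graph_variety" unfolding graph_variety_def by blast
  qed
  with P show ?thesis unfolding zariski_closed_def by blast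
qed

lemma proj_variety_graph_variety: "proj_variety graph_variety"
proof (rule proj_variety_param)
  define Psi where "Psi w = tensor (lift (\<lambda>j b. w $ (j, b)))" for w :: "complex ^ ('k \<times> bool)"
  show "poly_fun (\<lambda>w. Psi w $ i)" for i
    unfolding Psi_def tensor_nth lift_def by (intro poly_fun_intros)
  show "zariski_closed graph_variety" by (rule zariski_closed_graph_variety)
  show "graph_variety \<noteq> {}" using origin_in_graph_variety by blast
  have "\<exists>w. tensor (lift t) = Psi w" for t
    unfolding Psi_def by (intro exI[of _ "\<chi> jb. t (fst jb) (snd jb)"]) simp
  then show "graph_variety = {abs_proj (Psi w) |w. Psi w \<noteq> 0}"
    unfolding graph_variety_def by (auto simp: Psi_def) metis
qed

definition flip :: "('k \<Rightarrow> bool) \<Rightarrow> 'k \<Rightarrow> ('k \<Rightarrow> bool)" where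
  "flip a j = a(j := \<not> a j)"

lemma flip_diff: "{i. flip a j i \<noteq> a i} = {j}" by (auto simp: flip_def)

text \<open>
  In the chart at \<open>a\<close>, the coordinate of a product vector at \<open>flip a j\<close> is
  \<open>u j (\<not> a j) / u j (a j)\<close>, and all other coordinates are products of these. Because \<open>a\<close> is
  constant on the fibres of \<open>pi\<close>, the ratio at \<open>j\<close> is a positive power of the one at \<open>pi j\<close>,
  up to a constant.
\<close>

lemma graph_variety_chart:
  assumes a: "\<And>j. a (pi j) = a j"
  shows "graph_chart graph_variety (chart_dom a) a (flip a ` range pi)
    (\<lambda>y u. \<Prod>j\<in>{j. y j \<noteq> a j}. coeff_of j (\<not> a j) / coeff_of j (a j) * u $ flip a (pi j) ^ s j)"
    (is "graph_chart _ _ _ ?B ?h")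
  unfolding graph_chart_def
proof (intro conjI allI impI)
  show "open (chart_dom a)" by (rule open_chart_dom)
  show "a \<notin> flip a ` range pi"
  proof
    assume "a \<in> flip a ` range pi"
    then obtain j where "a = flip a j" by (elim imageE)
    from fun_cong[OF this, of j] show False by (simp add: flip_def)
  qed
  show "poly_fun (?h y)" for y by (intro poly_fun_intros)
  show "?h y u = ?h y u'" if "\<forall>b\<in>?B. u $ b = u' $ b" for y u u'
    using that by (intro prod.cong) auto
  have h_Gam: "aff_coord a y (abs_proj (tensor (lift t))) = ?h y (\<chi> l. aff_coord a l (abs_proj (tensor (lift t))))"
    if "tensor (lift t) $ a \<noteq> 0" for t y
  proof -
    have "aff_coord a (flip a (pi j)) (abs_proj (tensor (lift t))) = t (pi j) (\<not> a j) / t (pi j) (a j)" for j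
      unfolding aff_coord_tensor[OF that] flip_diff by (simp add: lift_pi a)
    moreover have "lift t j (\<not> a j) / lift t j (a j) =
        coeff_of j (\<not> a j) / coeff_of j (a j) * (t (pi j) (\<not> a j) / t (pi j) (a j)) ^ s j" for j
      by (simp add: lift_def power_divide)
    ultimately show ?thesis unfolding aff_coord_tensor[OF that, of y] by simp
  qed
  show "graph_variety \<inter> chart_dom a = {q \<in> chart_dom a. \<forall>y. y \<notin> insert a ?B \<longrightarrow>
      aff_coord a y q = ?h y (\<chi> l. aff_coord a l q)}"
  proof (intro equalityI subsetI)
    fix q assume q: "q \<in> graph_variety \<inter> chart_dom a"
    then obtain t where t: "q = abs_proj (tensor (lift t))" "tensor (lift t) \<noteq> 0" unfolding graph_variety_def by blast
    then have "tensor (lift t) $ a \<noteq> 0" using q abs_in_chart_dom by blast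
    then show "q \<in> {q \<in> chart_dom a. \<forall>y. y \<notin> insert a ?B \<longrightarrow> aff_coord a y q = ?h y (\<chi> l. aff_coord a l q)}"
      using h_Gam q unfolding t(1) by blast
  next
    fix q assume "q \<in> {q \<in> chart_dom a. \<forall>y. y \<notin> insert a ?B \<longrightarrow> aff_coord a y q = ?h y (\<chi> l. aff_coord a l q)}"
    then have q: "q \<in> chart_dom a" and eq: "\<And>y. y \<notin> insert a ?B \<Longrightarrow> aff_coord a y q = ?h y (\<chi> l. aff_coord a l q)"
      by blast+
    define t where "t i b = (if b = a i then 1 else aff_coord a (flip a i) q)" for i b
    have La: "lift t j (a j) \<noteq> 0" for j unfolding lift_eq_0_iff by (simp add: t_def a)
    then have ta: "tensor (lift t) $ a \<noteq> 0" by simp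
    then have nz: "tensor (lift t) \<noteq> 0" by (metis zero_index)
    have flip_eq: "aff_coord a (flip a (pi j)) (abs_proj (tensor (lift t))) = aff_coord a (flip a (pi j)) q" for j
      unfolding aff_coord_tensor[OF ta] flip_diff by (simp add: lift_pi t_def)
    have "aff_coord a y q = aff_coord a y (abs_proj (tensor (lift t)))" for y
    proof (cases "y \<in> insert a ?B")
      case True
      moreover have "aff_coord a a q = 1" using q by (simp add: aff_coord_def chart_dom_def)
      moreover have "aff_coord a a (abs_proj (tensor (lift t))) = 1"
        unfolding aff_coord_abs[OF nz] using ta by (rule divide_self)
      ultimately show ?thesis using flip_eq by auto
    next
      case False
      show ?thesis unfolding eq[OF False] h_Gam[OF ta, of y] by (simp add: flip_eq)
    qed
    moreover have "abs_proj (tensor (lift t)) \<in> chart_dom a" unfolding abs_in_chart_dom[OF nz] by (rule ta)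
    ultimately have "q = abs_proj (tensor (lift t))" using q by (intro eq_if_aff_coord_eq[of _ a])
    then show "q \<in> graph_variety \<inter> chart_dom a" using q nz unfolding graph_variety_def by blast
  qed
qed (rule subset_refl)

lemma card_flip: "card (flip a ` A) = card A"
proof (rule card_image)
  show "inj_on (flip a) A" by (rule inj_onI) (metis flip_diff singleton_inject)
qed

text \<open>
  The factors at \<open>j\<close> and \<open>pi j\<close> vanish at the same entries, so an index \<open>a\<close> at which the point
  is nonzero can be chosen constant on the fibres of \<open>pi\<close>.
\<close>

lemma graph_variety_charts:
  assumes "p \<in> graph_variety \<inter> V" "open V"
  shows "\<exists>W a B h. p \<in> W \<and> card B = card (range pi) \<and> graph_chart (graph_variety \<inter> V) W a B h"
proof -
  from assms(1) obtain t where t: "p = abs_proj (tensor (lift t))" "tensor (lift t) \<noteq> 0" unfolding graph_variety_def by blast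
  obtain x where x: "\<And>j. t (pi j) (x (pi j)) \<noteq> 0"
    using t(2) unfolding tensor_nonzero_iff lift_eq_0_iff by (metis idem)
  define a where "a j = x (pi j)" for j
  have a: "a (pi j) = a j" for j by (simp add: a_def idem)
  have "tensor (lift t) $ a \<noteq> 0" using x by (simp add: lift_eq_0_iff a_def)
  then have "p \<in> chart_dom a" using t abs_in_chart_dom by blast
  then show ?thesis
    using graph_chart_restrict[OF graph_variety_chart[of a, OF a] assms(2)] assms(1) card_flip[of a "range pi"] by blast
qed

lemma proj_dim_graph_variety: "proj_dim graph_variety (card (range pi))"
proof (rule graph_chart_proj_dim)
  show "graph_variety \<noteq> {}" using origin_in_graph_variety by blast
  show "\<exists>W a B h. p \<in> W \<and> card B = card (range pi) \<and> graph_chart graph_variety W a B h" if "p \<in> graph_variety" for p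
    using graph_variety_charts[of p UNIV] that by simp
qed

lemma proj_submanifold_graph_variety:
  assumes "open V" "graph_variety \<inter> V \<noteq> {}" shows "proj_submanifold (card (range pi)) (graph_variety \<inter> V)"
  by (rule graph_chart_submanifold[OF assms(2)]) (rule graph_variety_charts[OF _ assms(1)])

end

text \<open>
  For \<open>pi\<close> the identity, no relation is imposed and the graph variety is all of \<open>M_var\<close>.
\<close>

interpretation full: segre_graph id "\<lambda>_. 1" "\<lambda>_ _. 1" by unfold_locales auto

lemma full_graph_variety: "full.graph_variety = (M_var :: ('k::finite \<Rightarrow> bool) proj set)"
proof -
  have "full.lift t = t" for t :: "'k \<Rightarrow> bool \<Rightarrow> complex" unfolding full.lift_def by simp
  then have Gam: "full.graph_variety = {abs_proj (tensor t) |t :: 'k \<Rightarrow> bool \<Rightarrow> complex. tensor t \<noteq> 0}"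
    unfolding full.graph_variety_def by simp
  show ?thesis
  proof
    show "full.graph_variety \<subseteq> (M_var :: ('k \<Rightarrow> bool) proj set)" by (rule full.graph_variety_subset_M)
    show "(M_var :: ('k \<Rightarrow> bool) proj set) \<subseteq> full.graph_variety"
    proof
      fix p :: "('k \<Rightarrow> bool) proj" assume "p \<in> M_var"
      then obtain u where "tensor u \<noteq> 0" "p = abs_proj (tensor u)" by (rule M_var_imp_tensor)
      then show "p \<in> full.graph_variety" unfolding Gam by blast
    qed
  qed
qed

lemma proj_variety_M: "proj_variety (M_var :: ('k::finite \<Rightarrow> bool) proj set)"
  using full.proj_variety_graph_variety unfolding full_graph_variety .

lemma proj_dim_M: "proj_dim (M_var :: ('k::finite \<Rightarrow> bool) proj set) CARD('k)"
  using full.proj_dim_graph_variety unfolding full_graph_variety by simp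

lemma zariski_closed_M: "zariski_closed (M_var :: ('k::finite \<Rightarrow> bool) proj set)"
  using full.zariski_closed_graph_variety unfolding full_graph_variety .


section \<open>The renormalization map on product vectors\<close>

locale gluing_recursion =
  fixes D :: "('e, 'k::finite, 'm::finite) gluing" and lam :: complex
  assumes gd: "gluing_data D" and lam: "lam \<noteq> 0"
begin

abbreviation "Lam \<equiv> label_map D"
abbreviation "Fhat \<equiv> renorm_hat D lam"
abbreviation "inner_edges \<equiv> edges D - range (Phi D)"
abbreviation "states \<equiv> inner_edges \<rightarrow>\<^sub>E (UNIV :: bool set)"

lemma finite_edges: "finite (edges D)" and inj_Phi: "inj (Phi D)" and Phi_edges: "Phi D j \<in> edges D"
  using gd unfolding gluing_data_def by auto

lemma ends_nonempty: "e \<in> edges D \<Longrightarrow> ends D e \<noteq> {}"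
  using gd partition_onD3 unfolding gluing_data_def by (metis (mono_tags, lifting) imageI mem_Collect_eq)

lemma ends_eq_if_meet:
  assumes "e \<in> edges D" "e' \<in> edges D" "elabel D e = elabel D e'" "i \<in> ends D e" "i \<in> ends D e'"
  shows "e = e'"
proof -
  have inj: "inj_on (ends D) {e \<in> edges D. elabel D e = elabel D e'}"
    and part: "partition_on UNIV (ends D ` {e \<in> edges D. elabel D e = elabel D e'})"
    using gd unfolding gluing_data_def by blast+
  have "ends D e = ends D e'"
    using partition_onD2[OF part] assms unfolding disjoint_def by blast
  then show ?thesis using inj assms by (auto dest: inj_onD)
qed

lemma edge_at: "edge_at D j i \<in> edges D \<and> elabel D (edge_at D j i) = j \<and> i \<in> ends D (edge_at D j i)"
  unfolding edge_at_def
proof (rule theI')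
  have "partition_on UNIV (ends D ` {e \<in> edges D. elabel D e = j})"
    using gd unfolding gluing_data_def by blast
  then obtain e where "e \<in> edges D" "elabel D e = j" "i \<in> ends D e"
    using partition_onD1 by blast
  then show "\<exists>!e. e \<in> edges D \<and> elabel D e = j \<and> i \<in> ends D e"
    using ends_eq_if_meet by metis
qed

lemma edge_at_eq: "e \<in> edges D \<Longrightarrow> i \<in> ends D e \<Longrightarrow> edge_at D (elabel D e) i = e"
  using edge_at[of "elabel D e" i] ends_eq_if_meet by metis

lemma wedge_Phi [simp]: "wedge D x \<eta> (Phi D j) = x j"
  by (simp add: wedge_def the_inv_f_f[OF inj_Phi])

lemma wedge_inner [simp]: "e \<notin> range (Phi D) \<Longrightarrow> wedge D x \<eta> e = \<eta> e"
  by (simp add: wedge_def)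

definition edge_weight :: "'e \<Rightarrow> bool \<Rightarrow> complex" where
  "edge_weight e b = (if b then inverse lam ^ (card (ends D e) - 1) else 1)"

lemma edge_weight_nonzero: "edge_weight e b \<noteq> 0" using lam by (simp add: edge_weight_def)

lemma weight_eq_prod: "inverse lam ^ wedge_norm D y = (\<Prod>e\<in>edges D. edge_weight e (y e))"
proof -
  have "inverse lam ^ wedge_norm D y = (\<Prod>e\<in>{e \<in> edges D. y e}. inverse lam ^ (card (ends D e) - 1))"
    by (simp add: wedge_norm_def power_sum)
  also have "\<dots> = (\<Prod>e\<in>edges D. edge_weight e (y e))"
    unfolding edge_weight_def prod.inter_filter[OF finite_edges] ..
  finally show ?thesis .
qed

text \<open>
  A copy \<open>i\<close> meets exactly one edge of each label, so pairs of a copy and a label correspond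
  to pairs of an edge and a copy in it.
\<close>

lemma prod_copies_eq_prod_edges:
  "(\<Prod>i\<in>UNIV. \<Prod>j\<in>UNIV. U i j (y (edge_at D j i))) =
    (\<Prod>e\<in>edges D. \<Prod>i\<in>ends D e. U i (elabel D e) (y e))" for U :: "'m \<Rightarrow> 'k \<Rightarrow> bool \<Rightarrow> 'c::comm_monoid_mult"
proof -
  have "(\<Prod>i\<in>UNIV. \<Prod>j\<in>UNIV. U i j (y (edge_at D j i))) =
      (\<Prod>(i, j)\<in>UNIV \<times> UNIV. U i j (y (edge_at D j i)))"
    by (rule prod.cartesian_product)
  also have "\<dots> = (\<Prod>(e, i)\<in>Sigma (edges D) (ends D). U i (elabel D e) (y e))"
    by (rule prod.reindex_bij_witness[of _ "\<lambda>(e, i). (i, elabel D e)" "\<lambda>(i, j). (edge_at D j i, i)"])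
       (use edge_at edge_at_eq in auto)
  also have "\<dots> = (\<Prod>e\<in>edges D. \<Prod>i\<in>ends D e. U i (elabel D e) (y e))"
    using finite_edges by (simp add: prod.Sigma)
  finally show ?thesis .
qed

text \<open>
  The polarisation of the renormalization map, where copy \<open>i\<close> carries its own vector \<open>V i\<close>.
  Its values at product vectors determine the map on \<open>M_var\<close> as well as the derivatives there.
\<close>

definition renorm_multi :: "('m \<Rightarrow> complex ^ ('k \<Rightarrow> bool)) \<Rightarrow> complex ^ ('k \<Rightarrow> bool)" where
  "renorm_multi V = (\<chi> x. \<Sum>\<eta>\<in>states. inverse lam ^ wedge_norm D (wedge D x \<eta>) *
     (\<Prod>i\<in>UNIV. V i $ copy_tuple D (wedge D x \<eta>) i))"

lemma renorm_hat_eq_multi: "Fhat v = renorm_multi (\<lambda>_. v)"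
  by (simp add: renorm_hat_def renorm_multi_def)

lemma renorm_multi_scale: "renorm_multi (\<lambda>i. c i *s V i) = (\<Prod>i\<in>UNIV. c i) *s renorm_multi V"
  by (simp add: renorm_multi_def cart_eq_iff prod.distrib sum_distrib_left mult_ac)

text \<open>
  The contribution of the vertex glued along \<open>e\<close> in state \<open>b\<close>, if copy \<open>i\<close> carries the vector
  \<open>tensor (U i)\<close>.
\<close>

definition edge_factor :: "('m \<Rightarrow> 'k \<Rightarrow> bool \<Rightarrow> complex) \<Rightarrow> 'e \<Rightarrow> bool \<Rightarrow> complex" where
  "edge_factor U e b = edge_weight e b * (\<Prod>i\<in>ends D e. U i (elabel D e) b)"

definition inner_factor :: "('m \<Rightarrow> 'k \<Rightarrow> bool \<Rightarrow> complex) \<Rightarrow> complex" where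
  "inner_factor U = (\<Prod>e\<in>inner_edges. \<Sum>b\<in>UNIV. edge_factor U e b)"

text \<open>
  Each summand is a product over the glued vertices, of terms that depend on the state of one
  vertex only. Summing over the states of the unmarked vertices gives the scalar, and the
  marked vertices remain as the factors of the new product vector.
\<close>

lemma renorm_multi_tensor:
  "renorm_multi (\<lambda>i. tensor (U i)) = inner_factor U *s tensor (\<lambda>j. edge_factor U (Phi D j))"
proof (rule iffD2[OF cart_eq_iff], intro allI)
  fix x
  have summand: "inverse lam ^ wedge_norm D (wedge D x \<eta>) * (\<Prod>i\<in>UNIV. tensor (U i) $ copy_tuple D (wedge D x \<eta>) i) =
      (\<Prod>j\<in>UNIV. edge_factor U (Phi D j) (x j)) * (\<Prod>e\<in>inner_edges. edge_factor U e (\<eta> e))" for \<eta>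
  proof -
    have "inverse lam ^ wedge_norm D (wedge D x \<eta>) * (\<Prod>i\<in>UNIV. tensor (U i) $ copy_tuple D (wedge D x \<eta>) i) =
        (\<Prod>e\<in>edges D. edge_factor U e (wedge D x \<eta> e))"
      by (simp add: copy_tuple_def prod_copies_eq_prod_edges weight_eq_prod edge_factor_def prod.distrib)
    also have "\<dots> = (\<Prod>e\<in>inner_edges. edge_factor U e (wedge D x \<eta> e)) * (\<Prod>e\<in>range (Phi D). edge_factor U e (wedge D x \<eta> e))"
      using finite_edges Phi_edges by (intro prod.subset_diff) auto
    also have "(\<Prod>e\<in>range (Phi D). edge_factor U e (wedge D x \<eta> e)) = (\<Prod>j\<in>UNIV. edge_factor U (Phi D j) (x j))"
      by (simp add: prod.reindex[OF inj_Phi])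
    also have "(\<Prod>e\<in>inner_edges. edge_factor U e (wedge D x \<eta> e)) = (\<Prod>e\<in>inner_edges. edge_factor U e (\<eta> e))"
      by (intro prod.cong) auto
    finally show ?thesis by (simp add: mult.commute)
  qed
  have "renorm_multi (\<lambda>i. tensor (U i)) $ x = (\<Prod>j\<in>UNIV. edge_factor U (Phi D j) (x j)) *
      (\<Sum>\<eta>\<in>states. \<Prod>e\<in>inner_edges. edge_factor U e (\<eta> e))"
    by (simp only: renorm_multi_def vec_lambda_beta summand sum_distrib_left)
  also have "(\<Sum>\<eta>\<in>states. \<Prod>e\<in>inner_edges. edge_factor U e (\<eta> e)) = inner_factor U"
    unfolding inner_factor_def using finite_edges by (intro prod_sum_PiE[symmetric]) auto
  finally show "renorm_multi (\<lambda>i. tensor (U i)) $ x = (inner_factor U *s tensor (\<lambda>j. edge_factor U (Phi D j))) $ x"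
    by simp
qed

definition Phi_size :: "'k \<Rightarrow> nat" where "Phi_size j = card (ends D (Phi D j))"

lemma Phi_size_pos: "Phi_size j \<ge> 1"
  unfolding Phi_size_def using ends_nonempty[OF Phi_edges] by (metis Suc_leI card_gt_0_iff finite One_nat_def)

definition step :: "('k \<Rightarrow> bool \<Rightarrow> complex) \<Rightarrow> 'k \<Rightarrow> bool \<Rightarrow> complex" where
  "step u j b = edge_weight (Phi D j) b * u (Lam j) b ^ Phi_size j"

lemma edge_factor_Phi: "edge_factor (\<lambda>_. u) (Phi D j) = step u j"
  by (intro ext) (simp add: edge_factor_def step_def Phi_size_def label_map_def)

lemma renorm_hat_tensor: "Fhat (tensor u) = inner_factor (\<lambda>_. u) *s tensor (step u)"
  unfolding renorm_hat_eq_multi renorm_multi_tensor edge_factor_Phi ..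

lemma renorm_hat_scale: "Fhat (c *s v) = c ^ CARD('m) *s Fhat v"
  using renorm_multi_scale[of "\<lambda>_. c" "\<lambda>_. v"] by (simp add: renorm_hat_eq_multi)

lemma renorm_hat_iter_scale: "(Fhat ^^ n) (c *s v) = c ^ (CARD('m) ^ n) *s (Fhat ^^ n) v"
  by (induction n) (simp_all add: renorm_hat_scale power_mult[symmetric] mult.commute)

lemma poly_renorm_hat: "poly_fun (\<lambda>v. Fhat v $ x)"
  unfolding renorm_hat_def vec_lambda_beta by (intro poly_fun_intros)

lemma poly_renorm_hat_iter: "poly_fun (\<lambda>v. (Fhat ^^ n) v $ x)"
proof (induction n arbitrary: x)
  case (Suc n)
  from poly_fun_compose[OF poly_renorm_hat Suc] show ?case by simp
qed (simp add: poly_fun_coord)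

lemmas proj_map_iter = proj_map_abs[of "Fhat ^^ n" "CARD('m) ^ n" for n, OF renorm_hat_iter_scale]
lemmas indet_iter = proj_indet_iff[of "Fhat ^^ n" "CARD('m) ^ n" for n, OF renorm_hat_iter_scale]

lemma renorm_hat_iter_tensor: "\<exists>C. (Fhat ^^ n) (tensor u) = C *s tensor ((step ^^ n) u)"
proof (induction n)
  case 0
  show ?case by (intro exI[of _ 1]) simp
next
  case (Suc n)
  then obtain C where "(Fhat ^^ n) (tensor u) = C *s tensor ((step ^^ n) u)" by blast
  then show ?case
    by (intro exI[of _ "C ^ CARD('m) * inner_factor (\<lambda>_. (step ^^ n) u)"])
       (simp add: renorm_hat_scale renorm_hat_tensor vector_smult_assoc)
qed

text \<open>
  At the vectors supported at the index where all vertices are vacant, only vacant states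
  contribute, and they do so with nonzero weight. This point shows that no iterate is
  undefined on all of \<open>M_var\<close>.
\<close>

lemma renorm_hat_iter_origin:
  assumes "\<And>j. u j True = 0" "\<And>j. u j False \<noteq> 0"
  shows "(Fhat ^^ n) (tensor u) \<noteq> 0"
proof -
  have "\<exists>C u'. (Fhat ^^ n) (tensor u) = C *s tensor u' \<and> C \<noteq> 0 \<and> (\<forall>j. u' j True = 0 \<and> u' j False \<noteq> 0)"
  proof (induction n)
    case 0
    show ?case using assms by (intro exI[of _ 1] exI[of _ u]) simp
  next
    case (Suc n)
    then obtain C u' where C: "(Fhat ^^ n) (tensor u) = C *s tensor u'" "C \<noteq> 0"
      and u': "\<And>j. u' j True = 0" "\<And>j. u' j False \<noteq> 0" by blast
    have "edge_factor (\<lambda>_. u') e True = 0" "edge_factor (\<lambda>_. u') e False \<noteq> 0" if "e \<in> edges D" for e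
      using u' ends_nonempty[OF that] by (auto simp: edge_factor_def edge_weight_nonzero card_eq_0_iff)
    then have "inner_factor (\<lambda>_. u') \<noteq> 0"
      using finite_edges by (simp add: inner_factor_def UNIV_bool)
    moreover have "step u' j True = 0" "step u' j False \<noteq> 0" for j
      using u' Phi_size_pos[of j] by (auto simp: step_def edge_weight_nonzero)
    moreover have "(Fhat ^^ Suc n) (tensor u) = (C ^ CARD('m) * inner_factor (\<lambda>_. u')) *s tensor (step u')"
      using C by (simp add: renorm_hat_scale renorm_hat_tensor vector_smult_assoc)
    ultimately show ?case using C(2) by (metis mult_eq_0_iff power_not_zero)
  qed
  then obtain C u' where "(Fhat ^^ n) (tensor u) = C *s tensor u'" "C \<noteq> 0" "\<forall>j. u' j True = 0 \<and> u' j False \<noteq> 0"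
    by blast
  moreover from this have "tensor u' \<noteq> 0" unfolding tensor_nonzero_iff by blast
  ultimately show ?thesis by simp
qed

lemma renorm_map_M:
  assumes "p \<in> M_var - renorm_indet D lam n"
  obtains u where "tensor u \<noteq> 0" "p = abs_proj (tensor u)" "tensor ((step ^^ n) u) \<noteq> 0"
    "renorm_map D lam n p = abs_proj (tensor ((step ^^ n) u))"
proof -
  from assms obtain u where u: "tensor u \<noteq> 0" "p = abs_proj (tensor u)" using M_var_imp_tensor by blast
  then have nz: "(Fhat ^^ n) (tensor u) \<noteq> 0" using assms indet_iter[OF u(1)] by blast
  obtain C where C: "(Fhat ^^ n) (tensor u) = C *s tensor ((step ^^ n) u)"
    using renorm_hat_iter_tensor by blast
  then have "C \<noteq> 0" "tensor ((step ^^ n) u) \<noteq> 0" using nz by auto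
  moreover from this have "renorm_map D lam n p = abs_proj (tensor ((step ^^ n) u))"
    using proj_map_iter[OF u(1) nz] C by (simp add: u(2) abs_proj_scale)
  ultimately show ?thesis using that u by blast
qed

lemma renorm_map_M_subset: "renorm_map D lam n ` (M_var - renorm_indet D lam n) \<subseteq> M_var"
proof
  fix q assume "q \<in> renorm_map D lam n ` (M_var - renorm_indet D lam n)"
  then obtain p where "p \<in> M_var - renorm_indet D lam n" "q = renorm_map D lam n p" by blast
  then show "q \<in> M_var" by (metis M_var_tensor renorm_map_M)
qed

lemma M0_subset_M: "M0_var D lam n \<subseteq> M_var"
  unfolding M0_var_def zariski_closure_def
  by (intro hull_minimal renorm_map_M_subset zariski_closed_M)

fun iter_exponent :: "nat \<Rightarrow> 'k \<Rightarrow> nat" where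
  "iter_exponent 0 j = 1"
| "iter_exponent (Suc n) j = iter_exponent n (Lam j) * Phi_size j"

fun iter_coeff :: "nat \<Rightarrow> 'k \<Rightarrow> bool \<Rightarrow> complex" where
  "iter_coeff 0 j b = 1"
| "iter_coeff (Suc n) j b = edge_weight (Phi D j) b * iter_coeff n (Lam j) b ^ Phi_size j"

lemma step_iter: "(step ^^ n) u j b = iter_coeff n j b * u ((Lam ^^ n) j) b ^ iter_exponent n j"
proof (induction n arbitrary: j)
  case (Suc n)
  have "(Lam ^^ n) (Lam j) = (Lam ^^ Suc n) j" by (simp add: funpow_swap1)
  moreover have "(step ^^ Suc n) u j b = edge_weight (Phi D j) b * (step ^^ n) u (Lam j) b ^ Phi_size j"
    by (simp add: step_def[of "(step ^^ n) u"])
  ultimately show ?case by (simp add: Suc power_mult_distrib power_mult)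
qed simp

lemma iter_exponent_pos: "iter_exponent n j \<ge> 1"
  using Phi_size_pos by (induction n arbitrary: j) (auto simp: Suc_le_eq)

lemma iter_coeff_nonzero: "iter_coeff n j b \<noteq> 0"
  by (induction n arbitrary: j) (auto simp: edge_weight_nonzero)

lemma periodic_Lam: "periodic_label D j \<Longrightarrow> periodic_label D (Lam j)"
  unfolding periodic_label_def by (metis funpow_swap1)

lemma Phi_size_periodic: "nondegenerate D \<Longrightarrow> periodic_label D j \<Longrightarrow> Phi_size j = 1"
  using Phi_size_pos[of j] unfolding nondegenerate_def critical_label_def Phi_size_def by fastforce

text \<open>
  No label on a periodic orbit is critical, so every weight and every exponent along it is 1.
\<close>

lemma iter_periodic:
  assumes "nondegenerate D" "periodic_label D j" shows "iter_exponent n j = 1 \<and> iter_coeff n j b = 1"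
  using assms(2)
proof (induction n arbitrary: j)
  case (Suc n)
  with Phi_size_periodic[OF assms(1)] periodic_Lam show ?case
    by (auto simp: edge_weight_def Phi_size_def)
qed simp

end


section \<open>The variety of fixed points\<close>

locale retracting_recursion = gluing_recursion D lam
  for D :: "('e, 'k::finite, 'm::finite) gluing" and lam :: complex +
  fixes N :: nat
  assumes N: "N \<ge> 1" "Lam ^^ (2 * N) = Lam ^^ N" and nondeg: "nondegenerate D"
begin

lemma Lam_N_idem: "(Lam ^^ N) ((Lam ^^ N) j) = (Lam ^^ N) j"
proof -
  have "(Lam ^^ N) ((Lam ^^ N) j) = (Lam ^^ (2 * N)) j" by (simp add: mult_2 funpow_add)
  then show ?thesis by (simp add: N(2))
qed

lemma fixed_periodic: "(Lam ^^ N) j = j \<Longrightarrow> periodic_label D j"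
  unfolding periodic_label_def using N(1) by blast

sublocale G: segre_graph "Lam ^^ N" "iter_exponent N" "iter_coeff N"
  using Lam_N_idem iter_exponent_pos iter_coeff_nonzero iter_periodic[OF nondeg fixed_periodic] by unfold_locales auto

lemma G_lift: "G.lift u = (step ^^ N) u"
  by (intro ext) (simp add: G.lift_def step_iter)

lemma image_in_graph_variety: "renorm_map D lam N ` (M_var - renorm_indet D lam N) \<subseteq> G.graph_variety"
proof
  fix q assume "q \<in> renorm_map D lam N ` (M_var - renorm_indet D lam N)"
  then obtain p where p: "p \<in> M_var - renorm_indet D lam N" "q = renorm_map D lam N p" by blast
  from renorm_map_M[OF p(1)] show "q \<in> G.graph_variety" unfolding G.graph_variety_def p(2) G_lift by blast
qed

lemma graph_variety_fixed:
  assumes "\<xi> \<in> G.graph_variety - renorm_indet D lam N" shows "renorm_map D lam N \<xi> = \<xi>"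
proof -
  from assms obtain t where t: "\<xi> = abs_proj (tensor (G.lift t))" "tensor (G.lift t) \<noteq> 0" unfolding G.graph_variety_def by blast
  have nz: "(Fhat ^^ N) (tensor (G.lift t)) \<noteq> 0" using assms indet_iter[OF t(2)] unfolding t(1) by blast
  obtain C where C: "(Fhat ^^ N) (tensor (G.lift t)) = C *s tensor (G.lift t)"
    using renorm_hat_iter_tensor[of N "G.lift t"] by (metis G.lift_idem G_lift)
  then have "C \<noteq> 0" using nz by auto
  then show ?thesis using proj_map_iter[OF t(2) nz] C t by (simp add: abs_proj_scale)
qed

text \<open>
  Where the iterate is defined, the points of the graph variety are fixed and hence in the
  image. A closed set that contains the image therefore covers the graph variety together with
  the indeterminacy set. The latter is closed and misses one point of the graph variety, so by
  irreducibility the former covers it alone.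
\<close>

lemma M0_eq_graph_variety: "M0_var D lam N = G.graph_variety"
proof
  show "M0_var D lam N \<subseteq> G.graph_variety"
    unfolding M0_var_def zariski_closure_def by (intro hull_minimal image_in_graph_variety G.zariski_closed_graph_variety)
  show "G.graph_variety \<subseteq> M0_var D lam N"
    unfolding M0_var_def zariski_closure_def hull_def
  proof (rule Inter_greatest)
    fix T assume "T \<in> {T. zariski_closed T \<and> renorm_map D lam N ` (M_var - renorm_indet D lam N) \<subseteq> T}"
    then have T: "zariski_closed T" "renorm_map D lam N ` (M_var - renorm_indet D lam N) \<subseteq> T" by auto
    have "G.graph_variety \<subseteq> T \<union> renorm_indet D lam N"
    proof
      fix \<xi> assume \<xi>: "\<xi> \<in> G.graph_variety"
      show "\<xi> \<in> T \<union> renorm_indet D lam N"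
      proof (cases "\<xi> \<in> renorm_indet D lam N")
        case False
        then have "renorm_map D lam N \<xi> \<in> T" using T(2) \<xi> G.graph_variety_subset_M by blast
        then show ?thesis using graph_variety_fixed[of \<xi>] \<xi> False by simp
      qed simp
    qed
    moreover have "zariski_closed (renorm_indet D lam N)"
      by (rule zariski_closed_proj_indet[OF renorm_hat_iter_scale poly_renorm_hat_iter])
    ultimately have "G.graph_variety \<subseteq> T \<or> G.graph_variety \<subseteq> renorm_indet D lam N"
      using G.proj_variety_graph_variety T(1) unfolding proj_variety_def by blast
    moreover obtain t where t: "tensor (G.lift t) \<noteq> 0" "\<And>j. G.lift t j True = 0" "abs_proj (tensor (G.lift t)) \<in> G.graph_variety"
      using G.origin_in_graph_variety by blast
    have "G.lift t j False \<noteq> 0" for j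
      using t(1,2) unfolding tensor_nonzero_iff by (metis (full_types))
    then have "abs_proj (tensor (G.lift t)) \<notin> renorm_indet D lam N"
      unfolding indet_iter[OF t(1)] by (intro renorm_hat_iter_origin t(2))
    ultimately show "G.graph_variety \<subseteq> T" using t(3) by blast
  qed
qed

lemma card_range_le: "card (range (Lam ^^ N)) \<le> CARD('k)"
  by (rule card_mono) simp_all

end


section \<open>Propagation of product directions under the derivative\<close>

lemma linear_span_image:
  assumes "Vector_Spaces.linear (*s) (*s) f" "\<And>x. x \<in> X \<Longrightarrow> f x \<in> vec.span Y" "h \<in> vec.span X"
  shows "f h \<in> vec.span Y"
proof -
  interpret f: Vector_Spaces.linear "(*s)" "(*s)" f by (rule assms(1))
  show ?thesis
    using assms(3)
  proof (induction rule: vec.span_induct_alt)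
    case base show ?case by (simp add: f.zero vec.span_zero)
  next
    case (step c x y)
    then show ?case by (simp add: f.add f.scale vec.span_add vec.span_scale assms(2))
  qed
qed

text \<open>
  If \<open>S\<close> has at most one element, these are tangent vectors of the cone over \<open>M_var\<close> at
  \<open>tensor u\<close>; for larger \<open>S\<close> they need not be.
\<close>

definition tensors_off :: "'k::finite set \<Rightarrow> ('k \<Rightarrow> bool \<Rightarrow> complex) \<Rightarrow> (complex ^ ('k \<Rightarrow> bool)) set" where
  "tensors_off S u = {tensor h |h. \<forall>j. j \<notin> S \<longrightarrow> h j = u j}"

lemma tensors_off_mono: "S \<subseteq> S' \<Longrightarrow> tensors_off S u \<subseteq> tensors_off S' u" unfolding tensors_off_def by blast

lemma span_tensors_off_UNIV: "h \<in> vec.span (tensors_off UNIV u)"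
proof -
  have "axis x 1 = tensor (\<lambda>j b. if b = x j then 1 else 0)" for x :: "'a \<Rightarrow> bool"
  proof -
    have "axis x 1 $ y = (\<Prod>j\<in>UNIV. if y j = x j then 1 else (0 :: complex))" for y
    proof (cases "y = x")
      case False
      then obtain j where "y j \<noteq> x j" by blast
      then have "(\<Prod>j\<in>UNIV. if y j = x j then 1 else (0 :: complex)) = 0" by (intro prod_zero) auto
      with False show ?thesis by (simp add: axis_def)
    qed simp
    then show ?thesis by (simp add: cart_eq_iff)
  qed
  then have "axis x 1 \<in> tensors_off UNIV u" for x unfolding tensors_off_def by auto
  then have "(\<Sum>x\<in>UNIV. (h $ x) *s axis x 1) \<in> vec.span (tensors_off UNIV u)"
    by (intro vec.span_sum vec.span_scale vec.span_base)
  then show ?thesis by (simp add: basis_expansion)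
qed

context gluing_recursion
begin

text \<open>
  The product rule for a multilinear expression on the diagonal: one copy at a time carries
  the direction.
\<close>

definition renorm_deriv :: "complex ^ ('k \<Rightarrow> bool) \<Rightarrow> complex ^ ('k \<Rightarrow> bool) \<Rightarrow> complex ^ ('k \<Rightarrow> bool)" where
  "renorm_deriv v h = (\<Sum>i\<in>UNIV. renorm_multi (\<lambda>i'. if i' = i then h else v))"

lemma renorm_deriv_nth: "renorm_deriv v h $ x = (\<Sum>i\<in>UNIV. \<Sum>\<eta>\<in>states. inverse lam ^ wedge_norm D (wedge D x \<eta>) *
    (h $ copy_tuple D (wedge D x \<eta>) i * (\<Prod>i'\<in>UNIV - {i}. v $ copy_tuple D (wedge D x \<eta>) i')))"
proof -
  have "(\<Prod>i'\<in>UNIV. (if i' = i then h else v) $ c i') = h $ c i * (\<Prod>i'\<in>UNIV - {i}. v $ c i')" for c and i :: 'm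
  proof -
    have "(\<Prod>i'\<in>UNIV - {i}. (if i' = i then h else v) $ c i') = (\<Prod>i'\<in>UNIV - {i}. v $ c i')"
      by (intro prod.cong) auto
    then show ?thesis by (simp add: prod.remove[of UNIV i])
  qed
  then show ?thesis by (simp add: renorm_deriv_def renorm_multi_def)
qed

lemma linear_renorm_deriv: "Vector_Spaces.linear (*s) (*s) (renorm_deriv v)"
  unfolding Vector_Spaces.linear_iff
  by (auto simp: cart_eq_iff renorm_deriv_nth algebra_simps sum.distrib sum_distrib_left vec.vector_space_axioms)

lemma has_derivative_renorm_hat: "(Fhat has_derivative renorm_deriv v) (at v)"
proof (rule has_derivative_vecI)
  fix x
  have "((\<lambda>v. \<Sum>\<eta>\<in>states. inverse lam ^ wedge_norm D (wedge D x \<eta>) *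
        (\<Prod>i\<in>UNIV. v $ copy_tuple D (wedge D x \<eta>) i)) has_derivative
      (\<lambda>h. \<Sum>\<eta>\<in>states. inverse lam ^ wedge_norm D (wedge D x \<eta>) *
        (\<Sum>i\<in>UNIV. h $ copy_tuple D (wedge D x \<eta>) i * (\<Prod>i'\<in>UNIV - {i}. v $ copy_tuple D (wedge D x \<eta>) i')))) (at v)"
    by (intro has_derivative_sum has_derivative_mult_right has_derivative_prod
        bounded_linear_imp_has_derivative[OF bounded_linear_coord])
  moreover have "(\<Sum>\<eta>\<in>states. inverse lam ^ wedge_norm D (wedge D x \<eta>) *
        (\<Sum>i\<in>UNIV. h $ copy_tuple D (wedge D x \<eta>) i * (\<Prod>i'\<in>UNIV - {i}. v $ copy_tuple D (wedge D x \<eta>) i'))) = renorm_deriv v h $ x" for h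
    unfolding renorm_deriv_nth sum_distrib_left by (rule sum.swap)
  ultimately show "((\<lambda>v. Fhat v $ x) has_derivative (\<lambda>h. renorm_deriv v h $ x)) (at v)"
    by (simp add: renorm_hat_def)
qed

fun renorm_deriv_iter :: "nat \<Rightarrow> complex ^ ('k \<Rightarrow> bool) \<Rightarrow> complex ^ ('k \<Rightarrow> bool) \<Rightarrow> complex ^ ('k \<Rightarrow> bool)" where
  "renorm_deriv_iter 0 v h = h"
| "renorm_deriv_iter (Suc n) v h = renorm_deriv ((Fhat ^^ n) v) (renorm_deriv_iter n v h)"

lemma linear_renorm_deriv_iter: "Vector_Spaces.linear (*s) (*s) (renorm_deriv_iter n v)"
proof (induction n)
  case 0
  have "renorm_deriv_iter 0 v = id" by auto
  then show ?case by (simp only: vec.linear_id)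
next
  case (Suc n)
  have "renorm_deriv_iter (Suc n) v = renorm_deriv ((Fhat ^^ n) v) \<circ> renorm_deriv_iter n v" by auto
  then show ?case by (simp only: Vector_Spaces.linear_compose[OF Suc linear_renorm_deriv])
qed

lemma has_derivative_renorm_hat_iter: "((Fhat ^^ n) has_derivative renorm_deriv_iter n v) (at v)"
proof (induction n)
  case 0
  have "renorm_deriv_iter 0 v = (\<lambda>h. h)" by auto
  then show ?case by (simp add: id_def)
next
  case (Suc n)
  from has_derivative_compose[OF this has_derivative_renorm_hat] show ?case
    by (simp add: comp_def)
qed

text \<open>
  If the vector of copy \<open>i\<close> is perturbed at the labels in \<open>S\<close>, these are the new labels at
  which the factor of the result changes.
\<close>

definition copy_labels :: "'m \<Rightarrow> 'k set \<Rightarrow> 'k set" where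
  "copy_labels i S = {j. i \<in> ends D (Phi D j) \<and> Lam j \<in> S}"

definition copy_label_sets :: "'k set set \<Rightarrow> 'k set set" where
  "copy_label_sets \<S> = {copy_labels i S |i S. S \<in> \<S>}"

text \<open>
  In the summand for copy \<open>i\<close>, the factor at a label \<open>j\<close> outside of \<open>copy_labels i S\<close> is
  computed from entries of \<open>u\<close> only.
\<close>

lemma renorm_deriv_tensors_off:
  assumes "h \<in> tensors_off S u"
  shows "renorm_deriv (c *s tensor u) h \<in> vec.span (\<Union>i. tensors_off (copy_labels i S) (step u))"
  unfolding renorm_deriv_def
proof (rule vec.span_sum)
  fix i :: 'm
  obtain hh where hh: "h = tensor hh" "\<And>j. j \<notin> S \<Longrightarrow> hh j = u j" using assms unfolding tensors_off_def by blast
  define U where "U i' = (if i' = i then hh else u)" for i'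
  have "(\<lambda>i'. if i' = i then h else c *s tensor u) = (\<lambda>i'. (if i' = i then 1 else c) *s tensor (U i'))"
    by (auto simp: hh(1) U_def)
  then have "renorm_multi (\<lambda>i'. if i' = i then h else c *s tensor u) =
      (\<Prod>i'\<in>UNIV. if i' = i then 1 else c) *s (inner_factor U *s tensor (\<lambda>j. edge_factor U (Phi D j)))"
    by (simp only: renorm_multi_scale renorm_multi_tensor)
  moreover have "edge_factor U (Phi D j) = step u j" if "j \<notin> copy_labels i S" for j
  proof -
    have "U i' (Lam j) = u (Lam j)" if "i' \<in> ends D (Phi D j)" for i'
      using that \<open>j \<notin> copy_labels i S\<close> hh(2) by (auto simp: U_def copy_labels_def)
    then have "edge_factor U (Phi D j) = edge_factor (\<lambda>_. u) (Phi D j)"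
      by (intro ext) (simp add: edge_factor_def label_map_def)
    then show ?thesis by (simp add: edge_factor_Phi)
  qed
  then have "tensor (\<lambda>j. edge_factor U (Phi D j)) \<in> (\<Union>i. tensors_off (copy_labels i S) (step u))"
    unfolding tensors_off_def by blast
  ultimately show "renorm_multi (\<lambda>i'. if i' = i then h else c *s tensor u) \<in> vec.span (\<Union>i. tensors_off (copy_labels i S) (step u))"
    by (simp add: vec.span_scale vec.span_base)
qed

definition tensors_off_any :: "'k set set \<Rightarrow> ('k \<Rightarrow> bool \<Rightarrow> complex) \<Rightarrow> (complex ^ ('k \<Rightarrow> bool)) set" where
  "tensors_off_any \<S> u = (\<Union>S\<in>\<S>. tensors_off S u)"

lemma renorm_deriv_iter_span:
  assumes "h \<in> vec.span (tensors_off_any \<S> u)"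
  shows "renorm_deriv_iter n (c *s tensor u) h \<in> vec.span (tensors_off_any ((copy_label_sets ^^ n) \<S>) ((step ^^ n) u))"
proof (induction n)
  case (Suc n)
  obtain C where "(Fhat ^^ n) (tensor u) = C *s tensor ((step ^^ n) u)"
    using renorm_hat_iter_tensor by blast
  then obtain C' where C': "(Fhat ^^ n) (c *s tensor u) = C' *s tensor ((step ^^ n) u)"
    by (simp add: renorm_hat_iter_scale vector_smult_assoc) blast
  show ?case
    unfolding renorm_deriv_iter.simps C'
  proof (rule linear_span_image[OF linear_renorm_deriv _ Suc])
    fix x assume "x \<in> tensors_off_any ((copy_label_sets ^^ n) \<S>) ((step ^^ n) u)"
    then obtain S where S: "S \<in> (copy_label_sets ^^ n) \<S>" "x \<in> tensors_off S ((step ^^ n) u)" unfolding tensors_off_any_def by blast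
    have "renorm_deriv (C' *s tensor ((step ^^ n) u)) x \<in> vec.span (\<Union>i. tensors_off (copy_labels i S) (step ((step ^^ n) u)))"
      by (rule renorm_deriv_tensors_off[OF S(2)])
    moreover have "(\<Union>i. tensors_off (copy_labels i S) (step ((step ^^ n) u))) \<subseteq> tensors_off_any ((copy_label_sets ^^ Suc n) \<S>) ((step ^^ Suc n) u)"
      using S(1) unfolding tensors_off_any_def funpow.simps comp_def copy_label_sets_def by blast
    ultimately show "renorm_deriv (C' *s tensor ((step ^^ n) u)) x \<in> vec.span (tensors_off_any ((copy_label_sets ^^ Suc n) \<S>) ((step ^^ Suc n) u))"
      using vec.span_mono by blast
  qed
qed (use assms in simp)

definition at_most_single :: "'k set set" where "at_most_single = {S. \<exists>j. S \<subseteq> {j}}"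

text \<open>
  Two marked vertices that lie in the same copy and have the same label there are equal, and
  \<open>Phi\<close> is injective. To first order, this is the invariance of \<open>M_var\<close>.
\<close>

lemma copy_labels_single: "S \<in> at_most_single \<Longrightarrow> copy_labels i S \<in> at_most_single"
proof -
  assume "S \<in> at_most_single"
  then obtain j0 where S: "S \<subseteq> {j0}" unfolding at_most_single_def by blast
  have "j = j'" if "j \<in> copy_labels i S" "j' \<in> copy_labels i S" for j j'
  proof -
    have "elabel D (Phi D j) = elabel D (Phi D j')" using that S unfolding copy_labels_def label_map_def by blast
    then have "Phi D j = Phi D j'" using that ends_eq_if_meet[OF Phi_edges Phi_edges] unfolding copy_labels_def by blast
    then show ?thesis using inj_Phi by (auto dest: injD)
  qed
  then show ?thesis unfolding at_most_single_def by blast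
qed

lemma copy_label_sets_single: "\<S> \<subseteq> at_most_single \<Longrightarrow> (copy_label_sets ^^ n) \<S> \<subseteq> at_most_single"
  by (induction n) (auto simp: copy_label_sets_def intro!: copy_labels_single)

lemma copy_label_sets_empty: "\<S> \<subseteq> {{}} \<Longrightarrow> (copy_label_sets ^^ n) \<S> \<subseteq> {{}}"
  by (induction n) (auto simp: copy_label_sets_def copy_labels_def)

lemma Phi_iter_Cons: "i # w \<in> Phi_iter D (Suc n) j \<longleftrightarrow> i \<in> ends D (Phi D j) \<and> w \<in> Phi_iter D n (Lam j)"
proof -
  have "(\<forall>l<Suc n. (i # w) ! l \<in> ends D (Phi D ((Lam ^^ l) j))) \<longleftrightarrow>
      i \<in> ends D (Phi D j) \<and> (\<forall>l<n. w ! l \<in> ends D (Phi D ((Lam ^^ l) (Lam j))))"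
    unfolding All_less_Suc2 by (simp add: funpow_swap1)
  then show ?thesis unfolding Phi_iter_def by auto
qed

text \<open>
  The list \<open>w\<close> names a copy in the \<open>n\<close>-th iterate, and \<open>S\<close> is the set of marked vertices that
  lie in it.
\<close>

lemma copy_label_sets_UNIV: "S \<in> (copy_label_sets ^^ n) {UNIV} \<Longrightarrow> \<exists>w. length w = n \<and> S = {j. w \<in> Phi_iter D n j}"
proof (induction n arbitrary: S)
  case 0
  then show ?case by (simp add: Phi_iter_def)
next
  case (Suc n)
  then have "S \<in> copy_label_sets ((copy_label_sets ^^ n) {UNIV})" by simp
  then obtain i S' where S': "S = copy_labels i S'" "S' \<in> (copy_label_sets ^^ n) {UNIV}"
    unfolding copy_label_sets_def[of "(copy_label_sets ^^ n) {UNIV}"] by blast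
  with Suc.IH obtain w where "length w = n" "S' = {j. w \<in> Phi_iter D n j}" by blast
  then show ?case by (intro exI[of _ "i # w"]) (auto simp: S'(1) copy_labels_def Phi_iter_Cons)
qed

text \<open>
  Passing to prefixes of length \<open>n0\<close> shows that the sets stay disjoint for all larger \<open>n\<close>.
  Consequently, the derivative of a high iterate maps every direction to the tangent space of
  \<open>M_var\<close>.
\<close>

lemma expanding_at_most_single:
  assumes "disjoint_family (Phi_iter D n0)" "n \<ge> n0" shows "(copy_label_sets ^^ n) {UNIV} \<subseteq> at_most_single"
proof
  fix S assume "S \<in> (copy_label_sets ^^ n) {UNIV}"
  then obtain w where w: "length w = n" "S = {j. w \<in> Phi_iter D n j}" using copy_label_sets_UNIV by blast
  have "take n0 w \<in> Phi_iter D n0 j" if "j \<in> S" for j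
    using that assms(2) w unfolding Phi_iter_def by auto
  then have "j = j'" if "j \<in> S" "j' \<in> S" for j j'
    using assms(1) that unfolding disjoint_family_on_def by blast
  then show "S \<in> at_most_single" unfolding at_most_single_def by blast
qed

end


section \<open>Transversal superattraction\<close>

text \<open>
  Used for curves along which the ratio of two coordinates of \<open>G\<close> is known to be
  \<open>(K2 + t K3) / K1\<close>. Clearing denominators makes it unnecessary to know the common factor of
  the two coordinates.
\<close>

lemma ratio_derivative:
  fixes G :: "complex ^ 'i::finite \<Rightarrow> complex ^ 'i"
  assumes A: "(G has_derivative A) (at y)" "\<And>t h. A (t *s h) = t *s A h"
    and eq: "\<And>t. G (y + t *s h) $ x * K1 = G (y + t *s h) $ a * (K2 + t * K3)"
  shows "A h $ x * K1 = A h $ a * K2 + G y $ a * K3"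
proof -
  have der: "((\<lambda>t. G (y + t *s h) $ l) has_derivative (\<lambda>t. t * A h $ l)) (at 0)" for l
    using cdiff_line[OF bounded_linear.has_derivative[OF bounded_linear_coord[of l] A(1)], of h]
    by (simp add: A(2))
  have "((\<lambda>t. G (y + t *s h) $ x * K1) has_derivative (\<lambda>t. t * A h $ x * K1)) (at 0)"
    by (rule has_derivative_mult_left[OF der])
  moreover have "((\<lambda>t. G (y + t *s h) $ a * (K2 + t * K3)) has_derivative
      (\<lambda>t. G (y + 0 *s h) $ a * (t * K3) + t * A h $ a * (K2 + 0 * K3))) (at 0)"
    by (rule has_derivative_mult[OF der]) (auto intro!: derivative_eq_intros)
  ultimately have "(\<lambda>t. t * A h $ x * K1) = (\<lambda>t. G (y + 0 *s h) $ a * (t * K3) + t * A h $ a * (K2 + 0 * K3))"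
    unfolding eq by (rule has_derivative_unique)
  from fun_cong[OF this, of 1] show ?thesis by simp
qed

context retracting_recursion
begin

text \<open>
  The lift has the derivative \<open>A\<close> at \<open>y\<close>, and \<open>B\<close> is the map induced by \<open>A\<close> on the tangent
  space of the chart. The vectors \<open>eps j\<close> span the tangent space of \<open>M_var\<close>. By the
  propagation of product directions, \<open>B\<close> maps their span to itself and a power of \<open>B\<close> maps
  everything to it. The index \<open>a\<close> of the chart is arbitrary here, so \<open>a j\<close> and \<open>a (\<pi> j)\<close> may
  differ; this affects only those entries of the matrix of \<open>B\<close> that do not matter for its
  trace.
\<close>

lemma jacobian_char_poly:
  assumes exp: "expanding D" and p: "p \<in> G.graph_variety - renorm_indet D lam N" "p \<in> chart_dom a"
    and e: "bij_betw e {..<CARD('k \<Rightarrow> bool) - 1} (UNIV - {a})"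
  shows "char_poly (jacobian_mat (renorm_map D lam N) a e p) =
    [:-1, 1:] ^ card (range (Lam ^^ N)) * [:0, 1:] ^ (CARD('k \<Rightarrow> bool) - 1 - card (range (Lam ^^ N)))"
proof -
  let ?pi = "Lam ^^ N"
  define GG where "GG = Fhat ^^ N"
  from p(1) obtain t0 where t0: "p = abs_proj (tensor (G.lift t0))" "tensor (G.lift t0) \<noteq> 0" unfolding G.graph_variety_def by blast
  define u where "u = G.lift t0"
  have p_u: "p = abs_proj (tensor u)" and nz: "tensor u \<noteq> 0" using t0 by (simp_all add: u_def)
  have Lu: "G.lift u = u" unfolding u_def by (rule G.lift_idem)
  have stepu: "(step ^^ N) u = u" using Lu unfolding G_lift .
  have va: "tensor u $ a \<noteq> 0" using p(2) abs_in_chart_dom[OF nz] unfolding p_u by blast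
  then have ua: "u j (a j) \<noteq> 0" for j by simp
  define d where "d = inverse (tensor u $ a)"
  have d: "d \<noteq> 0" using va by (simp add: d_def)
  define y where "y = (\<chi> l. aff_coord a l p)"
  have y: "y = d *s tensor u"
    unfolding y_def p_u by (simp add: cart_eq_iff aff_coord_abs[OF nz] d_def divide_inverse mult.commute)
  have ya: "y $ a = 1" and y0: "y \<noteq> 0" and py: "abs_proj y = p"
    using normalised_lift[OF p(2)] unfolding y_def by blast+
  define Q where "Q j x = (\<Prod>i\<in>UNIV - {j}. u i (x i))" for j x
  have tensor_Q: "tensor (u(j := f)) $ x = f (x j) * Q j x" for j f x
  proof -
    have "(\<Prod>i\<in>UNIV - {j}. (u(j := f)) i (x i)) = Q j x" unfolding Q_def by (intro prod.cong) auto
    then show ?thesis by (simp add: prod.remove[of UNIV j])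
  qed
  have tensor_u_Q: "tensor u $ x = u j (x j) * Q j x" for j x
    using tensor_Q[of j "u j" x] by simp
  have Qa: "d * (u j (a j) * Q j a) = 1" for j
    using va unfolding d_def tensor_u_Q[symmetric] by simp
  obtain C where C: "GG (tensor u) = C *s tensor u"
    using renorm_hat_iter_tensor[of N u] unfolding stepu GG_def by blast
  have "GG (tensor u) \<noteq> 0"
    using p(1) indet_iter[OF nz] unfolding p_u GG_def by blast
  then have C0: "C \<noteq> 0" using C by auto
  define c where "c = d ^ (CARD('m) ^ N) * C / d"
  have c: "c \<noteq> 0" using C0 d by (simp add: c_def)
  have GGy: "GG y = c *s y"
    using d C by (simp add: y GG_def renorm_hat_iter_scale c_def vector_smult_assoc)
  define A where "A = renorm_deriv_iter N y"
  have linA: "Vector_Spaces.linear (*s) (*s) A" unfolding A_def by (rule linear_renorm_deriv_iter)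
  interpret A: Vector_Spaces.linear "(*s)" "(*s)" A by (rule linA)
  have derA: "(GG has_derivative A) (at y)" unfolding GG_def A_def by (rule has_derivative_renorm_hat_iter)
  have A_span: "A h \<in> vec.span (tensors_off_any ((copy_label_sets ^^ N) \<S>) u)" if "h \<in> vec.span (tensors_off_any \<S> u)" for h \<S>
    using renorm_deriv_iter_span[OF that, of N d] unfolding A_def y stepu .
  have A_pow_span: "(A ^^ t) h \<in> vec.span (tensors_off_any ((copy_label_sets ^^ (N * t)) {UNIV}) u)" for t h
  proof (induction t)
    case 0
    have "tensors_off_any {UNIV} u = tensors_off UNIV u" by (simp add: tensors_off_any_def)
    then show ?case using span_tensors_off_UNIV by simp
  next
    case (Suc t)
    from A_span[OF Suc] show ?case by (simp add: funpow_add)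
  qed
  have "y \<in> vec.span (tensors_off_any {{}} u)"
    unfolding y tensors_off_any_def tensors_off_def by (intro vec.span_scale vec.span_base) auto
  then have "A y \<in> vec.span (tensors_off_any ((copy_label_sets ^^ N) {{}}) u)" by (rule A_span)
  also have "\<dots> \<subseteq> vec.span (tensors_off_any {{}} u)"
    using copy_label_sets_empty[of "{{}}" N] by (intro vec.span_mono) (auto simp: tensors_off_any_def)
  also have "tensors_off_any {{}} u = {tensor u}"
  proof -
    have "(\<forall>j. h j = u j) \<longleftrightarrow> h = u" for h by auto
    then show ?thesis by (simp add: tensors_off_any_def tensors_off_def)
  qed
  finally obtain \<kappa>' where "A y = \<kappa>' *s tensor u" unfolding vec.span_singleton by blast
  then have Ay: "A y = (\<kappa>' / d) *s y" using d by (simp add: y vector_smult_assoc)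
  \<comment> \<open>The projection along the line of \<open>y\<close> to the hyperplane of vectors that vanish at \<open>a\<close>. Since
      \<open>A\<close> preserves this line, \<open>B\<close> has the same powers as \<open>A\<close>, up to scalars and the
      projection.\<close>
  define pr where "pr z = z - (z $ a) *s y" for z
  have pr_lin: "pr (z + z') = pr z + pr z'" "pr (b *s z) = b *s pr z" "pr (z - z') = pr z - pr z'" "pr 0 = 0" for z z' b
    by (auto simp: pr_def cart_eq_iff algebra_simps)
  have pr_y: "pr y = 0" by (simp add: pr_def ya)
  define B where "B h = inverse c *s pr (A h)" for h
  have linB: "Vector_Spaces.linear (*s) (*s) B"
    unfolding Vector_Spaces.linear_iff B_def
    by (auto simp: A.add A.scale pr_lin vec.vector_space_axioms vector_smult_assoc mult.commute vec.scale_right_distrib)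
  have Ba: "B h $ a = 0" for h by (simp add: B_def pr_def ya)
  have B_pr: "B (pr z) = B z" for z
    by (simp add: B_def pr_def[of z] A.diff A.scale pr_lin Ay pr_y)
  have B_pow: "(B ^^ Suc t) h = inverse c ^ Suc t *s pr ((A ^^ Suc t) h)" for t h
  proof (induction t)
    case (Suc t)
    interpret B: Vector_Spaces.linear "(*s)" "(*s)" B by (rule linB)
    have "(B ^^ Suc (Suc t)) h = B (inverse c ^ Suc t *s pr ((A ^^ Suc t) h))"
      using Suc by simp
    also have "\<dots> = inverse c ^ Suc t *s (inverse c *s pr (A ((A ^^ Suc t) h)))"
      unfolding B.scale B_pr unfolding B_def ..
    finally show ?case by (simp add: vector_smult_assoc mult_ac)
  qed (simp add: B_def)
  \<comment> \<open>The factor at \<open>j\<close> moves in the direction that keeps its entry at \<open>a j\<close>; the scalar makes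
      \<open>eps j\<close> dual to the coordinates \<open>flip_at j'\<close>.\<close>
  define eps where "eps j = (d * u j (a j)) *s tensor (u(j := (\<lambda>b. if b = a j then 0 else 1)))" for j
  define flip_at where "flip_at = G.flip a"
  have eps_nth: "eps j $ x = (if x j = a j then 0 else d * u j (a j) * Q j x)" for j x
    unfolding eps_def vector_smult_component tensor_Q by simp
  have epsa: "eps j $ a = 0" for j by (simp add: eps_nth)
  have Q_flip: "Q j (flip_at j) = Q j a" for j unfolding Q_def flip_at_def G.flip_def by (intro prod.cong) auto
  have dual: "eps j $ flip_at j' = (if j = j' then 1 else 0)" for j j'
    using Qa[of j] Q_flip[of j] by (auto simp: eps_nth mult.assoc) (auto simp: flip_at_def G.flip_def)
  \<comment> \<open>The span of all \<open>eps j\<close>, described by the dual coordinates.\<close>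
  define R where "R = {z. z = (\<Sum>j\<in>UNIV. (z $ flip_at j) *s eps j)}"
  have R_eps: "b *s eps j \<in> R" for b j
  proof -
    have "(\<Sum>j'\<in>UNIV. ((b *s eps j) $ flip_at j') *s eps j') = (\<Sum>j'\<in>UNIV. if j' = j then b *s eps j else 0)"
      by (intro sum.cong refl) (auto simp: dual)
    then show ?thesis unfolding R_def by simp
  qed
  have R_sub: "vec.subspace R"
    unfolding vec.subspace_def R_def
  proof (intro conjI ballI allI; unfold mem_Collect_eq)
    show "0 = (\<Sum>j\<in>UNIV. (0 $ flip_at j) *s eps j)" by simp
    fix z z' assume "z = (\<Sum>j\<in>UNIV. (z $ flip_at j) *s eps j)" "z' = (\<Sum>j\<in>UNIV. (z' $ flip_at j) *s eps j)"
    then show "z + z' = (\<Sum>j\<in>UNIV. ((z + z') $ flip_at j) *s eps j)"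
      by (simp add: vec.scale_left_distrib sum.distrib)
  next
    fix b z assume z: "z = (\<Sum>j\<in>UNIV. (z $ flip_at j) *s eps j)"
    have "(\<Sum>j\<in>UNIV. ((b *s z) $ flip_at j) *s eps j) = b *s (\<Sum>j\<in>UNIV. (z $ flip_at j) *s eps j)"
      by (simp add: vec.scale_sum_right vector_smult_assoc)
    with z show "b *s z = (\<Sum>j\<in>UNIV. ((b *s z) $ flip_at j) *s eps j)" by simp
  qed
  have pr_tensors_off: "pr h \<in> R" if "h \<in> tensors_off_any at_most_single u" for h
  proof -
    from that obtain S where "S \<in> at_most_single" "h \<in> tensors_off S u" unfolding tensors_off_any_def by blast
    then obtain j where "h \<in> tensors_off {j} u" unfolding at_most_single_def using tensors_off_mono by blast
    then obtain hh where hh: "h = tensor hh" "\<And>i. i \<noteq> j \<Longrightarrow> hh i = u i" unfolding tensors_off_def by auto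
    have hh_upd: "hh = u(j := hh j)" using hh(2) by auto
    define \<beta> where "\<beta> = hh j (\<not> a j) - hh j (a j) / u j (a j) * u j (\<not> a j)"
    have "pr h = (\<beta> / (d * u j (a j))) *s eps j"
    proof (rule iffD2[OF cart_eq_iff], intro allI)
      fix x
      have h_nth: "h $ x = hh j (x j) * Q j x" for x unfolding hh(1) by (subst hh_upd) (rule tensor_Q)
      have Qa': "Q j a * d = 1 / u j (a j)" using Qa[of j] ua[of j] by (simp add: field_simps)
      have "pr h $ x = hh j (x j) * Q j x - hh j (a j) * (Q j a * d) * (u j (x j) * Q j x)"
        by (simp add: pr_def h_nth y tensor_u_Q[of x j] del: tensor_nth)
      also have "\<dots> = Q j x * (hh j (x j) - hh j (a j) / u j (a j) * u j (x j))"
        unfolding Qa' by (simp add: algebra_simps)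
      also have "\<dots> = (if x j = a j then 0 else Q j x * \<beta>)"
      proof (cases "x j = a j")
        case False
        then have "x j = (\<not> a j)" by auto
        then show ?thesis by (simp add: \<beta>_def)
      qed (simp add: ua)
      also have "\<dots> = ((\<beta> / (d * u j (a j))) *s eps j) $ x"
        using d ua[of j] by (simp add: eps_nth)
      finally show "pr h $ x = ((\<beta> / (d * u j (a j))) *s eps j) $ x" .
    qed
    then show ?thesis using R_eps by simp
  qed
  have pr_span: "pr h \<in> R" if "h \<in> vec.span (tensors_off_any at_most_single u)" for h
  proof -
    have "Vector_Spaces.linear (*s) (*s) pr"
      unfolding Vector_Spaces.linear_iff by (simp add: pr_lin vec.vector_space_axioms)
    then have "pr h \<in> vec.span R"
      by (rule linear_span_image[OF _ _ that]) (use pr_tensors_off vec.span_base in blast)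
    then show ?thesis using R_sub by (metis vec.span_eq_iff)
  qed
  obtain n0 where n0: "disjoint_family (Phi_iter D n0)" using exp unfolding expanding_def by blast
  have range: "(B ^^ Suc n0) h = (\<Sum>j\<in>UNIV. ((B ^^ Suc n0) h $ flip_at j) *s eps j)" for h
  proof -
    have "N * Suc n0 \<ge> n0" using N(1) by (cases N) auto
    then have "(copy_label_sets ^^ (N * Suc n0)) {UNIV} \<subseteq> at_most_single" by (rule expanding_at_most_single[OF n0])
    then have "tensors_off_any ((copy_label_sets ^^ (N * Suc n0)) {UNIV}) u \<subseteq> tensors_off_any at_most_single u" unfolding tensors_off_any_def by blast
    then have "(A ^^ Suc n0) h \<in> vec.span (tensors_off_any at_most_single u)" using A_pow_span[of "Suc n0" h] vec.span_mono by blast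
    then have "(B ^^ Suc n0) h \<in> R"
      unfolding B_pow by (intro vec.subspace_scale[OF R_sub] pr_span)
    then show ?thesis unfolding R_def by blast
  qed
  have eps_span: "eps j \<in> vec.span (tensors_off_any {{j}} u)" for j
    unfolding eps_def tensors_off_any_def tensors_off_def by (intro vec.span_scale vec.span_base) auto
  have Beps: "B (eps j) = (\<Sum>j'\<in>UNIV. (B (eps j) $ flip_at j') *s eps j')" for j
  proof -
    have "(copy_label_sets ^^ N) {{j}} \<subseteq> at_most_single" by (rule copy_label_sets_single) (auto simp: at_most_single_def)
    then have "tensors_off_any ((copy_label_sets ^^ N) {{j}}) u \<subseteq> tensors_off_any at_most_single u" unfolding tensors_off_any_def by blast
    then have "A (eps j) \<in> vec.span (tensors_off_any at_most_single u)" using A_span[OF eps_span] vec.span_mono by blast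
    then have "B (eps j) \<in> R" unfolding B_def by (intro vec.subspace_scale[OF R_sub] pr_span)
    then show ?thesis unfolding R_def by blast
  qed
  \<comment> \<open>Move along \<open>eps j\<close>. The coordinates of the image at \<open>flip_at j'\<close> and at \<open>a\<close> are in the ratio
      of the two entries of its factor at \<open>j'\<close>, which is a monomial image of the factor at
      \<open>?pi j'\<close> and hence known explicitly.\<close>
  have coords: "B (eps j) $ flip_at j' = (if ?pi j = j \<and> j = j' then 1 else 0)"
    if jj': "?pi j \<noteq> j \<or> ?pi j' = j'" for j j'
  proof -
    define us where "us s = u(j := (\<lambda>b. if b = a j then u j b else u j b + s * u j (a j)))" for s
    define K3 where "K3 = (if ?pi j = j \<and> j = j' then u j (a j) else 0)"
    have line: "y + s *s eps j = d *s tensor (us s)" for s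
    proof (rule iffD2[OF cart_eq_iff], intro allI)
      fix x
      have "(y + s *s eps j) $ x = d * (u j (x j) * Q j x) + s * eps j $ x"
        by (simp only: y vector_add_component vector_smult_component tensor_u_Q[of x j])
      also have "\<dots> = d * ((if x j = a j then u j (x j) else u j (x j) + s * u j (a j)) * Q j x)"
        by (simp add: eps_nth algebra_simps)
      also have "\<dots> = (d *s tensor (us s)) $ x"
        unfolding us_def vector_smult_component tensor_Q ..
      finally show "(y + s *s eps j) $ x = (d *s tensor (us s)) $ x" .
    qed
    have U: "G.lift (us s) j' (a j') = u j' (a j')" "G.lift (us s) j' (\<not> a j') = u j' (\<not> a j') + s * K3" for s
    proof -
      have "G.lift (us s) j' (a j') = u j' (a j') \<and> G.lift (us s) j' (\<not> a j') = u j' (\<not> a j') + s * K3"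
      proof (cases "?pi j = j")
        case True
        then have j': "?pi j' = j'" using jj' by simp
        have "G.lift (us s) j' b = us s j' b" for b using G.lift_pi[of "us s" j' b] by (simp only: j')
        then show ?thesis using True by (simp add: us_def K3_def)
      next
        case False
        then have "?pi j' \<noteq> j" using Lam_N_idem by metis
        then have "G.lift (us s) j' = G.lift u j'" by (intro ext) (simp add: G.lift_def us_def)
        then show ?thesis using False by (simp add: Lu K3_def)
      qed
      then show "G.lift (us s) j' (a j') = u j' (a j')" "G.lift (us s) j' (\<not> a j') = u j' (\<not> a j') + s * K3" by auto
    qed
    have "GG (y + s *s eps j) $ flip_at j' * u j' (a j') = GG (y + s *s eps j) $ a * (u j' (\<not> a j') + s * K3)" for s
    proof -
      obtain Cs where "GG (tensor (us s)) = Cs *s tensor (G.lift (us s))"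
        using renorm_hat_iter_tensor[of N "us s"] unfolding GG_def G_lift by blast
      then have GGs: "GG (y + s *s eps j) = (d ^ (CARD('m) ^ N) * Cs) *s tensor (G.lift (us s))"
        unfolding line by (simp add: GG_def renorm_hat_iter_scale vector_smult_assoc)
      have "tensor (G.lift (us s)) $ flip_at j' = G.lift (us s) j' (\<not> a j') * (\<Prod>i\<in>UNIV - {j'}. G.lift (us s) i (a i))"
        unfolding flip_at_def G.flip_def by (rule tensor_upd)
      moreover have "tensor (G.lift (us s)) $ a = G.lift (us s) j' (a j') * (\<Prod>i\<in>UNIV - {j'}. G.lift (us s) i (a i))"
        using tensor_upd[of "G.lift (us s)" a j' "a j'"] by (simp only: fun_upd_triv)
      ultimately show ?thesis unfolding GGs vector_smult_component by (simp add: U del: tensor_nth)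
    qed
    then have "A (eps j) $ flip_at j' * u j' (a j') = A (eps j) $ a * u j' (\<not> a j') + GG y $ a * K3"
      by (rule ratio_derivative[OF derA A.scale])
    moreover have "GG y $ a = c" by (simp add: GGy ya)
    moreover have "y $ flip_at j' = u j' (\<not> a j') / u j' (a j')"
    proof -
      have "y $ flip_at j' = d * (u j' (\<not> a j') * Q j' a)"
        unfolding y vector_smult_component tensor_u_Q[of "flip_at j'" j'] Q_flip by (simp add: flip_at_def G.flip_def)
      also have "\<dots> = u j' (\<not> a j') * (d * Q j' a)" by (simp only: mult_ac)
      also have "d * Q j' a = 1 / u j' (a j')" using Qa[of j'] ua[of j'] by (simp add: field_simps)
      finally show ?thesis by simp
    qed
    ultimately have "B (eps j) $ flip_at j' = K3 / u j' (a j')"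
      using c ua[of j'] by (simp add: B_def pr_def field_simps)
    then show ?thesis using ua[of j'] by (cases "j = j'") (simp_all add: K3_def)
  qed
  have entry: "jacobian_entry (renorm_map D lam N) a p i j = B (axis j 1) $ i" for i j
    using jacobian_entry_eq[OF renorm_hat_iter_scale poly_renorm_hat_iter y_def p(2) GGy[unfolded GG_def] c derA[unfolded GG_def] A.scale]
    by (simp add: B_def pr_def divide_inverse algebra_simps)
  have "char_poly (Matrix.mat (CARD('k \<Rightarrow> bool) - 1) (CARD('k \<Rightarrow> bool) - 1) (\<lambda>(r, s). B (axis (e s) 1) $ e r)) =
    [:-1, 1:] ^ card {j. ?pi j = j} * [:0, 1:] ^ (CARD('k \<Rightarrow> bool) - 1 - card {j. ?pi j = j})"
  proof (rule char_poly_mat_of_retraction[OF linB Ba epsa dual range Beps _ _ e])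
    show "B (eps j) $ flip_at j' = 0" if "j \<notin> {j. ?pi j = j}" for j j'
      using coords[of j j'] that by simp
    show "B (eps j) $ flip_at j' = (if j = j' then 1 else 0)" if "j \<in> {j. ?pi j = j}" "j' \<in> {j. ?pi j = j}" for j j'
      using coords[of j j'] that by simp
  qed
  moreover have "{j. ?pi j = j} = range ?pi"
  proof (intro equalityI subsetI)
    fix j assume "j \<in> {j. ?pi j = j}"
    then have "j = ?pi j" by simp
    then show "j \<in> range ?pi" by (rule range_eqI)
  next
    fix j assume "j \<in> range ?pi"
    then obtain i where "j = ?pi i" by (elim rangeE)
    then show "j \<in> {j. ?pi j = j}" by (simp add: Lam_N_idem)
  qed
  ultimately show ?thesis unfolding jacobian_mat_def entry by simp
qed

lemma M0_superattracting:
  assumes "expanding D"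
  shows "transversally_superattracting (renorm_map D lam N) (M0_var D lam N - renorm_indet D lam N)"
  unfolding transversally_superattracting_def M0_eq_graph_variety
proof (intro exI[of _ "card (range (Lam ^^ N))"] conjI ballI allI impI)
  have openW: "open (- renorm_indet D lam N)"
    by (rule open_Compl_proj_indet[OF renorm_hat_iter_scale poly_renorm_hat_iter])
  obtain t where t: "tensor (G.lift t) \<noteq> 0" "\<And>j. G.lift t j True = 0" "abs_proj (tensor (G.lift t)) \<in> G.graph_variety"
    using G.origin_in_graph_variety by blast
  have "G.lift t j False \<noteq> 0" for j
    using t(1,2) unfolding tensor_nonzero_iff by (metis (full_types))
  then have "abs_proj (tensor (G.lift t)) \<notin> renorm_indet D lam N"
    unfolding indet_iter[OF t(1)] by (intro renorm_hat_iter_origin t(2))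
  then have "G.graph_variety \<inter> - renorm_indet D lam N \<noteq> {}" using t(3) by blast
  then show "proj_submanifold (card (range (Lam ^^ N))) (G.graph_variety - renorm_indet D lam N)"
    using G.proj_submanifold_graph_variety[OF openW] by (simp add: Diff_eq)
  show "\<exists>W. open W \<and> G.graph_variety - renorm_indet D lam N \<subseteq> W \<and> proj_holomorphic_map_on (renorm_map D lam N) W"
    using openW proj_map_holomorphic[OF renorm_hat_iter_scale poly_renorm_hat_iter] by blast
  show "renorm_map D lam N p = p" if "p \<in> G.graph_variety - renorm_indet D lam N" for p
    using that by (rule graph_variety_fixed)
  show "char_poly (jacobian_mat (renorm_map D lam N) a e p) =
      [:- 1, 1:] ^ card (range (Lam ^^ N)) * [:0, 1:] ^ (CARD('k \<Rightarrow> bool) - 1 - card (range (Lam ^^ N)))"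
    if "p \<in> G.graph_variety - renorm_indet D lam N" "p \<in> chart_dom a \<and> bij_betw e {..<CARD('k \<Rightarrow> bool) - 1} (UNIV - {a})" for p a e
    using jacobian_char_poly[OF assms that(1)] that(2) by blast
qed

end


section \<open>Decay of correlations for positive parameters\<close>

text \<open>
  The defect in a swap equation and the square of the norm are both homogeneous of degree 2.
  Hence it is an open condition on points of projective space that the defect exceeds \<open>\<delta>\<close>
  times the squared norm. If the defect of the limit were nonzero, the condition would hold
  for some \<open>\<delta>\<close> from some point on.
\<close>

lemma limit_in_M_var:
  fixes w :: "nat \<Rightarrow> complex ^ ('k::finite \<Rightarrow> bool)"
  assumes nz: "\<And>i. w i \<noteq> 0" and lim: "(\<lambda>i. abs_proj (w i)) \<longlonglongrightarrow> \<xi>"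
    and decay: "\<And>j x y \<delta>. \<delta> > 0 \<Longrightarrow> eventually (\<lambda>i. cmod (w i $ (x(j := True)) * w i $ (y(j := False))
        - w i $ (x(j := False)) * w i $ (y(j := True))) \<le> \<delta> * (norm (w i))\<^sup>2) sequentially"
  shows "\<xi> \<in> M_var"
proof -
  define q where "q = rep_proj \<xi>"
  have q: "q \<noteq> 0" "abs_proj q = \<xi>" by (simp_all add: q_def)
  have "q $ (x(j := True)) * q $ (y(j := False)) = q $ (x(j := False)) * q $ (y(j := True))" for j x y
  proof (rule ccontr)
    define f where "f v = cmod (v $ (x(j := True)) * v $ (y(j := False)) - v $ (x(j := False)) * v $ (y(j := True)))"
      for v :: "complex ^ ('k \<Rightarrow> bool)"
    assume "q $ (x(j := True)) * q $ (y(j := False)) \<noteq> q $ (x(j := False)) * q $ (y(j := True))"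
    then have fq: "f q > 0" by (simp add: f_def)
    define \<delta> where "\<delta> = f q / (2 * (norm q)\<^sup>2)"
    have \<delta>: "\<delta> > 0" using fq q by (simp add: \<delta>_def)
    have norm_scale: "norm (c *s v) = cmod c * norm v" for c and v :: "complex ^ ('k \<Rightarrow> bool)"
      by (simp add: norm_vec_def L2_set_def norm_mult power_mult_distrib sum_distrib_left[symmetric] real_sqrt_mult)
    have f_scale: "f (c *s v) = (cmod c)\<^sup>2 * f v" for c v
      by (simp add: f_def norm_mult[symmetric] norm_power[symmetric] power2_eq_square algebra_simps)
    have "open {p. \<delta> * (norm (rep_proj p))\<^sup>2 < f (rep_proj p)}"
    proof (rule open_proj_Collect)
      show "\<delta> * (norm (c *s v))\<^sup>2 < f (c *s v) \<longleftrightarrow> \<delta> * (norm v)\<^sup>2 < f v" if "c \<noteq> 0" for c v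
      proof -
        have eq: "\<delta> * (norm (c *s v))\<^sup>2 = (cmod c)\<^sup>2 * (\<delta> * (norm v)\<^sup>2)"
          by (simp add: norm_scale power_mult_distrib)
        have "(cmod c)\<^sup>2 > 0" using that by simp
        then show ?thesis unfolding f_scale eq by (rule mult_less_cancel_left_pos)
      qed
      have "open {v :: complex ^ ('k \<Rightarrow> bool). v \<noteq> 0}" by (intro open_Collect_neq continuous_intros)
      moreover have "open {v. \<delta> * (norm v)\<^sup>2 < f v}"
        unfolding f_def by (intro open_Collect_less continuous_intros)
      ultimately show "open {v. v \<noteq> 0 \<and> \<delta> * (norm v)\<^sup>2 < f v}" by (rule open_Collect_conj)
    qed
    moreover have "\<xi> \<in> {p. \<delta> * (norm (rep_proj p))\<^sup>2 < f (rep_proj p)}"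
      using fq q by (simp add: q_def[symmetric] \<delta>_def)
    ultimately have "eventually (\<lambda>i. abs_proj (w i) \<in> {p. \<delta> * (norm (rep_proj p))\<^sup>2 < f (rep_proj p)}) sequentially"
      using lim by (rule topological_tendstoD[rotated])
    moreover have "eventually (\<lambda>i. f (w i) \<le> \<delta> * (norm (w i))\<^sup>2) sequentially"
      unfolding f_def by (rule decay[OF \<delta>])
    ultimately have "eventually (\<lambda>i. False) sequentially"
    proof eventually_elim
      fix i
      assume 1: "abs_proj (w i) \<in> {p. \<delta> * (norm (rep_proj p))\<^sup>2 < f (rep_proj p)}" and 2: "f (w i) \<le> \<delta> * (norm (w i))\<^sup>2"
      obtain c where c: "c \<noteq> 0" "rep_proj (abs_proj (w i)) = c *s w i" using rep_abs_proj[OF nz] .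
      have "\<delta> * (norm (c *s w i))\<^sup>2 < f (c *s w i)" using 1 c(2) by simp
      then have "(cmod c)\<^sup>2 * (\<delta> * (norm (w i))\<^sup>2) < (cmod c)\<^sup>2 * f (w i)"
        by (simp add: norm_scale f_scale power_mult_distrib mult_ac)
      then show False using 2 c(1) by simp
    qed
    then show False by simp
  qed
  then have "abs_proj q \<in> M_var" by (rule M_var_if_swap[OF q(1)])
  then show ?thesis using q by simp
qed

lemma power_diff_le:
  fixes lo hi :: real
  assumes "0 \<le> lo" "lo \<le> hi" shows "hi ^ Suc n - lo ^ Suc n \<le> real (Suc n) * hi ^ n * (hi - lo)"
proof (induction n)
  case (Suc n)
  have "hi ^ Suc (Suc n) - lo ^ Suc (Suc n) = hi * (hi ^ Suc n - lo ^ Suc n) + lo ^ Suc n * (hi - lo)"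
    by (simp add: algebra_simps)
  also have "\<dots> \<le> hi * (real (Suc n) * hi ^ n * (hi - lo)) + hi ^ Suc n * (hi - lo)"
    using assms Suc by (intro add_mono mult_left_mono mult_right_mono power_mono) auto
  also have "\<dots> = real (Suc (Suc n)) * hi ^ Suc n * (hi - lo)" by (simp add: algebra_simps)
  finally show ?case .
qed simp

locale positive_recursion = gluing_recursion D "complex_of_real l"
  for D :: "('e, 'k::finite, 'm::finite) gluing" and l :: real +
  assumes l: "l > 0"
begin

text \<open>
  The summands of the renormalization map on real vectors, where \<open>y\<close> is a state of all glued
  vertices.
\<close>

definition rterm :: "(('k \<Rightarrow> bool) \<Rightarrow> real) \<Rightarrow> ('e \<Rightarrow> bool) \<Rightarrow> real" where
  "rterm w y = inverse l ^ wedge_norm D y * (\<Prod>i\<in>UNIV. w (copy_tuple D y i))"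

definition rstep :: "(('k \<Rightarrow> bool) \<Rightarrow> real) \<Rightarrow> ('k \<Rightarrow> bool) \<Rightarrow> real" where
  "rstep w x = (\<Sum>\<eta>\<in>states. rterm w (wedge D x \<eta>))"

lemma renorm_hat_of_real: "Fhat (\<chi> x. of_real (w x)) = (\<chi> x. of_real (rstep w x))"
  by (simp add: renorm_hat_def rstep_def rterm_def)

lemma renorm_hat_iter_of_real: "(Fhat ^^ n) (\<chi> x. of_real (w x)) = (\<chi> x. of_real ((rstep ^^ n) w x))"
  by (induction n) (simp_all add: renorm_hat_of_real)

lemma wedge_upd: "wedge D (x(j := b)) \<eta> = (wedge D x \<eta>)(Phi D j := b)"
proof
  fix e
  show "wedge D (x(j := b)) \<eta> e = ((wedge D x \<eta>)(Phi D j := b)) e"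
  proof (cases "e \<in> range (Phi D)")
    case True
    then obtain j' where "e = Phi D j'" by blast
    then show ?thesis using inj_Phi by (auto dest: injD)
  next
    case False
    then show ?thesis by auto
  qed
qed

lemma copy_tuple_upd:
  assumes "e \<in> edges D"
  shows "copy_tuple D (y(e := b)) i = (if i \<in> ends D e then (copy_tuple D y i)(elabel D e := b) else copy_tuple D y i)"
proof
  fix j
  have "edge_at D j i = e \<longleftrightarrow> j = elabel D e \<and> i \<in> ends D e"
    using edge_at[of j i] edge_at_eq[OF assms, of i] by metis
  then show "copy_tuple D (y(e := b)) i j = (if i \<in> ends D e then (copy_tuple D y i)(elabel D e := b) else copy_tuple D y i) j"
    by (simp add: copy_tuple_def)
qed

text \<open>
  The state of the vertex glued along \<open>e\<close> enters through its own weight and through the entry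
  at its label in the copies that contain it.
\<close>

lemma rterm_upd:
  assumes e: "e \<in> edges D" and w: "\<And>x. w x \<ge> 0"
  obtains R where "R \<ge> 0" "\<And>b. rterm w (y(e := b)) = R * (if b then inverse l ^ (card (ends D e) - 1) else 1) *
    (\<Prod>i\<in>ends D e. w ((copy_tuple D y i)(elabel D e := b)))"
proof
  define R where "R = inverse l ^ (\<Sum>e'\<in>{e' \<in> edges D - {e}. y e'}. card (ends D e') - 1) *
    (\<Prod>i\<in>UNIV - ends D e. w (copy_tuple D y i))"
  show "R \<ge> 0" using l w by (auto simp: R_def intro!: mult_nonneg_nonneg prod_nonneg)
  fix b
  have "wedge_norm D (y(e := b)) = (\<Sum>e'\<in>{e' \<in> edges D - {e}. y e'}. card (ends D e') - 1) + (if b then card (ends D e) - 1 else 0)"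
  proof -
    have "{e' \<in> edges D. (y(e := b)) e'} = {e' \<in> edges D - {e}. y e'} \<union> (if b then {e} else {})"
      using e by auto
    moreover have "finite {e' \<in> edges D - {e}. y e'}" using finite_edges by auto
    ultimately show ?thesis unfolding wedge_norm_def by (auto simp: sum.union_disjoint)
  qed
  then have "inverse l ^ wedge_norm D (y(e := b)) = inverse l ^ (\<Sum>e'\<in>{e' \<in> edges D - {e}. y e'}. card (ends D e') - 1) *
      (if b then inverse l ^ (card (ends D e) - 1) else 1)"
    by (simp add: power_add)
  moreover have "(\<Prod>i\<in>UNIV. w (copy_tuple D (y(e := b)) i)) =
      (\<Prod>i\<in>UNIV - ends D e. w (copy_tuple D y i)) * (\<Prod>i\<in>ends D e. w ((copy_tuple D y i)(elabel D e := b)))"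
    by (subst prod.subset_diff[of "ends D e" UNIV]) (auto simp: copy_tuple_upd[OF e] intro!: arg_cong2[of _ _ _ _ "(*)"] prod.cong)
  ultimately show "rterm w (y(e := b)) = R * (if b then inverse l ^ (card (ends D e) - 1) else 1) *
      (\<Prod>i\<in>ends D e. w ((copy_tuple D y i)(elabel D e := b)))"
    by (simp add: rterm_def R_def mult_ac)
qed

lemma rterm_nonneg: "(\<And>x. w x \<ge> 0) \<Longrightarrow> rterm w y \<ge> 0"
  unfolding rterm_def using l by (intro mult_nonneg_nonneg prod_nonneg) auto

lemma rterm_upd_le:
  assumes e: "e \<in> edges D" and w: "\<And>x. w x \<ge> 0" and c: "c \<ge> 0"
    and le: "\<And>z. w (z(elabel D e := True)) \<le> c * w (z(elabel D e := False))"
  shows "rterm w (y(e := True)) \<le> c ^ card (ends D e) * inverse l ^ (card (ends D e) - 1) * rterm w (y(e := False))"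
proof -
  obtain R where R: "R \<ge> 0" "\<And>b. rterm w (y(e := b)) = R * (if b then inverse l ^ (card (ends D e) - 1) else 1) *
    (\<Prod>i\<in>ends D e. w ((copy_tuple D y i)(elabel D e := b)))" by (rule rterm_upd[where w = w and y = y, OF e w]) (rule that)
  have "(\<Prod>i\<in>ends D e. w ((copy_tuple D y i)(elabel D e := True))) \<le> (\<Prod>i\<in>ends D e. c * w ((copy_tuple D y i)(elabel D e := False)))"
    by (intro prod_mono conjI le w)
  also have "\<dots> = c ^ card (ends D e) * (\<Prod>i\<in>ends D e. w ((copy_tuple D y i)(elabel D e := False)))"
    by (simp add: prod.distrib)
  finally have "R * inverse l ^ (card (ends D e) - 1) * (\<Prod>i\<in>ends D e. w ((copy_tuple D y i)(elabel D e := True))) \<le>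
      R * inverse l ^ (card (ends D e) - 1) * (c ^ card (ends D e) * (\<Prod>i\<in>ends D e. w ((copy_tuple D y i)(elabel D e := False))))"
    using R(1) l by (intro mult_left_mono) auto
  then show ?thesis unfolding R(2) by (simp add: mult_ac)
qed

lemma rterm_upd_ge:
  assumes e: "e \<in> edges D" and w: "\<And>x. w x \<ge> 0" and c: "c \<ge> 0"
    and ge: "\<And>z. c * w (z(elabel D e := False)) \<le> w (z(elabel D e := True))"
  shows "c ^ card (ends D e) * inverse l ^ (card (ends D e) - 1) * rterm w (y(e := False)) \<le> rterm w (y(e := True))"
proof -
  obtain R where R: "R \<ge> 0" "\<And>b. rterm w (y(e := b)) = R * (if b then inverse l ^ (card (ends D e) - 1) else 1) *
    (\<Prod>i\<in>ends D e. w ((copy_tuple D y i)(elabel D e := b)))" by (rule rterm_upd[where w = w and y = y, OF e w]) (rule that)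
  have "c ^ card (ends D e) * (\<Prod>i\<in>ends D e. w ((copy_tuple D y i)(elabel D e := False))) =
      (\<Prod>i\<in>ends D e. c * w ((copy_tuple D y i)(elabel D e := False)))"
    by (simp add: prod.distrib)
  also have "\<dots> \<le> (\<Prod>i\<in>ends D e. w ((copy_tuple D y i)(elabel D e := True)))"
    using c w by (intro prod_mono conjI ge mult_nonneg_nonneg)
  finally have "R * inverse l ^ (card (ends D e) - 1) * (c ^ card (ends D e) * (\<Prod>i\<in>ends D e. w ((copy_tuple D y i)(elabel D e := False)))) \<le>
      R * inverse l ^ (card (ends D e) - 1) * (\<Prod>i\<in>ends D e. w ((copy_tuple D y i)(elabel D e := True)))"
    using R(1) l by (intro mult_left_mono) auto
  then show ?thesis unfolding R(2) by (simp add: mult_ac)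
qed

text \<open>
  For independence polynomials, removing a marked vertex from all independent sets that
  contain it gives the second condition, and the empty set gives the last one. All three
  conditions are inherited by the glued graph.
\<close>

definition removal_bound :: "(('k \<Rightarrow> bool) \<Rightarrow> real) \<Rightarrow> bool" where
  "removal_bound w \<longleftrightarrow> (\<forall>x. w x \<ge> 0) \<and> (\<forall>j z. w (z(j := True)) \<le> l * w (z(j := False))) \<and> w (\<lambda>_. False) > 0"

text \<open>
  Of the factors \<open>l\<close>, one for each copy that contains the vertex, the weight of the vertex
  cancels all but one.
\<close>

lemma rterm_flip:
  assumes "removal_bound w" "e \<in> edges D" shows "rterm w (y(e := True)) \<le> l * rterm w (y(e := False))"
proof -
  have "card (ends D e) \<ge> 1" using ends_nonempty[OF assms(2)] by (metis One_nat_def Suc_leI card_gt_0_iff finite)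
  then have "l ^ card (ends D e) * inverse l ^ (card (ends D e) - 1) = l"
    using l by (cases "card (ends D e)") (simp_all add: power_inverse)
  moreover have "rterm w (y(e := True)) \<le> l ^ card (ends D e) * inverse l ^ (card (ends D e) - 1) * rterm w (y(e := False))"
    using assms l unfolding removal_bound_def by (intro rterm_upd_le) auto
  ultimately show ?thesis by simp
qed

text \<open>
  The base is \<open>max 1 l\<close> instead of \<open>l\<close> since some of the vertices in \<open>A\<close> may be vacant from
  the start.
\<close>

lemma rterm_erase:
  assumes "removal_bound w" "finite A" "A \<subseteq> edges D"
  shows "rterm w y \<le> max 1 l ^ card A * rterm w (\<lambda>e. if e \<in> A then False else y e)"
  using assms(2,3)
proof (induction A)
  case (insert e A)
  define y' where "y' = (\<lambda>e. if e \<in> A then False else y e)"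
  have Phi_size: "rterm w z \<ge> 0" for z using assms(1) by (intro rterm_nonneg) (simp add: removal_bound_def)
  have "rterm w y' \<le> max 1 l * rterm w (y'(e := False))"
  proof (cases "y' e")
    case True
    then have "y'(e := True) = y'" by (intro fun_upd_idem) simp
    then have "rterm w y' \<le> l * rterm w (y'(e := False))"
      using rterm_flip[OF assms(1), of e y'] insert(4) by simp
    also have "\<dots> \<le> max 1 l * rterm w (y'(e := False))" using Phi_size by (intro mult_right_mono) auto
    finally show ?thesis .
  next
    case False
    then have "y'(e := False) = y'" by (intro fun_upd_idem) simp
    then show ?thesis using Phi_size[of y'] mult_right_mono[of 1 "max 1 l" "rterm w y'"] by simp
  qed
  then have le: "max 1 l ^ card A * rterm w y' \<le> max 1 l ^ card A * (max 1 l * rterm w (y'(e := False)))"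
    by (intro mult_left_mono) auto
  have upd: "y'(e := False) = (\<lambda>e'. if e' \<in> insert e A then False else y e')" by (rule ext) (simp add: y'_def)
  have "rterm w y \<le> max 1 l ^ card A * rterm w y'" using insert unfolding y'_def by simp
  also note le
  finally have "rterm w y \<le> max 1 l ^ card A * (max 1 l * rterm w (\<lambda>e'. if e' \<in> insert e A then False else y e'))"
    unfolding upd .
  then show ?case using insert by (simp add: mult_ac)
qed simp

lemma finite_PiE_inner: "finite states"
  using finite_edges by (intro finite_PiE) auto

lemma rstep_upd: "rstep w (x(j := b)) = (\<Sum>\<eta>\<in>states. rterm w ((wedge D x \<eta>)(Phi D j := b)))"
  by (simp add: rstep_def wedge_upd)

lemma removal_bound_rstep: assumes "removal_bound w" shows "removal_bound (rstep w)"
  unfolding removal_bound_def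
proof (intro conjI allI)
  have w: "w x \<ge> 0" for x using assms by (simp add: removal_bound_def)
  show "rstep w x \<ge> 0" for x unfolding rstep_def by (intro sum_nonneg rterm_nonneg w)
  show "rstep w (z(j := True)) \<le> l * rstep w (z(j := False))" for j z
    unfolding rstep_upd sum_distrib_left by (intro sum_mono rterm_flip[OF assms] Phi_edges)
  define \<eta>0 :: "'e \<Rightarrow> bool" where "\<eta>0 = restrict (\<lambda>_. False) inner_edges"
  have \<eta>0: "\<eta>0 \<in> states" by (simp add: \<eta>0_def)
  have wedge0: "wedge D (\<lambda>_. False) \<eta>0 e = False" if "e \<in> edges D" for e
    using that by (cases "e \<in> range (Phi D)") (auto simp: \<eta>0_def)
  have "copy_tuple D (wedge D (\<lambda>_. False) \<eta>0) i = (\<lambda>_. False)" for i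
    using wedge0 edge_at by (auto simp: copy_tuple_def)
  then have "rterm w (wedge D (\<lambda>_. False) \<eta>0) > 0"
    using assms l by (auto simp: rterm_def removal_bound_def intro!: mult_pos_pos prod_pos)
  also have "rterm w (wedge D (\<lambda>_. False) \<eta>0) \<le> rstep w (\<lambda>_. False)"
    unfolding rstep_def by (rule member_le_sum[OF \<eta>0]) (auto intro!: rterm_nonneg w finite_PiE_inner)
  finally show "0 < rstep w (\<lambda>_. False)" .
qed

lemma removal_bound_rstep_iter: "removal_bound w \<Longrightarrow> removal_bound ((rstep ^^ n) w)"
  by (induction n) (auto intro: removal_bound_rstep)

definition some_copy :: "'k \<Rightarrow> 'm" where
  "some_copy j = (SOME i. i \<in> ends D (Phi D j))"

lemma some_copy_mem: "some_copy j \<in> ends D (Phi D j)"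
proof -
  have "\<exists>i. i \<in> ends D (Phi D j)" using ends_nonempty[OF Phi_edges] by (simp add: ex_in_conv)
  then show ?thesis unfolding some_copy_def by (rule someI_ex)
qed

lemma ends_single: "Phi_size j = 1 \<Longrightarrow> ends D (Phi D j) = {some_copy j}"
  using some_copy_mem[of j] unfolding Phi_size_def card_1_singleton_iff One_nat_def by auto

text \<open>
  The state of the marked vertices of one copy at the vertex \<open>j\<close>, if the glued graph has its
  marked vertices in state \<open>x\<close> and all others vacant.
\<close>

definition transport1 :: "'k \<Rightarrow> ('k \<Rightarrow> bool) \<Rightarrow> 'k \<Rightarrow> bool" where
  "transport1 j x = copy_tuple D (wedge D x (\<lambda>_. False)) (some_copy j)"

fun transport :: "nat \<Rightarrow> 'k \<Rightarrow> ('k \<Rightarrow> bool) \<Rightarrow> 'k \<Rightarrow> bool" where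
  "transport 0 j x = x"
| "transport (Suc n) j x = transport n (Lam j) (transport1 j x)"

text \<open>
  The copy in the \<open>n\<close>-th iterate to which \<open>transport n j\<close> descends.
\<close>

fun copy_path :: "nat \<Rightarrow> 'k \<Rightarrow> 'm list" where
  "copy_path 0 j = []"
| "copy_path (Suc n) j = some_copy j # copy_path n (Lam j)"

lemma transport1_Lam: "transport1 j x (Lam j) = x j"
  unfolding transport1_def copy_tuple_def label_map_def edge_at_eq[OF Phi_edges some_copy_mem] by simp

lemma transport1_support:
  assumes "transport1 j x k" obtains j' where "x j'" "Lam j' = k" "some_copy j \<in> ends D (Phi D j')"
proof -
  define e where "e = edge_at D k (some_copy j)"
  have e: "elabel D e = k" "some_copy j \<in> ends D e" using edge_at[of k "some_copy j"] by (auto simp: e_def)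
  have "wedge D x (\<lambda>_. False) e" using assms by (simp add: transport1_def copy_tuple_def e_def)
  then obtain j' where "e = Phi D j'" "x j'" by (cases "e \<in> range (Phi D)") auto
  then show ?thesis using that e unfolding label_map_def by blast
qed

text \<open>
  A marked vertex of the copy can only be occupied if it is an occupied marked vertex of the
  large graph, since \<open>transport1\<close> leaves all unmarked vertices vacant.
\<close>

lemma transport_support:
  "transport n j x k \<Longrightarrow> \<exists>j'. x j' \<and> copy_path n j \<in> Phi_iter D n j'"
proof (induction n arbitrary: j x)
  case 0
  then show ?case by (auto simp: Phi_iter_def)
next
  case (Suc n)
  then obtain k' where k': "transport1 j x k'" "copy_path n (Lam j) \<in> Phi_iter D n k'" by auto
  then obtain j' where "x j'" "Lam j' = k'" "some_copy j \<in> ends D (Phi D j')" using transport1_support by blast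
  with k'(2) show ?case by (auto simp: Phi_iter_Cons)
qed

lemma copy_path_mem: "copy_path n j \<in> Phi_iter D n j"
proof (induction n arbitrary: j)
  case 0
  show ?case by (simp add: Phi_iter_def)
qed (simp add: Phi_iter_Cons some_copy_mem)

text \<open>
  By disjointness, \<open>j\<close> is the only marked vertex of the large graph that lies in this copy.
\<close>

lemma transport_eq_origin:
  assumes "disjoint_family (Phi_iter D n)" "\<not> x j" shows "transport n j x = (\<lambda>_. False)"
proof (rule ext)
  fix k
  have "j' = j" if "copy_path n j \<in> Phi_iter D n j'" for j'
    using assms(1) that copy_path_mem[of n j] unfolding disjoint_family_on_def by blast
  then show "transport n j x k = False" using transport_support[of n j x k] assms(2) by auto
qed

text \<open>
  For \<open>\<sigma> = 1\<close> this bounds the ratio of \<open>v (z(j := True))\<close> and \<open>v (z(j := False))\<close> by \<open>\<kappa>\<close> from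
  above, and for \<open>\<sigma> = -1\<close> by \<open>-\<kappa>\<close> from below. Both values may be 0, so no quotient is formed.
\<close>

definition one_sided_bound :: "real \<Rightarrow> (('k \<Rightarrow> bool) \<Rightarrow> real) \<Rightarrow> 'k \<Rightarrow> real \<Rightarrow> bool" where
  "one_sided_bound \<sigma> v j \<kappa> \<longleftrightarrow> (\<forall>z. \<sigma> * v (z(j := True)) \<le> \<kappa> * v (z(j := False)))"

text \<open>
  A crude lower bound for the share of the states in which prescribed unmarked vertices are
  vacant: emptying them costs a state at most the factor \<open>max 1 l ^ card (edges D)\<close>, and at
  most \<open>card states\<close> states are mapped to the same one.
\<close>

definition \<epsilon> :: real where
  "\<epsilon> = inverse (real (card states) * max 1 l ^ card (edges D))"

lemma eps_bounds: "0 < \<epsilon>" "\<epsilon> \<le> 1"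
proof -
  have "states \<noteq> {}" by (simp add: PiE_eq_empty_iff)
  then have c: "card states \<ge> 1"
    using finite_PiE_inner by (simp add: Suc_le_eq card_gt_0_iff)
  have "1 \<le> max 1 l ^ card (edges D)" by (rule one_le_power) simp
  then have "1 \<le> real (card states) * max 1 l ^ card (edges D)"
    using c mult_mono[of 1 "real (card states)" 1 "max 1 l ^ card (edges D)"] by simp
  moreover define K where "K = real (card states) * max 1 l ^ card (edges D)"
  ultimately have "1 \<le> K" by simp
  then show "0 < \<epsilon>" "\<epsilon> \<le> 1" unfolding \<epsilon>_def K_def[symmetric] by (auto simp: inverse_le_1_iff)
qed

text \<open>
  The vertex \<open>j\<close> lies in one copy only. So the ratio at \<open>j\<close> for \<open>rstep v\<close> is an average, with
  weights \<open>T \<eta> False\<close>, of the ratios at \<open>Lam j\<close> for \<open>v\<close> over the states that the \<open>\<eta>\<close> induce in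
  this copy. In \<open>Z\<close> are those \<open>\<eta>\<close> that leave the unmarked vertices of the copy vacant; they
  all induce the state \<open>transport1 j x\<close>, and their share of the total weight is at least \<open>\<epsilon>\<close>.
\<close>

lemma rstep_contract:
  assumes mon: "removal_bound v" and nn1: "Phi_size j = 1" and bd: "one_sided_bound \<sigma> v (Lam j) \<kappa>"
    and at_t: "\<sigma> * v ((transport1 j x)(Lam j := True)) \<le> \<rho> * v ((transport1 j x)(Lam j := False))"
    and le: "\<rho> \<le> \<kappa>"
  shows "\<sigma> * rstep v (x(j := True)) \<le> (\<kappa> - \<epsilon> * (\<kappa> - \<rho>)) * rstep v (x(j := False))"
proof -
  define i where "i = some_copy j"
  have ends: "ends D (Phi D j) = {i}" using ends_single[OF nn1] by (simp add: i_def)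
  have v: "v z \<ge> 0" for z using mon by (simp add: removal_bound_def)
  define X where "X = states"
  have finX: "finite X" unfolding X_def by (rule finite_PiE_inner)
  define A where "A = {e \<in> inner_edges. i \<in> ends D e}"
  define Z where "Z = {\<eta> \<in> X. \<forall>e\<in>A. \<not> \<eta> e}"
  define T where "T \<eta> b = rterm v ((wedge D x \<eta>)(Phi D j := b))" for \<eta> b
  have T_nonneg: "T \<eta> b \<ge> 0" for \<eta> b unfolding T_def by (intro rterm_nonneg v)
  have T_le: "\<sigma> * T \<eta> True \<le> q * T \<eta> False"
    if q: "\<sigma> * v ((copy_tuple D (wedge D x \<eta>) i)(Lam j := True)) \<le> q * v ((copy_tuple D (wedge D x \<eta>) i)(Lam j := False))" for \<eta> q
  proof -
    obtain R where R: "R \<ge> 0" "\<And>b. rterm v ((wedge D x \<eta>)(Phi D j := b)) = R *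
        (if b then inverse l ^ (card (ends D (Phi D j)) - 1) else 1) *
        (\<Prod>i\<in>ends D (Phi D j). v ((copy_tuple D (wedge D x \<eta>) i)(elabel D (Phi D j) := b)))"
      by (rule rterm_upd[where w = v and y = "wedge D x \<eta>" and e = "Phi D j", OF Phi_edges v]) (rule that)
    have "T \<eta> b = R * v ((copy_tuple D (wedge D x \<eta>) i)(Lam j := b))" for b
      unfolding T_def R(2) ends by (simp add: label_map_def)
    then show ?thesis using mult_left_mono[OF q R(1)] by (simp add: mult_ac)
  qed
  have T_gen: "\<sigma> * T \<eta> True \<le> \<kappa> * T \<eta> False" for \<eta>
    using bd unfolding one_sided_bound_def by (intro T_le) blast
  have T_Z: "\<sigma> * T \<eta> True \<le> \<rho> * T \<eta> False" if "\<eta> \<in> Z" for \<eta>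
  proof (rule T_le)
    have "wedge D x \<eta> (edge_at D k i) = wedge D x (\<lambda>_. False) (edge_at D k i)" for k
      using edge_at[of k i] that by (cases "edge_at D k i \<in> range (Phi D)") (auto simp: Z_def A_def)
    then have "copy_tuple D (wedge D x \<eta>) i = transport1 j x"
      by (auto simp: copy_tuple_def transport1_def i_def[symmetric])
    then show "\<sigma> * v ((copy_tuple D (wedge D x \<eta>) i)(Lam j := True)) \<le> \<rho> * v ((copy_tuple D (wedge D x \<eta>) i)(Lam j := False))"
      using at_t by simp
  qed
  have ZX: "Z \<subseteq> X" unfolding Z_def by blast
  \<comment> \<open>Emptying the vertices in \<open>A\<close> turns any \<open>\<eta>\<close> into an element of \<open>Z\<close>.\<close>
  have sum_Z: "\<epsilon> * (\<Sum>\<eta>\<in>X. T \<eta> False) \<le> (\<Sum>\<eta>\<in>Z. T \<eta> False)"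
  proof -
    have "T \<eta> False \<le> max 1 l ^ card (edges D) * (\<Sum>\<eta>\<in>Z. T \<eta> False)" if \<eta>: "\<eta> \<in> X" for \<eta>
    proof -
      define \<zeta> where "\<zeta> = (\<lambda>e. if e \<in> A then False else \<eta> e)"
      have "\<zeta> \<in> Z" using \<eta> by (auto simp: Z_def X_def \<zeta>_def A_def PiE_iff extensional_def)
      have A_sub: "A \<subseteq> edges D" and A_Phi: "A \<inter> range (Phi D) = {}" unfolding A_def by auto
      have fin_A: "finite A" using A_sub finite_edges by (rule finite_subset)
      have "(\<lambda>e. if e \<in> A then False else ((wedge D x \<eta>)(Phi D j := False)) e) = (wedge D x \<zeta>)(Phi D j := False)"
      proof (rule ext)
        fix e
        show "(if e \<in> A then False else ((wedge D x \<eta>)(Phi D j := False)) e) = ((wedge D x \<zeta>)(Phi D j := False)) e"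
          using A_Phi by (cases "e \<in> range (Phi D)") (auto simp: \<zeta>_def)
      qed
      then have "T \<eta> False \<le> max 1 l ^ card A * T \<zeta> False"
        using rterm_erase[OF mon fin_A A_sub, of "(wedge D x \<eta>)(Phi D j := False)"] unfolding T_def by simp
      also have "\<dots> \<le> max 1 l ^ card (edges D) * T \<zeta> False"
        using card_mono[OF finite_edges A_sub] T_nonneg by (intro mult_right_mono power_increasing) auto
      also have "\<dots> \<le> max 1 l ^ card (edges D) * (\<Sum>\<eta>\<in>Z. T \<eta> False)"
        using \<open>\<zeta> \<in> Z\<close> finite_subset[OF ZX finX] T_nonneg
        by (intro mult_left_mono member_le_sum) auto
      finally show ?thesis .
    qed
    then have "(\<Sum>\<eta>\<in>X. T \<eta> False) \<le> real (card X) * (max 1 l ^ card (edges D) * (\<Sum>\<eta>\<in>Z. T \<eta> False))"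
      by (rule sum_bounded_above)
    also have "\<dots> = (\<Sum>\<eta>\<in>Z. T \<eta> False) / \<epsilon>" by (simp add: \<epsilon>_def X_def divide_inverse mult_ac)
    finally show ?thesis using eps_bounds(1) by (simp add: field_simps)
  qed
  have "\<sigma> * rstep v (x(j := True)) = (\<Sum>\<eta>\<in>X. \<sigma> * T \<eta> True)"
    by (simp add: rstep_upd T_def X_def sum_distrib_left)
  also have "\<dots> \<le> (\<Sum>\<eta>\<in>X. \<kappa> * T \<eta> False - (if \<eta> \<in> Z then (\<kappa> - \<rho>) * T \<eta> False else 0))"
    using T_gen T_Z by (intro sum_mono) (auto simp: algebra_simps)
  also have "\<dots> = \<kappa> * (\<Sum>\<eta>\<in>X. T \<eta> False) - (\<kappa> - \<rho>) * (\<Sum>\<eta>\<in>Z. T \<eta> False)"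
    using ZX finX by (simp add: sum_subtractf sum_distrib_left sum.If_cases Int_absorb1)
  also have "\<dots> \<le> \<kappa> * (\<Sum>\<eta>\<in>X. T \<eta> False) - (\<kappa> - \<rho>) * (\<epsilon> * (\<Sum>\<eta>\<in>X. T \<eta> False))"
    using mult_left_mono[OF sum_Z, of "\<kappa> - \<rho>"] le by simp
  also have "\<dots> = (\<kappa> - \<epsilon> * (\<kappa> - \<rho>)) * rstep v (x(j := False))"
    by (simp add: rstep_upd T_def X_def algebra_simps)
  finally show ?thesis .
qed

lemma one_sided_bound_rstep:
  assumes "removal_bound v" "Phi_size j = 1" "one_sided_bound \<sigma> v (Lam j) \<kappa>" shows "one_sided_bound \<sigma> (rstep v) j \<kappa>"
  unfolding one_sided_bound_def
proof
  fix z
  have "\<sigma> * v ((transport1 j z)(Lam j := True)) \<le> \<kappa> * v ((transport1 j z)(Lam j := False))"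
    using assms(3) unfolding one_sided_bound_def by blast
  from rstep_contract[OF assms this] show "\<sigma> * rstep v (z(j := True)) \<le> \<kappa> * rstep v (z(j := False))" by simp
qed

lemma one_sided_bound_rstep_iter:
  assumes "nondegenerate D" "removal_bound w"
  shows "periodic_label D j \<Longrightarrow> one_sided_bound \<sigma> w ((Lam ^^ n) j) \<kappa> \<Longrightarrow> one_sided_bound \<sigma> ((rstep ^^ n) w) j \<kappa>"
proof (induction n arbitrary: j)
  case (Suc n)
  have "one_sided_bound \<sigma> ((rstep ^^ n) w) (Lam j) \<kappa>"
    using Suc.prems(2) periodic_Lam[OF Suc.prems(1)] by (intro Suc.IH) (simp_all add: funpow_swap1)
  then show ?case
    using one_sided_bound_rstep[OF removal_bound_rstep_iter[OF assms(2)] Phi_size_periodic[OF assms(1) Suc.prems(1)]] by simp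
qed simp

text \<open>
  Applying the averages of the single steps one after the other, the transported state retains
  the share \<open>\<epsilon>\<close> at each step.
\<close>

lemma rstep_iter_contract:
  assumes nd: "nondegenerate D" and mon: "removal_bound w" and le: "\<rho> \<le> \<kappa>"
  shows "periodic_label D j \<Longrightarrow> one_sided_bound \<sigma> w ((Lam ^^ n) j) \<kappa> \<Longrightarrow> \<not> x j \<Longrightarrow>
    \<sigma> * w ((transport n j x)((Lam ^^ n) j := True)) \<le> \<rho> * w ((transport n j x)((Lam ^^ n) j := False)) \<Longrightarrow>
    \<sigma> * (rstep ^^ n) w (x(j := True)) \<le> (\<kappa> - \<epsilon> ^ n * (\<kappa> - \<rho>)) * (rstep ^^ n) w (x(j := False))"
proof (induction n arbitrary: j x)
  case (Suc n)
  have swap: "(Lam ^^ Suc n) j = (Lam ^^ n) (Lam j)" by (simp add: funpow_swap1)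
  have per: "periodic_label D (Lam j)" using periodic_Lam[OF Suc.prems(1)] .
  have bd0: "one_sided_bound \<sigma> w ((Lam ^^ n) (Lam j)) \<kappa>" using Suc.prems(2) unfolding swap .
  have ih: "\<sigma> * (rstep ^^ n) w ((transport1 j x)(Lam j := True)) \<le>
      (\<kappa> - \<epsilon> ^ n * (\<kappa> - \<rho>)) * (rstep ^^ n) w ((transport1 j x)(Lam j := False))"
  proof (rule Suc.IH[OF per bd0])
    show "\<not> transport1 j x (Lam j)" using Suc.prems(3) by (simp add: transport1_Lam)
    show "\<sigma> * w ((transport n (Lam j) (transport1 j x))((Lam ^^ n) (Lam j) := True)) \<le>
        \<rho> * w ((transport n (Lam j) (transport1 j x))((Lam ^^ n) (Lam j) := False))"
      using Suc.prems(4) unfolding swap transport.simps .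
  qed
  have le': "\<kappa> - \<epsilon> ^ n * (\<kappa> - \<rho>) \<le> \<kappa>" using le eps_bounds(1) by simp
  have "\<sigma> * rstep ((rstep ^^ n) w) (x(j := True)) \<le>
      (\<kappa> - \<epsilon> * (\<kappa> - (\<kappa> - \<epsilon> ^ n * (\<kappa> - \<rho>)))) * rstep ((rstep ^^ n) w) (x(j := False))"
    by (rule rstep_contract[OF removal_bound_rstep_iter[OF mon] Phi_size_periodic[OF nd Suc.prems(1)] one_sided_bound_rstep_iter[OF nd mon per bd0] ih le'])
  moreover have "\<kappa> - \<epsilon> * (\<kappa> - (\<kappa> - \<epsilon> ^ n * (\<kappa> - \<rho>))) = \<kappa> - \<epsilon> ^ Suc n * (\<kappa> - \<rho>)" by simp
  ultimately show ?case unfolding funpow.simps comp_def by (simp only:)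
qed simp

text \<open>
  The ratios at label \<open>j\<close> lie in an interval of length at most \<open>\<delta>\<close>. If \<open>\<delta>\<close> could be taken 0
  for all \<open>j\<close>, then \<open>w\<close> would satisfy the equations of \<open>M_var\<close>.
\<close>

definition ratio_spread :: "(('k \<Rightarrow> bool) \<Rightarrow> real) \<Rightarrow> 'k \<Rightarrow> real \<Rightarrow> bool" where
  "ratio_spread w j \<delta> \<longleftrightarrow> (\<exists>lo hi. 0 \<le> lo \<and> lo \<le> hi \<and> hi \<le> l \<and> hi - lo \<le> \<delta> \<and> one_sided_bound 1 w j hi \<and> one_sided_bound (-1) w j (- lo))"

lemma ratio_spread_mono: "ratio_spread w j \<delta> \<Longrightarrow> \<delta> \<le> \<delta>' \<Longrightarrow> ratio_spread w j \<delta>'"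
  unfolding ratio_spread_def by (meson order_trans)

lemma ratio_spread_init: "removal_bound w \<Longrightarrow> ratio_spread w j l"
  unfolding ratio_spread_def using l by (intro exI[of _ 0] exI[of _ l]) (auto simp: one_sided_bound_def removal_bound_def)

text \<open>
  Once the transported state is vacant whatever the state outside, all averages contain the
  same ratio \<open>\<rho>\<close> with the same share \<open>\<epsilon> ^ n\<close>, and both ends of the interval move towards \<open>\<rho>\<close>.
\<close>

lemma ratio_spread_contract:
  assumes nd: "nondegenerate D" and disj: "disjoint_family (Phi_iter D n)" and mon: "removal_bound w"
    and per: "periodic_label D j" and width: "ratio_spread w ((Lam ^^ n) j) \<delta>"
  shows "ratio_spread ((rstep ^^ n) w) j ((1 - \<epsilon> ^ n) * \<delta>)"
proof -
  define k where "k = (Lam ^^ n) j"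
  obtain lo hi where lh: "0 \<le> lo" "lo \<le> hi" "hi \<le> l" "hi - lo \<le> \<delta>" and bd: "one_sided_bound 1 w k hi" "one_sided_bound (-1) w k (- lo)"
    using width unfolding ratio_spread_def k_def by blast
  define O0 :: "'k \<Rightarrow> bool" where "O0 = (\<lambda>_. False)"
  have O0_upd: "O0(k := False) = O0" by (rule ext) (simp add: O0_def)
  have w0: "w O0 > 0" using mon by (simp add: removal_bound_def O0_def)
  define \<rho> where "\<rho> = w (O0(k := True)) / w O0"
  have at: "w (O0(k := True)) = \<rho> * w (O0(k := False))" using w0 by (simp add: \<rho>_def O0_upd)
  have \<rho>: "lo \<le> \<rho>" "\<rho> \<le> hi"
    using bd[unfolded one_sided_bound_def, THEN spec, of O0] w0 unfolding O0_upd \<rho>_def by (simp_all add: field_simps)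
  define E where "E = \<epsilon> ^ n"
  have E: "0 \<le> E" "E \<le> 1" using eps_bounds unfolding E_def by (auto intro: power_le_one)
  have key: "one_sided_bound \<sigma> ((rstep ^^ n) w) j (\<kappa> - E * (\<kappa> - \<rho>'))"
    if b: "one_sided_bound \<sigma> w k \<kappa>" and r: "\<rho>' \<le> \<kappa>" "\<sigma> * w (O0(k := True)) \<le> \<rho>' * w (O0(k := False))" for \<sigma> \<kappa> \<rho>'
    unfolding one_sided_bound_def
  proof
    fix z
    have tr: "transport n j (z(j := False)) = O0"
      unfolding O0_def by (rule transport_eq_origin[OF disj]) simp
    have "\<sigma> * (rstep ^^ n) w ((z(j := False))(j := True)) \<le>
        (\<kappa> - \<epsilon> ^ n * (\<kappa> - \<rho>')) * (rstep ^^ n) w ((z(j := False))(j := False))"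
      by (rule rstep_iter_contract[OF nd mon r(1) per b[unfolded k_def]]) (use r(2) in \<open>simp_all add: tr k_def\<close>)
    then show "\<sigma> * (rstep ^^ n) w (z(j := True)) \<le> (\<kappa> - E * (\<kappa> - \<rho>')) * (rstep ^^ n) w (z(j := False))"
      by (simp add: E_def)
  qed
  have up: "one_sided_bound 1 ((rstep ^^ n) w) j (hi - E * (hi - \<rho>))"
    using key[OF bd(1), of \<rho>] \<rho> at by simp
  have low: "one_sided_bound (-1) ((rstep ^^ n) w) j (- (lo + E * (\<rho> - lo)))"
    using key[OF bd(2), of "- \<rho>"] \<rho> at by (simp add: algebra_simps)
  have Erho: "0 \<le> E * (\<rho> - lo)" "0 \<le> E * (hi - \<rho>)" using E \<rho> by simp_all
  have diff: "hi - E * (hi - \<rho>) - (lo + E * (\<rho> - lo)) = (1 - E) * (hi - lo)" by (simp add: algebra_simps)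
  have "(1 - E) * (hi - lo) \<le> (1 - E) * \<delta>" "0 \<le> (1 - E) * (hi - lo)"
    using E lh by (auto intro: mult_left_mono)
  then show ?thesis
    unfolding ratio_spread_def E_def[symmetric] using up low lh Erho diff
    by (intro exI[of _ "lo + E * (\<rho> - lo)"] exI[of _ "hi - E * (hi - \<rho>)"] conjI) linarith+
qed

text \<open>
  For a vertex glued from several copies, the interval changes by the function \<open>f\<close>, whose
  derivative on \<open>[0, l]\<close> is at most the number of copies.
\<close>

lemma ratio_spread_step:
  assumes mon: "removal_bound w" and width: "ratio_spread w (Lam j) \<delta>"
  shows "ratio_spread (rstep w) j (real (Phi_size j) * \<delta>)"
proof -
  obtain lo hi where lh: "0 \<le> lo" "lo \<le> hi" "hi \<le> l" "hi - lo \<le> \<delta>" and bd: "one_sided_bound 1 w (Lam j) hi" "one_sided_bound (-1) w (Lam j) (- lo)"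
    using width unfolding ratio_spread_def by blast
  obtain m where m: "Phi_size j = Suc m" using Phi_size_pos[of j] by (cases "Phi_size j") auto
  define f where "f c = c ^ Suc m * inverse l ^ m" for c
  have card: "card (ends D (Phi D j)) = Suc m" using m by (simp add: Phi_size_def)
  have w: "w z \<ge> 0" for z using mon by (simp add: removal_bound_def)
  have up: "one_sided_bound 1 (rstep w) j (f hi)"
    unfolding one_sided_bound_def
  proof
    fix z
    have "rterm w ((wedge D z \<eta>)(Phi D j := True)) \<le> f hi * rterm w ((wedge D z \<eta>)(Phi D j := False))" for \<eta>
      using rterm_upd_le[where w = w and e = "Phi D j" and c = hi and y = "wedge D z \<eta>", OF Phi_edges w] bd(1) lh unfolding one_sided_bound_def card f_def label_map_def by simp
    then show "1 * rstep w (z(j := True)) \<le> f hi * rstep w (z(j := False))"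
      unfolding rstep_upd sum_distrib_left mult_1 by (intro sum_mono)
  qed
  have low: "one_sided_bound (-1) (rstep w) j (- f lo)"
    unfolding one_sided_bound_def
  proof
    fix z
    have "f lo * rterm w ((wedge D z \<eta>)(Phi D j := False)) \<le> rterm w ((wedge D z \<eta>)(Phi D j := True))" for \<eta>
      using rterm_upd_ge[where w = w and e = "Phi D j" and c = lo and y = "wedge D z \<eta>", OF Phi_edges w] bd(2) lh unfolding one_sided_bound_def card f_def label_map_def by simp
    then have "f lo * rstep w (z(j := False)) \<le> rstep w (z(j := True))"
      unfolding rstep_upd sum_distrib_left by (intro sum_mono)
    then show "-1 * rstep w (z(j := True)) \<le> - f lo * rstep w (z(j := False))" by simp
  qed
  have "0 \<le> hi * inverse l" "hi * inverse l \<le> 1" using lh l by (simp_all add: field_simps)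
  then have ratio: "(hi * inverse l) ^ m \<le> 1" "0 \<le> (hi * inverse l) ^ m"
    by (simp_all only: power_le_one zero_le_power)
  have "f hi = hi * (hi * inverse l) ^ m" by (simp add: f_def power_mult_distrib)
  also have "\<dots> \<le> hi" using ratio lh mult_left_mono[of "(hi * inverse l) ^ m" 1 hi] by simp
  finally have f_hi: "f hi \<le> l" using lh by simp
  have "f lo \<le> f hi" unfolding f_def using lh l by (intro mult_right_mono power_mono) auto
  moreover have "0 \<le> f lo" using lh l by (simp add: f_def)
  moreover have "f hi - f lo \<le> real (Phi_size j) * \<delta>"
  proof -
    have "f hi - f lo = (hi ^ Suc m - lo ^ Suc m) * inverse l ^ m" by (simp add: f_def algebra_simps)
    also have "\<dots> \<le> (real (Suc m) * hi ^ m * (hi - lo)) * inverse l ^ m"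
      using power_diff_le[OF lh(1,2), of m] l by (intro mult_right_mono) auto
    also have "\<dots> = (hi * inverse l) ^ m * (real (Suc m) * (hi - lo))" by (simp add: power_mult_distrib mult_ac)
    also have "\<dots> \<le> 1 * (real (Suc m) * (hi - lo))" using ratio lh by (intro mult_right_mono) auto
    also have "\<dots> \<le> real (Phi_size j) * \<delta>" using lh unfolding m by (simp add: mult_left_mono)
    finally show ?thesis .
  qed
  ultimately show ?thesis unfolding ratio_spread_def using up low f_hi by blast
qed

lemma periodic_Lam_iter: "periodic_label D j \<Longrightarrow> periodic_label D ((Lam ^^ n) j)"
  by (induction n) (auto intro: periodic_Lam)

lemma ratio_spread_periodic:
  assumes nd: "nondegenerate D" and disj: "disjoint_family (Phi_iter D n)"
  shows "removal_bound w \<Longrightarrow> periodic_label D j \<Longrightarrow> ratio_spread ((rstep ^^ (n * t)) w) j ((1 - \<epsilon> ^ n) ^ t * l)"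
proof (induction t arbitrary: j)
  case 0
  then show ?case by (simp add: ratio_spread_init)
next
  case (Suc t)
  have "ratio_spread ((rstep ^^ (n * t)) w) ((Lam ^^ n) j) ((1 - \<epsilon> ^ n) ^ t * l)"
    by (rule Suc.IH[OF Suc.prems(1) periodic_Lam_iter[OF Suc.prems(2)]])
  from ratio_spread_contract[OF nd disj removal_bound_rstep_iter[OF Suc.prems(1)] Suc.prems(2) this]
  show ?case by (simp add: funpow_add mult_ac)
qed

text \<open>
  The ratios at periodic labels contract, and any label becomes periodic after finitely many
  steps, each of which enlarges the interval by a bounded factor only.
\<close>

lemma eventually_ratio_spread:
  assumes nd: "nondegenerate D" and exp: "expanding D" and mon: "removal_bound w"
  shows "periodic_label D ((Lam ^^ M) j) \<Longrightarrow> \<delta> > 0 \<Longrightarrow> eventually (\<lambda>s. ratio_spread ((rstep ^^ s) w) j \<delta>) sequentially"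
proof (induction M arbitrary: j \<delta>)
  case 0
  obtain n where n: "disjoint_family (Phi_iter D n)" using exp unfolding expanding_def by blast
  have "0 < \<epsilon> ^ n" "\<epsilon> ^ n \<le> 1" using eps_bounds by (auto intro: power_le_one)
  then obtain t where t: "(1 - \<epsilon> ^ n) ^ t < \<delta> / l"
    using real_arch_pow_inv[of "\<delta> / l" "1 - \<epsilon> ^ n"] 0 l by auto
  have "ratio_spread ((rstep ^^ s) w) j \<delta>" if "s \<ge> n * t" for s
  proof -
    have "(rstep ^^ s) w = (rstep ^^ (n * t)) ((rstep ^^ (s - n * t)) w)"
      using that by (metis comp_apply funpow_add le_add_diff_inverse)
    then have "ratio_spread ((rstep ^^ s) w) j ((1 - \<epsilon> ^ n) ^ t * l)"
      using ratio_spread_periodic[OF nd n removal_bound_rstep_iter[OF mon]] 0 by simp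
    then show ?thesis by (rule ratio_spread_mono) (use t l in \<open>simp add: field_simps\<close>)
  qed
  then show ?case unfolding eventually_sequentially by blast
next
  case (Suc M)
  have "eventually (\<lambda>s. ratio_spread ((rstep ^^ s) w) (Lam j) (\<delta> / real (Phi_size j))) sequentially"
    using Suc.prems Phi_size_pos[of j] by (intro Suc.IH) (simp_all add: funpow_swap1)
  then have "eventually (\<lambda>s. ratio_spread ((rstep ^^ Suc s) w) j \<delta>) sequentially"
  proof eventually_elim
    case (elim s)
    from ratio_spread_step[OF removal_bound_rstep_iter[OF mon] this] Phi_size_pos[of j] show ?case by simp
  qed
  then show ?case by (simp only: eventually_sequentially_Suc[of "\<lambda>s. ratio_spread ((rstep ^^ s) w) j \<delta>"])
qed

lemma eventually_periodic: "\<exists>M. periodic_label D ((Lam ^^ M) j)"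
proof -
  have "\<not> inj (\<lambda>M. (Lam ^^ M) j)"
    using finite_imageD[of "\<lambda>M. (Lam ^^ M) j" UNIV] by (metis finite infinite_UNIV_nat)
  then obtain M M' where M: "M < M'" "(Lam ^^ M) j = (Lam ^^ M') j"
    unfolding inj_def by (metis linorder_neqE_nat)
  have "(Lam ^^ (M' - M)) ((Lam ^^ M) j) = (Lam ^^ (M' - M + M)) j" by (simp add: funpow_add)
  also have "\<dots> = (Lam ^^ M) j" using M by simp
  finally show ?thesis unfolding periodic_label_def using M(1) by (metis Suc_leI One_nat_def zero_less_diff)
qed

lemma orbit_limit_in_M_var:
  assumes nd: "nondegenerate D" and exp: "expanding D" and mon: "removal_bound w" and s: "strict_mono s"
    and lim: "(\<lambda>i. abs_proj (\<chi> x. complex_of_real ((rstep ^^ s i) w x))) \<longlonglongrightarrow> \<xi>"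
  shows "\<xi> \<in> M_var"
proof (rule limit_in_M_var[OF _ lim])
  define V where "V n = (\<chi> x. complex_of_real ((rstep ^^ n) w x))" for n
  have pos: "(rstep ^^ n) w (\<lambda>_. False) > 0" "(rstep ^^ n) w x \<ge> 0" for n x
    using removal_bound_rstep_iter[OF mon, of n] by (auto simp: removal_bound_def)
  show "(\<chi> x. complex_of_real ((rstep ^^ s i) w x)) \<noteq> 0" for i
    using pos(1)[of "s i"] by (auto simp: cart_eq_iff intro!: exI[of _ "\<lambda>_. False"])
  fix j x y and \<delta> :: real assume \<delta>: "\<delta> > 0"
  obtain M where "periodic_label D ((Lam ^^ M) j)" using eventually_periodic by blast
  from eventually_ratio_spread[OF nd exp mon this \<delta>]
  have "eventually (\<lambda>i. ratio_spread ((rstep ^^ s i) w) j \<delta>) sequentially"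
    using s by (rule eventually_subseq[rotated])
  then show "eventually (\<lambda>i. cmod ((\<chi> x. complex_of_real ((rstep ^^ s i) w x)) $ (x(j := True)) *
        (\<chi> x. complex_of_real ((rstep ^^ s i) w x)) $ (y(j := False)) -
      (\<chi> x. complex_of_real ((rstep ^^ s i) w x)) $ (x(j := False)) *
        (\<chi> x. complex_of_real ((rstep ^^ s i) w x)) $ (y(j := True)))
      \<le> \<delta> * (norm (\<chi> x. complex_of_real ((rstep ^^ s i) w x)))\<^sup>2) sequentially"
  proof eventually_elim
    case (elim i)
    define W where "W = (rstep ^^ s i) w"
    obtain lo hi where lh: "hi - lo \<le> \<delta>" and bd: "one_sided_bound 1 W j hi" "one_sided_bound (-1) W j (- lo)"
      using elim unfolding ratio_spread_def W_def by blast
    have W: "W z \<ge> 0" for z unfolding W_def by (rule pos)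
    have b: "lo * W (z(j := False)) \<le> W (z(j := True))" "W (z(j := True)) \<le> hi * W (z(j := False))" for z
      using bd[unfolded one_sided_bound_def, THEN spec, of z] by simp_all
    have "W (x(j := True)) * W (y(j := False)) \<le> hi * W (x(j := False)) * W (y(j := False))"
      "lo * W (x(j := False)) * W (y(j := False)) \<le> W (x(j := True)) * W (y(j := False))"
      "W (x(j := False)) * W (y(j := True)) \<le> W (x(j := False)) * (hi * W (y(j := False)))"
      "W (x(j := False)) * (lo * W (y(j := False))) \<le> W (x(j := False)) * W (y(j := True))"
      using b W by (auto intro: mult_right_mono mult_left_mono)
    then have "\<bar>W (x(j := True)) * W (y(j := False)) - W (x(j := False)) * W (y(j := True))\<bar> \<le>
        (hi - lo) * (W (x(j := False)) * W (y(j := False)))"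
      by (simp add: algebra_simps abs_le_iff)
    also have "\<dots> \<le> \<delta> * (W (x(j := False)) * W (y(j := False)))"
      using lh W by (intro mult_right_mono) auto
    also have "\<dots> \<le> \<delta> * (norm (V (s i)) * norm (V (s i)))"
    proof -
      have "W z \<le> norm (V (s i))" for z
        using Finite_Cartesian_Product.norm_nth_le[of "V (s i)" z] W[of z] by (simp add: V_def W_def)
      then show ?thesis using \<delta> W by (intro mult_left_mono mult_mono) auto
    qed
    finally have "\<bar>W (x(j := True)) * W (y(j := False)) - W (x(j := False)) * W (y(j := True))\<bar> \<le> \<delta> * (norm (V (s i)))\<^sup>2"
      by (simp add: power2_eq_square)
    moreover have "cmod (complex_of_real a * complex_of_real b - complex_of_real c * complex_of_real d) = \<bar>a * b - c * d\<bar>" for a b c d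
      by (metis norm_of_real of_real_diff of_real_mult)
    ultimately show ?case by (simp add: V_def W_def)
  qed
qed

text \<open>
  Removing the marked vertex \<open>v\<close> is an injection from the independent sets that contain \<open>v\<close> to
  those that do not.
\<close>

lemma removal_bound_marked_graph:
  fixes G :: "('v, 'k) mgraph"
  assumes G: "marked_graph G"
  shows "\<exists>w. removal_bound w \<and> (\<forall>x. indep_poly G x (complex_of_real l) = complex_of_real (w x))"
proof -
  define S where "S x = {I. independent_set G I \<and> (\<forall>j. gmark G j \<in> I \<longleftrightarrow> x j)}" for x
  define w where "w x = (\<Sum>I\<in>S x. l ^ card I)" for x
  have fin: "finite (S x)" for x
    by (rule finite_subset[of _ "Pow (gverts G)"]) (use G in \<open>auto simp: S_def independent_set_def marked_graph_def\<close>)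
  have nonneg: "w x \<ge> 0" for x unfolding w_def using l by (intro sum_nonneg) auto
  have flip: "w (z(j := True)) \<le> l * w (z(j := False))" for j z
  proof -
    define v where "v = gmark G j"
    have v_eq: "gmark G j' = v \<longleftrightarrow> j' = j" for j' using G unfolding marked_graph_def v_def by (auto dest: injD)
    have v_in: "v \<in> I" if "I \<in> S (z(j := True))" for I using that unfolding S_def v_def by auto
    have inj: "inj_on (\<lambda>I. I - {v}) (S (z(j := True)))"
      using v_in by (intro inj_onI) (metis insert_Diff)
    have img: "(\<lambda>I. I - {v}) ` S (z(j := True)) \<subseteq> S (z(j := False))"
      using v_eq unfolding S_def independent_set_def by auto
    have "w (z(j := True)) = (\<Sum>I\<in>S (z(j := True)). l * l ^ card (I - {v}))"
      unfolding w_def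
    proof (intro sum.cong refl)
      fix I assume I: "I \<in> S (z(j := True))"
      have "finite I" using I G by (auto simp: S_def independent_set_def marked_graph_def intro: finite_subset)
      then have "card I = Suc (card (I - {v}))" using v_in[OF I] by (rule card.remove)
      then show "l ^ card I = l * l ^ card (I - {v})" by simp
    qed
    also have "\<dots> = l * (\<Sum>I\<in>(\<lambda>I. I - {v}) ` S (z(j := True)). l ^ card I)"
      by (simp add: sum.reindex[OF inj] sum_distrib_left)
    also have "\<dots> \<le> l * w (z(j := False))"
      unfolding w_def using l fin img by (intro mult_left_mono sum_mono2) auto
    finally show ?thesis .
  qed
  have "{} \<in> S (\<lambda>_. False)" using G by (auto simp: S_def independent_set_def marked_graph_def)
  then have "w (\<lambda>_. False) > 0" unfolding w_def using fin l by (intro sum_pos2[of _ "{}"]) auto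
  then have "removal_bound w" unfolding removal_bound_def using nonneg flip by blast
  moreover have "indep_poly G x (complex_of_real l) = complex_of_real (w x)" for x
    by (simp add: indep_poly_def w_def S_def)
  ultimately show ?thesis by blast
qed

lemma graph_orbit:
  fixes G :: "('v, 'k) mgraph"
  assumes nd: "nondegenerate D" and exp: "expanding D" and G: "marked_graph G"
  shows "graph_point (of_real l) G \<notin> renorm_indet D (of_real l) n"
    and "strict_mono s \<Longrightarrow> (\<lambda>i. renorm_map D (of_real l) (s i) (graph_point (of_real l) G)) \<longlonglongrightarrow> \<xi> \<Longrightarrow> \<xi> \<in> M_var"
proof -
  obtain w where w: "removal_bound w" "\<And>x. indep_poly G x (complex_of_real l) = complex_of_real (w x)"
    using removal_bound_marked_graph[OF G] by blast
  define V where "V n = (\<chi> x. complex_of_real ((rstep ^^ n) w x))" for n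
  have gp: "graph_point (of_real l) G = abs_proj (V 0)" by (simp add: graph_point_def w(2) V_def)
  have Vn: "(Fhat ^^ n) (V 0) = V n" for n using renorm_hat_iter_of_real[of n w] by (simp add: V_def)
  have nz: "V n \<noteq> 0" for n
    using removal_bound_rstep_iter[OF w(1), of n] unfolding V_def removal_bound_def
    by (auto simp: cart_eq_iff intro!: exI[of _ "\<lambda>_. False"])
  show "graph_point (of_real l) G \<notin> renorm_indet D (of_real l) n"
    unfolding gp indet_iter[OF nz] Vn by (rule nz)
  assume s: "strict_mono s" and lim: "(\<lambda>i. renorm_map D (of_real l) (s i) (graph_point (of_real l) G)) \<longlonglongrightarrow> \<xi>"
  have "renorm_map D (of_real l) n (graph_point (of_real l) G) = abs_proj (V n)" for n
    using proj_map_iter[OF nz[of 0], of n] nz[of n] unfolding gp Vn by blast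
  with lim have "(\<lambda>i. abs_proj (V (s i))) \<longlonglongrightarrow> \<xi>" by simp
  then show "\<xi> \<in> M_var" unfolding V_def by (rule orbit_limit_in_M_var[OF nd exp w(1) s])
qed

end


section \<open>The theorem\<close>

theorem theorem1p3:
  fixes D :: "('e, 'k::finite, 'm::finite) gluing" and lam :: complex
  assumes "CARD('m) \<ge> 2" and "gluing_data D" and "lam \<noteq> 0"
  shows
    "proj_variety (M_var :: ('k \<Rightarrow> bool) proj set) \<and>
     proj_dim (M_var :: ('k \<Rightarrow> bool) proj set) CARD('k) \<and>
     renorm_map D lam 1 ` (M_var - renorm_indet D lam 1) \<subseteq> M_var \<and>
     (\<forall>N\<ge>1. label_map D ^^ (2 * N) = label_map D ^^ N \<longrightarrow>
        M0_var D lam N \<subseteq> M_var \<and>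
        (nondegenerate D \<longrightarrow>
           proj_variety (M0_var D lam N) \<and>
           (\<exists>k0\<le>CARD('k). proj_dim (M0_var D lam N) k0) \<and>
           renorm_map D lam N ` (M_var - renorm_indet D lam N) \<subseteq> M0_var D lam N \<and>
           (\<forall>\<xi> \<in> M0_var D lam N - renorm_indet D lam N. renorm_map D lam N \<xi> = \<xi>)) \<and>
        (nondegenerate D \<and> expanding D \<longrightarrow>
           transversally_superattracting (renorm_map D lam N)
             (M0_var D lam N - renorm_indet D lam N))) \<and>
     (nondegenerate D \<and> expanding D \<and> lam \<in> \<real> \<and> Re lam > 0 \<longrightarrow>
        (\<forall>G0 :: ('v, 'k) mgraph. marked_graph G0 \<longrightarrow>
           (\<forall>n. graph_point lam G0 \<notin> renorm_indet D lam n) \<and>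
           (\<forall>\<xi>. (\<exists>s. strict_mono s \<and>
                    (\<lambda>i. renorm_map D lam (s i) (graph_point lam G0)) \<longlonglongrightarrow> \<xi>)
                \<longrightarrow> \<xi> \<in> M_var)))"
proof -
  interpret gluing_recursion D lam using assms(2,3) by unfold_locales
  have invariant: "renorm_map D lam 1 ` (M_var - renorm_indet D lam 1) \<subseteq> M_var"
    by (rule renorm_map_M_subset)
  have retraction: "M0_var D lam N \<subseteq> M_var \<and>
      (nondegenerate D \<longrightarrow>
         proj_variety (M0_var D lam N) \<and>
         (\<exists>k0\<le>CARD('k). proj_dim (M0_var D lam N) k0) \<and>
         renorm_map D lam N ` (M_var - renorm_indet D lam N) \<subseteq> M0_var D lam N \<and>
         (\<forall>\<xi> \<in> M0_var D lam N - renorm_indet D lam N. renorm_map D lam N \<xi> = \<xi>)) \<and>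
      (nondegenerate D \<and> expanding D \<longrightarrow>
         transversally_superattracting (renorm_map D lam N) (M0_var D lam N - renorm_indet D lam N))"
    if N: "N \<ge> 1" "label_map D ^^ (2 * N) = label_map D ^^ N" for N
  proof (cases "nondegenerate D")
    case True
    interpret retracting_recursion D lam N using N True by unfold_locales
    have "\<exists>k0\<le>CARD('k). proj_dim (M0_var D lam N) k0"
      using G.proj_dim_graph_variety card_range_le unfolding M0_eq_graph_variety by blast
    show ?thesis
    proof (intro conjI impI ballI)
      show "M0_var D lam N \<subseteq> M_var" by (rule M0_subset_M)
      show "proj_variety (M0_var D lam N)"
        unfolding M0_eq_graph_variety by (rule G.proj_variety_graph_variety)
      show "\<exists>k0\<le>CARD('k). proj_dim (M0_var D lam N) k0" by fact
      show "renorm_map D lam N ` (M_var - renorm_indet D lam N) \<subseteq> M0_var D lam N"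
        unfolding M0_eq_graph_variety by (rule image_in_graph_variety)
      show "renorm_map D lam N \<xi> = \<xi>" if "\<xi> \<in> M0_var D lam N - renorm_indet D lam N" for \<xi>
        using that unfolding M0_eq_graph_variety by (rule graph_variety_fixed)
      show "transversally_superattracting (renorm_map D lam N) (M0_var D lam N - renorm_indet D lam N)"
        if "nondegenerate D \<and> expanding D" using that by (intro M0_superattracting) simp
    qed
  next
    case False
    then show ?thesis using M0_subset_M by simp
  qed
  have convergence: "(\<forall>n. graph_point lam G0 \<notin> renorm_indet D lam n) \<and>
      (\<forall>\<xi>. (\<exists>s. strict_mono s \<and> (\<lambda>i. renorm_map D lam (s i) (graph_point lam G0)) \<longlonglongrightarrow> \<xi>) \<longrightarrow> \<xi> \<in> M_var)"
    if nd: "nondegenerate D" and exp: "expanding D" and pos: "lam \<in> \<real>" "Re lam > 0" and G0: "marked_graph G0"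
    for G0 :: "('v, 'k) mgraph"
  proof -
    have lam_eq: "lam = complex_of_real (Re lam)" using pos(1) by simp
    have pos_rec: "positive_recursion D (Re lam)"
      unfolding positive_recursion_def gluing_recursion_def positive_recursion_axioms_def lam_eq[symmetric]
      using assms(2,3) pos(2) by simp
    note orbit = positive_recursion.graph_orbit[OF pos_rec nd exp G0, unfolded lam_eq[symmetric]]
    show ?thesis
    proof (intro conjI allI impI)
      show "graph_point lam G0 \<notin> renorm_indet D lam n" for n by (rule orbit(1))
      fix \<xi>
      assume "\<exists>s. strict_mono s \<and> (\<lambda>i. renorm_map D lam (s i) (graph_point lam G0)) \<longlonglongrightarrow> \<xi>"
      then obtain s where "strict_mono s" "(\<lambda>i. renorm_map D lam (s i) (graph_point lam G0)) \<longlonglongrightarrow> \<xi>"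
        by (elim exE conjE)
      then show "\<xi> \<in> M_var" by (rule orbit(2))
    qed
  qed
  show ?thesis
  proof (intro conjI)
    show "proj_variety (M_var :: ('k \<Rightarrow> bool) proj set)" by (rule proj_variety_M)
    show "proj_dim (M_var :: ('k \<Rightarrow> bool) proj set) CARD('k)" by (rule proj_dim_M)
    show "renorm_map D lam 1 ` (M_var - renorm_indet D lam 1) \<subseteq> M_var" by (rule invariant)
  qed (intro allI impI, rule retraction, assumption+, intro allI impI, elim conjE, rule convergence, assumption+)
qed

end
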